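(* Let $X=(X,d,\mu)$ be a doubling metric measure space and let $\mathcal B$ be a differentiation basis on $X$. Let either $\mathcal F\in\{N^s_{p,q}(X),M^s_{p,q}(X)\}$, where $0<s<1$ and $0<p,q<\infty$, or $\mathcal F=M^s_{p,\infty}(X)=M^{s,p}(X)$, where $0<s\le1$ and $0<p<\infty$. Then the following claims are equivalent. (1) For every $\mathcal F$-quasicontinuous $u\in\mathcal F$, there exists a set $E\subset X$ with $C_{\mathcal F}(E)=0$ such that \[\lim_{\mathcal B\ni B\to x}m^\gamma_u(B)=u(x)\] for every $0<\gamma<1$ and $x\in X\setminus E$. (2) For every $0<\gamma<1$, there exists a constant $C$ such that \[C_{\mathcal F}\Big(\Big\{x\in X:\limsup_{\mathcal B\ni B\to x}m^\gamma_{|u|}(B)>\lambda\Big\}\Big)\le C\lambda^{-p}\|u\|_{\mathcal F}^p\] for every $\lambda>0$ and $u\in\mathcal F$. (3) For each $0<\gamma<1$, each $\lambda>0$ and each sequence $(u_k)$ in $\mathcal F$ such that $\|u_k\|_{\mathcal F}\to0$ as $k\to\infty$, we have \[C_{\mathcal F}\Big(\Big\{x\in X:\limsup_{\mathcal B\ni B\to x}m^\gamma_{|u_k|}(B)>\lambda\Big\}\Big)\to0\] as $k\to\infty$.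
   Context: A metric measure space $X=(X,d,\mu)$ is a metric space with a Borel regular outer measure $\mu$ such that every ball has positive and finite measure. It is doubling if there is a constant $C_d$ with $\mu(B(x,2r))\le C_d\,\mu(B(x,r))$ for all $x\in X$, $r>0$, where $B(x,r)=\{y:d(y,x)<r\}$. $L^0(X)$ is the set of measurable $f:X\to[-\infty,\infty]$ finite almost everywhere. Bases: a differentiation basis is a collection $\mathcal B=\bigcup_{x\in X}\mathcal B(x)$, where each $\mathcal B(x)$ consists of bounded measurable sets containing $x$ and, for every $x\in X$ and $\varepsilon>0$, there is $B\in\mathcal B(x)$ with $\operatorname{diam}(B)<\varepsilon$. For a set function $\varphi$ on $\mathcal B$, $\limsup_{\mathcal B\ni B\to x}\varphi(B)=\lim_{\varepsilon\to0}\sup\{\varphi(B):B\in\mathcal B(x),\operatorname{diam}(B)<\varepsilon\}$; $\liminf$ uses $\inf$; $\lim$ is the common value when they coincide. Medians: for $0<\gamma<1$, measurable $f$ and measurable $A$ with $\mu(A)<\infty$, $m^\gamma_f(A)=\inf\{a\in\mathbb R:\mu(\{x\in A:f(x)>a\})<\gamma\mu(A)\}$. Function spaces: let $0<s<\infty$. A measurable $g:X\to[0,\infty]$ is an $s$-gradient of $u\in L^0(X)$ if there is $E$ with $\mu(E)=0$ such that $|u(x)-u(y)|\le d(x,y)^s(g(x)+g(y))$ for all $x,y\in X\setminus E$. The Hajłasz space $M^{s,p}(X)$ consists of $u\in L^p(X)$ for which $\|u\|_{M^{s,p}(X)}=\|u\|_{L^p(X)}+\inf_g\|g\|_{L^p(X)}<\infty$,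 the infimum over all $s$-gradients $g$ of $u$. A sequence $(g_k)_{k\in\mathbb Z}$ of nonnegative measurable functions is a fractional $s$-gradient of $u\in L^0(X)$ if there is $E\subset X$ with $\mu(E)=0$ such that $|u(x)-u(y)|\le d(x,y)^s(g_k(x)+g_k(y))$ for all $k\in\mathbb Z$ and all $x,y\in X\setminus E$ with $2^{-k-1}\le d(x,y)<2^{-k}$; $\mathbb D^s(u)$ is the collection of all of them. For $0<p,q\le\infty$, $\|(g_k)\|_{L^p(X,l^q)}=\big\|\,\|(g_k)_{k\in\mathbb Z}\|_{l^q}\big\|_{L^p(X)}$ and $\|(g_k)\|_{l^q(L^p(X))}=\big\|(\|g_k\|_{L^p(X)})_{k\in\mathbb Z}\big\|_{l^q}$. The Hajłasz--Triebel--Lizorkin space $M^s_{p,q}(X)$ consists of $u\in L^p(X)$ with $\|u\|_{M^s_{p,q}(X)}=\|u\|_{L^p(X)}+\inf_{(g_k)\in\mathbb D^s(u)}\|(g_k)\|_{L^p(X,l^q)}<\infty$, and the Hajłasz--Besov space $N^s_{p,q}(X)$ consists of $u\in L^p(X)$ with $\|u\|_{N^s_{p,q}(X)}=\|u\|_{L^p(X)}+\inf_{(g_k)\in\mathbb D^s(u)}\|(g_k)\|_{l^q(L^p(X))}<\infty$ (in general these are quasi-norms). It is known that $M^s_{p,\infty}(X)=M^{s,p}(X)$. Capacity: $C_{\mathcal F}(E)=\inf\{\|u\|_{\mathcal F}^p:u\in\mathcal F,\ u\ge1\text{ on a neighbourhood of }E\}$ for $E\subset X$. A function $u:X\to[-\infty,\infty]$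 is $\mathcal F$-quasicontinuous if for every $\varepsilon>0$ there is $E\subset X$ with $C_{\mathcal F}(E)<\varepsilon$ such that the restriction of $u$ to $X\setminus E$ is continuous. *)

theory Defs
  imports "HOL-Analysis.Analysis"
begin

section \<open>Metric measure spaces\<close>

text \<open>
  The metric space is the universe of a type of class \<^class>\<open>metric_space\<close>; \<open>\<mu>\<close> is an outer measure
  defined on all subsets of it. Measurable sets are the Caratheodory measurable ones.
\<close>

definition carath_measure :: "('a set \<Rightarrow> ennreal) \<Rightarrow> 'a measure" where
  "carath_measure \<mu> = measure_of UNIV (lambda_system UNIV UNIV \<mu>) \<mu>"

definition borel_regular_outer_measure :: "('a::topological_space set \<Rightarrow> ennreal) \<Rightarrow> bool" where
  "borel_regular_outer_measure \<mu> \<longleftrightarrow>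
     outer_measure_space UNIV \<mu> \<and>
     sets borel \<subseteq> lambda_system UNIV UNIV \<mu> \<and>
     (\<forall>A. \<exists>B \<in> sets borel. A \<subseteq> B \<and> \<mu> B = \<mu> A)"

definition metric_measure_space :: "('a::metric_space set \<Rightarrow> ennreal) \<Rightarrow> bool" where
  "metric_measure_space \<mu> \<longleftrightarrow>
     borel_regular_outer_measure \<mu> \<and> (\<forall>x. \<forall>r>0. 0 < \<mu> (ball x r) \<and> \<mu> (ball x r) < \<infinity>)"

definition doubling :: "('a::metric_space set \<Rightarrow> ennreal) \<Rightarrow> bool" where
  "doubling \<mu> \<longleftrightarrow>
     (\<exists>Cd::real. \<forall>x. \<forall>r>0. \<mu> (ball x (2 * r)) \<le> ennreal Cd * \<mu> (ball x r))"

section \<open>Differentiation bases\<close>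

text \<open>A basis is given by the family \<open>x \<mapsto> \<B>(x)\<close>.\<close>

definition differentiation_basis ::
  "('a::metric_space set \<Rightarrow> ennreal) \<Rightarrow> ('a \<Rightarrow> 'a set set) \<Rightarrow> bool" where
  "differentiation_basis \<mu> \<B> \<longleftrightarrow>
     (\<forall>x. \<forall>B \<in> \<B> x. bounded B \<and> B \<in> sets (carath_measure \<mu>) \<and> x \<in> B) \<and>
     (\<forall>x. \<forall>\<epsilon>>0. \<exists>B \<in> \<B> x. diameter B < \<epsilon>)"

definition basis_limsup ::
  "('a::metric_space \<Rightarrow> 'a set set) \<Rightarrow> 'a \<Rightarrow> ('a set \<Rightarrow> ereal) \<Rightarrow> ereal" where
  "basis_limsup \<B> x \<phi> = Lim (at_right 0) (\<lambda>\<epsilon>::real. SUP B \<in> {B \<in> \<B> x. diameter B < \<epsilon>}. \<phi> B)"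

definition basis_liminf ::
  "('a::metric_space \<Rightarrow> 'a set set) \<Rightarrow> 'a \<Rightarrow> ('a set \<Rightarrow> ereal) \<Rightarrow> ereal" where
  "basis_liminf \<B> x \<phi> = Lim (at_right 0) (\<lambda>\<epsilon>::real. INF B \<in> {B \<in> \<B> x. diameter B < \<epsilon>}. \<phi> B)"

definition has_basis_limit ::
  "('a::metric_space \<Rightarrow> 'a set set) \<Rightarrow> 'a \<Rightarrow> ('a set \<Rightarrow> ereal) \<Rightarrow> ereal \<Rightarrow> bool" where
  "has_basis_limit \<B> x \<phi> l \<longleftrightarrow> basis_liminf \<B> x \<phi> = l \<and> basis_limsup \<B> x \<phi> = l"

section \<open>Medians\<close>

text \<open>The infimum is taken in the extended reals, so that \<open>inf {} = \<infinity>\<close>.\<close>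

definition median :: "('a set \<Rightarrow> ennreal) \<Rightarrow> real \<Rightarrow> ('a \<Rightarrow> ereal) \<Rightarrow> 'a set \<Rightarrow> ereal" where
  "median \<mu> \<gamma> f A = (INF a \<in> {a::real. \<mu> {x \<in> A. f x > ereal a} < ennreal \<gamma> * \<mu> A}. ereal a)"

section \<open>Function spaces\<close>

definition enn_powr :: "ennreal \<Rightarrow> real \<Rightarrow> ennreal" where
  \<comment> \<open>only used with positive exponents\<close>
  "enn_powr x p = (if x = \<infinity> then \<infinity> else ennreal (enn2real x powr p))"

definition Lp_norm :: "'a measure \<Rightarrow> real \<Rightarrow> ('a \<Rightarrow> ennreal) \<Rightarrow> ennreal" where
  "Lp_norm M p f = enn_powr (\<integral>\<^sup>+ x. enn_powr (f x) p \<partial>M) (1 / p)"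

definition lq_norm :: "ennreal \<Rightarrow> (int \<Rightarrow> ennreal) \<Rightarrow> ennreal" where
  "lq_norm q a = (if q = \<infinity> then (SUP k. a k) else Lp_norm (count_space UNIV) (enn2real q) a)"

definition eabs :: "('a \<Rightarrow> ereal) \<Rightarrow> 'a \<Rightarrow> ennreal" where
  "eabs u x = e2ennreal \<bar>u x\<bar>"

definition L0 :: "('a set \<Rightarrow> ennreal) \<Rightarrow> ('a \<Rightarrow> ereal) set" where
  "L0 \<mu> = {u \<in> borel_measurable (carath_measure \<mu>). \<mu> {x. \<bar>u x\<bar> = \<infinity>} = 0}"

definition Lp :: "('a set \<Rightarrow> ennreal) \<Rightarrow> real \<Rightarrow> ('a \<Rightarrow> ereal) set" where
  "Lp \<mu> p = {u \<in> L0 \<mu>. Lp_norm (carath_measure \<mu>) p (eabs u) < \<infinity>}"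

text \<open>
  In the gradient inequalities \<open>\<infinity> - \<infinity> = \<infinity>\<close> (as in \<^typ>\<open>ereal\<close>). This is harmless:
  functions in \<open>L0\<close> are finite outside a null set, which can be absorbed into \<open>E\<close>.
\<close>

definition s_gradients ::
  "('a::metric_space set \<Rightarrow> ennreal) \<Rightarrow> real \<Rightarrow> ('a \<Rightarrow> ereal) \<Rightarrow> ('a \<Rightarrow> ennreal) set" where
  "s_gradients \<mu> s u = {g \<in> borel_measurable (carath_measure \<mu>).
     \<exists>E. \<mu> E = 0 \<and> (\<forall>x \<in> - E. \<forall>y \<in> - E.
       e2ennreal \<bar>u x - u y\<bar> \<le> ennreal (dist x y powr s) * (g x + g y))}"

definition fractional_s_gradients ::
  "('a::metric_space set \<Rightarrow> ennreal) \<Rightarrow> real \<Rightarrow> ('a \<Rightarrow> ereal) \<Rightarrow> (int \<Rightarrow> 'a \<Rightarrow> ennreal) set" where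
  "fractional_s_gradients \<mu> s u = {g. (\<forall>k. g k \<in> borel_measurable (carath_measure \<mu>)) \<and>
     (\<exists>E. \<mu> E = 0 \<and> (\<forall>k. \<forall>x \<in> - E. \<forall>y \<in> - E.
       2 powi (- k - 1) \<le> dist x y \<and> dist x y < 2 powi (- k) \<longrightarrow>
       e2ennreal \<bar>u x - u y\<bar> \<le> ennreal (dist x y powr s) * (g k x + g k y)))}"

definition hajlasz_norm ::
  "('a::metric_space set \<Rightarrow> ennreal) \<Rightarrow> real \<Rightarrow> real \<Rightarrow> ('a \<Rightarrow> ereal) \<Rightarrow> ennreal" where
  "hajlasz_norm \<mu> s p u =
     Lp_norm (carath_measure \<mu>) p (eabs u) +
     (INF g \<in> s_gradients \<mu> s u. Lp_norm (carath_measure \<mu>) p g)"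

definition hajlasz_space ::
  "('a::metric_space set \<Rightarrow> ennreal) \<Rightarrow> real \<Rightarrow> real \<Rightarrow> ('a \<Rightarrow> ereal) set" where
  "hajlasz_space \<mu> s p = {u \<in> Lp \<mu> p. hajlasz_norm \<mu> s p u < \<infinity>}"

definition hajlasz_triebel_lizorkin_norm ::
  "('a::metric_space set \<Rightarrow> ennreal) \<Rightarrow> real \<Rightarrow> real \<Rightarrow> ennreal \<Rightarrow> ('a \<Rightarrow> ereal) \<Rightarrow> ennreal" where
  "hajlasz_triebel_lizorkin_norm \<mu> s p q u =
     Lp_norm (carath_measure \<mu>) p (eabs u) +
     (INF g \<in> fractional_s_gradients \<mu> s u.
        Lp_norm (carath_measure \<mu>) p (\<lambda>x. lq_norm q (\<lambda>k. g k x)))"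

definition hajlasz_triebel_lizorkin_space ::
  "('a::metric_space set \<Rightarrow> ennreal) \<Rightarrow> real \<Rightarrow> real \<Rightarrow> ennreal \<Rightarrow> ('a \<Rightarrow> ereal) set" where
  "hajlasz_triebel_lizorkin_space \<mu> s p q =
     {u \<in> Lp \<mu> p. hajlasz_triebel_lizorkin_norm \<mu> s p q u < \<infinity>}"

definition hajlasz_besov_norm ::
  "('a::metric_space set \<Rightarrow> ennreal) \<Rightarrow> real \<Rightarrow> real \<Rightarrow> ennreal \<Rightarrow> ('a \<Rightarrow> ereal) \<Rightarrow> ennreal" where
  "hajlasz_besov_norm \<mu> s p q u =
     Lp_norm (carath_measure \<mu>) p (eabs u) +
     (INF g \<in> fractional_s_gradients \<mu> s u.
        lq_norm q (\<lambda>k. Lp_norm (carath_measure \<mu>) p (g k)))"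

definition hajlasz_besov_space ::
  "('a::metric_space set \<Rightarrow> ennreal) \<Rightarrow> real \<Rightarrow> real \<Rightarrow> ennreal \<Rightarrow> ('a \<Rightarrow> ereal) set" where
  "hajlasz_besov_space \<mu> s p q = {u \<in> Lp \<mu> p. hajlasz_besov_norm \<mu> s p q u < \<infinity>}"

section \<open>Capacity and quasicontinuity\<close>

text \<open>
  Here \<open>F\<close> is the function space and \<open>N\<close> its (quasi-)norm; the infimum over the empty set
  is \<open>\<infinity>\<close>.
\<close>

definition capacity ::
  "('a::topological_space \<Rightarrow> ereal) set \<Rightarrow> (('a \<Rightarrow> ereal) \<Rightarrow> ennreal) \<Rightarrow> real \<Rightarrow> 'a set \<Rightarrow> ennreal" where
  "capacity F N p E =
     (INF u \<in> {u \<in> F. \<exists>U. open U \<and> E \<subseteq> U \<and> (\<forall>x \<in> U. 1 \<le> u x)}. enn_powr (N u) p)"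

definition quasicontinuous ::
  "('a::topological_space \<Rightarrow> ereal) set \<Rightarrow> (('a \<Rightarrow> ereal) \<Rightarrow> ennreal) \<Rightarrow> real \<Rightarrow> ('a \<Rightarrow> ereal) \<Rightarrow> bool" where
  "quasicontinuous F N p u \<longleftrightarrow>
     (\<forall>\<epsilon>::real. \<epsilon> > 0 \<longrightarrow> (\<exists>E. capacity F N p E < ennreal \<epsilon> \<and> continuous_on (- E) u))"

end

theory Submission
  imports Defs
begin

text \<open>
  The function spaces enter the equivalence only through four properties, collected in the locale
  \<open>capacity_space\<close>: their elements are measurable with \<open>\<parallel>u\<parallel>\<^sub>p \<le> N u\<close>; \<open>N\<close> scales; a function that is
  controlled, in size and in its differences, by \<open>sup\<^sub>i |w\<^sub>i|\<close> and \<open>sup\<^sub>i |w\<^sub>i(x) - w\<^sub>i(y)|\<close> belongs to the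
  space, with \<open>N v \<le> K sup\<^sub>i 4\<^sup>i N(w\<^sub>i)\<close>; and continuous functions are dense. The weights \<open>4\<^sup>i\<close> make one
  inequality serve for all exponents: it replaces the countable triangle inequality, whose form depends
  on \<open>p\<close> and \<open>q\<close>, because in every application the \<open>w\<^sub>i\<close> can be chosen with rapidly decreasing norms.

  Domination yields that capacity is quasi-subadditive, that countable unions of sets of capacity zero
  have capacity zero, and that \<open>C({|u| > t}) \<le> K t\<^sup>-\<^sup>p N(u)\<^sup>p\<close> for quasicontinuous \<open>u\<close>
  (\<open>cap_superlevel\<close>). Together with density it shows that every \<open>u\<close> agrees almost everywhere with a
  quasicontinuous \<open>v\<close>, the limit of rapidly converging continuous functions.

  Claim (1) implies (2) because medians do not see null sets: the medians of \<open>|u|\<close> are those of \<open>|v|\<close>,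
  which converge to \<open>|v|\<close> outside a set of capacity zero, and the capacitary weak type estimate applies to
  \<open>v\<close>. Claim (2) trivially gives (3). For (3) implies (1), write a quasicontinuous \<open>u\<close> as \<open>f + w\<close> with \<open>f\<close>
  continuous and \<open>N w\<close> small. If \<open>|w(x)| \<le> t\<close> and the medians of \<open>|w|\<close> at \<open>x\<close> are eventually below
  \<open>2t\<close>, then on small basis sets \<open>B\<close> the oscillation \<open>|u - u(x)|\<close> exceeds \<open>4t\<close> only on a part of \<open>B\<close> of
  relative measure below \<open>\<gamma>\<close>. The exceptional points have capacity tending to zero with \<open>N w\<close>, and
  smallness of all relative measures of \<open>{|u - u(x)| > 4t}\<close> forces the medians of every order to converge.

  Density is proved in two ways. For \<open>q = \<infinity>\<close> the space is the Hajlasz space, and one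
  extends the restriction of \<open>u\<close> to the set where \<open>|u|\<close> and its gradient are at most \<open>n\<close> to a bounded
  Hoelder function on the whole space. For \<open>q < \<infinity>\<close> and \<open>s < 1\<close> one interpolates values of \<open>u\<close> at well
  chosen points of a \<open>2\<^sup>-\<^sup>n\<close>-net by a Lipschitz partition of unity. Since only the single scale \<open>2\<^sup>-\<^sup>n\<close>
  is involved, the error is controlled by two functions in \<open>L\<^sup>p\<close> times geometrically decaying weights in
  the scale, and their \<open>L\<^sup>p\<close> norms are bounded by the part of a gradient of \<open>u\<close> on the scales from
  \<open>n - 3\<close> on, which tends to zero.
\<close>

section \<open>Powers and \<open>L\<^sup>p\<close> quasi-norms of \<open>[0, \<infinity>]\<close>-valued functions\<close>

lemma enn_powr_0 [simp]: "enn_powr 0 p = 0"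
  by (simp add: enn_powr_def)

lemma enn_powr_1 [simp]: "enn_powr 1 p = 1"
  by (simp add: enn_powr_def)

lemma enn_powr_top [simp]: "enn_powr top p = top"
  by (simp add: enn_powr_def)

lemma enn_powr_ennreal: "0 \<le> a \<Longrightarrow> enn_powr (ennreal a) p = ennreal (a powr p)"
  by (simp add: enn_powr_def)

lemma enn_powr_eq_top_iff [simp]: "enn_powr x p = top \<longleftrightarrow> x = top"
  by (simp add: enn_powr_def)

lemma enn_powr_mono: "0 < p \<Longrightarrow> x \<le> y \<Longrightarrow> enn_powr x p \<le> enn_powr y p"
  by (cases x; cases y) (auto simp: enn_powr_def powr_mono2 top_unique intro!: ennreal_leI)

lemma enn_powr_powr: "0 < p \<Longrightarrow> 0 < q \<Longrightarrow> enn_powr (enn_powr x p) q = enn_powr x (p * q)"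
  by (cases x) (auto simp: enn_powr_def powr_powr)

lemma enn_powr_one_exp [simp]: "enn_powr x 1 = x"
  by (cases x) (auto simp: enn_powr_def)

lemma enn_powr_inverse:
  assumes "0 < p" shows "enn_powr (enn_powr x p) (1/p) = x" "enn_powr (enn_powr x (1/p)) p = x"
  using assms by (simp_all add: enn_powr_powr)

lemma enn_powr_mult: "0 < p \<Longrightarrow> enn_powr (x * y) p = enn_powr x p * enn_powr y p"
  by (cases x; cases y; cases "x = 0"; cases "y = 0")
    (auto simp: enn_powr_def ennreal_mult'' powr_mult ennreal_mult_top ennreal_top_mult top_unique
      simp flip: ennreal_mult'')

lemma enn_powr_le_iff: "0 < p \<Longrightarrow> enn_powr x p \<le> enn_powr y p \<longleftrightarrow> x \<le> y"
  by (metis enn_powr_inverse(1) enn_powr_mono divide_pos_pos zero_less_one)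

lemma enn_powr_less_iff: "0 < p \<Longrightarrow> enn_powr x p < enn_powr y p \<longleftrightarrow> x < y"
  using enn_powr_le_iff[of p y x] by (simp flip: not_le)

lemma enn_powr_eq_0_iff [simp]: "enn_powr x p = 0 \<longleftrightarrow> x = 0"
  by (cases x) (auto simp: enn_powr_def)

lemma measurable_enn_powr [measurable]: "(\<lambda>x. enn_powr x p) \<in> borel_measurable borel"
  unfolding enn_powr_def by measurable

lemma tendsto_enn_powr_0:
  assumes "0 < p" "(f \<longlongrightarrow> 0) G" shows "((\<lambda>x. enn_powr (f x) p) \<longlongrightarrow> 0) G"
proof (rule order_tendstoI)
  fix a :: ennreal assume a: "0 < a"
  have "0 < enn_powr a (1/p)" using a by (simp add: zero_less_iff_neq_zero)
  then have "\<forall>\<^sub>F x in G. f x < enn_powr a (1/p)"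
    using assms(2) by (simp add: order_tendsto_iff)
  then show "\<forall>\<^sub>F x in G. enn_powr (f x) p < a"
    by eventually_elim (metis assms(1) enn_powr_inverse(2) enn_powr_less_iff)
qed auto

lemma Lp_norm_mono_AE:
  assumes "0 < p" "AE x in M. f x \<le> g x" shows "Lp_norm M p f \<le> Lp_norm M p g"
  unfolding Lp_norm_def using assms
  by (intro enn_powr_mono nn_integral_mono_AE) (auto intro: enn_powr_mono)

lemma Lp_norm_mono:
  assumes "0 < p" "\<And>x. f x \<le> g x" shows "Lp_norm M p f \<le> Lp_norm M p g"
  using assms by (intro Lp_norm_mono_AE) auto

lemma Lp_norm_zero [simp]: "Lp_norm M p (\<lambda>x. 0) = 0"
  by (simp add: Lp_norm_def)

lemma enn_powr_Lp_norm:
  "0 < p \<Longrightarrow> enn_powr (Lp_norm M p f) p = (\<integral>\<^sup>+ x. enn_powr (f x) p \<partial>M)"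
  by (simp add: Lp_norm_def enn_powr_inverse)

lemma Lp_norm_cmult:
  assumes "0 < p" and [measurable]: "f \<in> borel_measurable M"
  shows "Lp_norm M p (\<lambda>x. c * f x) = c * Lp_norm M p f"
  using assms(1) by (simp add: Lp_norm_def enn_powr_mult nn_integral_cmult enn_powr_inverse)

lemma Lp_norm_finite_AE:
  assumes "0 < p" "f \<in> borel_measurable M" "Lp_norm M p f < \<infinity>"
  shows "AE x in M. f x \<noteq> \<infinity>"
proof -
  have "(\<integral>\<^sup>+ x. enn_powr (f x) p \<partial>M) \<noteq> \<infinity>"
    using assms(1,3) by (metis enn_powr_Lp_norm enn_powr_eq_top_iff infinity_ennreal_def less_irrefl)
  then have "AE x in M. enn_powr (f x) p \<noteq> \<infinity>"
    using assms(2) by (intro nn_integral_noteq_infinite) auto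
  then show ?thesis by simp
qed

lemma Lp_norm_tendsto_0_dominated:
  assumes p: "0 < p" and f: "\<And>n. f n \<in> borel_measurable M" and g: "g \<in> borel_measurable M"
    and fin: "Lp_norm M p g < \<infinity>" and le: "\<And>n. AE x in M. f n x \<le> g x"
    and lim: "AE x in M. (\<lambda>n. f n x) \<longlonglongrightarrow> 0"
  shows "(\<lambda>n. Lp_norm M p (f n)) \<longlonglongrightarrow> 0"
proof -
  have fin': "(\<integral>\<^sup>+ x. enn_powr (g x) p \<partial>M) < \<infinity>"
    using p fin by (metis enn_powr_Lp_norm enn_powr_eq_top_iff infinity_ennreal_def top.not_eq_extremum)
  have "(\<lambda>n. \<integral>\<^sup>+ x. enn_powr (f n x) p \<partial>M) \<longlonglongrightarrow> (\<integral>\<^sup>+ x. 0 \<partial>M)"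
  proof (rule nn_integral_dominated_convergence[OF _ _ _ _ fin'])
    show "AE x in M. enn_powr (f n x) p \<le> enn_powr (g x) p" for n
      using le[of n] by eventually_elim (use p in \<open>simp add: enn_powr_mono\<close>)
    show "AE x in M. (\<lambda>n. enn_powr (f n x) p) \<longlonglongrightarrow> 0"
      using lim by eventually_elim (rule tendsto_enn_powr_0[OF p])
  qed (use f g in auto)
  then show ?thesis
    unfolding Lp_norm_def using p by (intro tendsto_enn_powr_0) auto
qed

text \<open>
  Since \<open>(sup\<^sub>i f\<^sub>i)\<^sup>p \<le> \<Sum>\<^sub>i f\<^sub>i\<^sup>p\<close>, the geometric weights make the series of the \<open>\<parallel>f\<^sub>i\<parallel>\<^sub>p\<^sup>p\<close> converge.
  With counting measure it also gives the sequence space version.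
\<close>

lemma Lp_norm_SUP_le:
  assumes p: "0 < p" and \<theta>: "0 < \<theta>" "\<theta> < 1"
  obtains C :: real where "0 < C"
    "\<And>M (f :: nat \<Rightarrow> 'b \<Rightarrow> ennreal). \<forall>i. f i \<in> borel_measurable M \<Longrightarrow>
       Lp_norm M p (\<lambda>x. SUP i. f i x) \<le> ennreal C * (SUP i. ennreal ((1/\<theta>) ^ i) * Lp_norm M p (f i))"
proof -
  define t where "t = \<theta> powr p"
  have t: "0 < t" "t < 1"
    using p \<theta> powr_less_mono2[of p \<theta> 1] by (auto simp: t_def)
  define C where "C = (1/(1-t)) powr (1/p)"
  have "Lp_norm M p (\<lambda>x. SUP i. f i x) \<le> ennreal C * (SUP i. ennreal ((1/\<theta>) ^ i) * Lp_norm M p (f i))"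
    if f: "\<forall>i. f i \<in> borel_measurable M" for M and f :: "nat \<Rightarrow> 'b \<Rightarrow> ennreal"
  proof -
    have [measurable]: "f i \<in> borel_measurable M" for i using f by simp
    define W where "W = (SUP i. ennreal ((1/\<theta>) ^ i) * Lp_norm M p (f i))"
    have Lp: "Lp_norm M p (f i) \<le> ennreal (\<theta> ^ i) * W" for i
    proof -
      have "ennreal ((1/\<theta>) ^ i) * Lp_norm M p (f i) \<le> W"
        unfolding W_def by (rule SUP_upper) simp
      then have "ennreal (\<theta> ^ i) * (ennreal ((1/\<theta>) ^ i) * Lp_norm M p (f i)) \<le> ennreal (\<theta> ^ i) * W"
        by (rule mult_left_mono) simp
      moreover have "ennreal (\<theta> ^ i) * ennreal ((1/\<theta>) ^ i) = 1"
        using \<theta> by (simp add: ennreal_mult'[symmetric] power_divide)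
      ultimately show ?thesis
        by (metis mult.assoc mult_1)
    qed
    have "enn_powr (SUP i. f i x) p \<le> (\<Sum>i. enn_powr (f i x) p)" for x
    proof -
      have "f i x \<le> enn_powr (\<Sum>i. enn_powr (f i x) p) (1/p)" for i
      proof -
        have "enn_powr (f i x) p \<le> (\<Sum>i. enn_powr (f i x) p)"
          using sum_le_suminf[of "\<lambda>i. enn_powr (f i x) p" "{i}"] by simp
        then have "enn_powr (enn_powr (f i x) p) (1/p) \<le> enn_powr (\<Sum>i. enn_powr (f i x) p) (1/p)"
          using p by (intro enn_powr_mono) auto
        then show ?thesis using p by (simp add: enn_powr_inverse)
      qed
      then have "(SUP i. f i x) \<le> enn_powr (\<Sum>i. enn_powr (f i x) p) (1/p)"
        by (intro SUP_least)
      then have "enn_powr (SUP i. f i x) p \<le> enn_powr (enn_powr (\<Sum>i. enn_powr (f i x) p) (1/p)) p"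
        using p by (intro enn_powr_mono) auto
      then show ?thesis using p by (simp add: enn_powr_inverse)
    qed
    then have "(\<integral>\<^sup>+ x. enn_powr (SUP i. f i x) p \<partial>M) \<le> (\<integral>\<^sup>+ x. (\<Sum>i. enn_powr (f i x) p) \<partial>M)"
      by (intro nn_integral_mono)
    also have "\<dots> = (\<Sum>i. \<integral>\<^sup>+ x. enn_powr (f i x) p \<partial>M)"
      by (intro nn_integral_suminf) measurable
    also have "\<dots> = (\<Sum>i. enn_powr (Lp_norm M p (f i)) p)"
      using p by (simp add: enn_powr_Lp_norm)
    also have "\<dots> \<le> (\<Sum>i. ennreal (t ^ i) * enn_powr W p)"
    proof (rule suminf_le)
      fix i
      have "enn_powr (Lp_norm M p (f i)) p \<le> enn_powr (ennreal (\<theta> ^ i) * W) p"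
        using p Lp by (intro enn_powr_mono) auto
      also have "\<dots> = ennreal (t ^ i) * enn_powr W p"
        using p \<theta> by (simp add: enn_powr_mult enn_powr_ennreal t_def powr_power powr_realpow[symmetric] powr_powr mult.commute)
      finally show "enn_powr (Lp_norm M p (f i)) p \<le> ennreal (t ^ i) * enn_powr W p" .
    qed auto
    also have "\<dots> = (\<Sum>i. ennreal (t ^ i)) * enn_powr W p"
      by simp
    also have "(\<Sum>i. ennreal (t ^ i)) = ennreal (1/(1-t))"
      using t geometric_sums[of t] by (intro suminf_ennreal_eq) auto
    finally have "Lp_norm M p (\<lambda>x. SUP i. f i x) \<le> enn_powr (ennreal (1/(1-t)) * enn_powr W p) (1/p)"
      unfolding Lp_norm_def using p by (intro enn_powr_mono) auto
    also have "\<dots> = ennreal C * W"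
      using p t by (simp add: enn_powr_mult enn_powr_inverse enn_powr_ennreal C_def)
    finally show ?thesis by (simp add: W_def)
  qed
  moreover have "0 < C" using t by (simp add: C_def)
  ultimately show ?thesis by (rule that[rotated])
qed

lemma enn_powr_add_le:
  assumes "0 < p" shows "enn_powr (a + b) p \<le> ennreal (2 powr p) * (enn_powr a p + enn_powr b p)"
proof -
  have "a + b \<le> 2 * max a b" unfolding mult_2 by (intro add_mono) auto
  then have "enn_powr (a + b) p \<le> enn_powr (2 * max a b) p" using assms by (rule enn_powr_mono[rotated])
  also have "\<dots> = ennreal (2 powr p) * enn_powr (max a b) p"
    using assms enn_powr_ennreal[of 2 p] by (simp add: enn_powr_mult)
  also have "enn_powr (max a b) p \<le> enn_powr a p + enn_powr b p"
    by (auto simp: max_def add_increasing add_increasing2)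
  finally show ?thesis by (simp add: mult_left_mono)
qed

lemma Lp_norm_add_le:
  assumes p: "0 < p" and [measurable]: "f \<in> borel_measurable M" "g \<in> borel_measurable M"
  shows "Lp_norm M p (\<lambda>x. f x + g x) \<le> ennreal (2 * 2 powr (1/p)) * (Lp_norm M p f + Lp_norm M p g)"
proof -
  define m where "m = max (Lp_norm M p f) (Lp_norm M p g)"
  have "enn_powr (Lp_norm M p (\<lambda>x. f x + g x)) p = (\<integral>\<^sup>+x. enn_powr (f x + g x) p \<partial>M)"
    by (rule enn_powr_Lp_norm[OF p])
  also have "\<dots> \<le> (\<integral>\<^sup>+x. ennreal (2 powr p) * (enn_powr (f x) p + enn_powr (g x) p) \<partial>M)"
    by (intro nn_integral_mono enn_powr_add_le p)
  also have "\<dots> = ennreal (2 powr p) * (enn_powr (Lp_norm M p f) p + enn_powr (Lp_norm M p g) p)"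
    using p by (simp add: nn_integral_cmult nn_integral_add enn_powr_Lp_norm)
  also have "\<dots> \<le> ennreal (2 powr p) * (enn_powr m p + enn_powr m p)"
    by (intro mult_left_mono add_mono enn_powr_mono p) (auto simp: m_def)
  also have "\<dots> = enn_powr (ennreal (2 * 2 powr (1/p)) * m) p"
    using p enn_powr_ennreal[of 2 p] by (simp add: enn_powr_mult enn_powr_ennreal powr_mult powr_powr ennreal_mult mult.assoc flip: mult_2)
  finally have "Lp_norm M p (\<lambda>x. f x + g x) \<le> ennreal (2 * 2 powr (1/p)) * m"
    using p by (simp add: enn_powr_le_iff)
  also have "\<dots> \<le> ennreal (2 * 2 powr (1/p)) * (Lp_norm M p f + Lp_norm M p g)"
    by (intro mult_left_mono) (auto simp: m_def add_increasing add_increasing2)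
  finally show ?thesis .
qed

section \<open>The measure of a metric measure space\<close>

text \<open>
  Everything below happens on the Caratheodory measurable sets, which form a complete measure
  containing the Borel sets. The outer measure itself appears only on null sets and through monotonicity
  and subadditivity.
\<close>

locale mm_space =
  fixes \<mu> :: "'a::metric_space set \<Rightarrow> ennreal"
  assumes mms: "metric_measure_space \<mu>"
begin

abbreviation "M \<equiv> carath_measure \<mu>"

lemma outer: "outer_measure_space UNIV \<mu>" and borel_lambda: "sets borel \<subseteq> lambda_system UNIV UNIV \<mu>"
  using mms by (auto simp: metric_measure_space_def borel_regular_outer_measure_def)

lemma mu_mono: "A \<subseteq> B \<Longrightarrow> \<mu> A \<le> \<mu> B"
  using outer by (auto simp: outer_measure_space_def increasing_def)

lemma mu_empty [simp]: "\<mu> {} = 0"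
  using outer by (auto simp: outer_measure_space_def positive_def)

lemma mu_Un: "\<mu> (A \<union> B) \<le> \<mu> A + \<mu> B"
proof -
  have "subadditive UNIV \<mu>"
    using outer by (auto simp: outer_measure_space_def intro!: ring_of_sets.countably_subadditive_subadditive[of UNIV] algebra.axioms sigma_algebra.axioms(1) sigma_algebra_Pow[of UNIV, simplified])
  then have "\<mu> (A \<union> (B - A)) \<le> \<mu> A + \<mu> (B - A)"
    unfolding subadditive_def by blast
  also have "\<dots> \<le> \<mu> A + \<mu> B" by (intro add_left_mono mu_mono) auto
  finally show ?thesis by simp
qed

lemma measure_space_lambda: "measure_space UNIV (lambda_system UNIV UNIV \<mu>) \<mu>"
  using sigma_algebra.caratheodory_lemma[OF sigma_algebra_Pow[of UNIV]] outer by simp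

lemma space_M [simp]: "space M = UNIV"
  by (simp add: carath_measure_def space_measure_of_conv)

lemma sets_M: "sets M = lambda_system UNIV UNIV \<mu>"
  using measure_space_lambda unfolding carath_measure_def measure_space_def
  by (simp add: sigma_algebra.sigma_sets_eq)

lemma emeasure_M: "A \<in> sets M \<Longrightarrow> emeasure M A = \<mu> A"
  using measure_space_lambda unfolding sets_M unfolding carath_measure_def measure_space_def
  by (subst emeasure_measure_of_sigma) (auto simp: sigma_algebra.sigma_sets_eq)

lemma borel_sets_M: "A \<in> sets borel \<Longrightarrow> A \<in> sets M"
  using borel_lambda by (auto simp: sets_M)

lemma open_sets_M [measurable, simp]: "open A \<Longrightarrow> A \<in> sets M"
  by (rule borel_sets_M) auto

lemma continuous_measurable_M:
  assumes "continuous_on UNIV (f :: 'a \<Rightarrow> 'b::topological_space)" shows "f \<in> borel_measurable M"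
  using measurable_mono[of borel borel M borel] borel_measurable_continuous_onI[OF assms] borel_sets_M
  by (auto simp: measurable_def)

lemma null_sets_M: "Z \<in> null_sets M \<longleftrightarrow> \<mu> Z = 0"
proof
  assume Z: "\<mu> Z = 0"
  have "\<mu> (Z \<inter> x) = 0" for x
    using mu_mono[of "Z \<inter> x" Z] Z by simp
  moreover have "\<mu> ((UNIV - Z) \<inter> x) = \<mu> x" for x
  proof (rule antisym)
    show "\<mu> ((UNIV - Z) \<inter> x) \<le> \<mu> x" by (rule mu_mono) auto
    have "\<mu> x \<le> \<mu> (Z \<union> ((UNIV - Z) \<inter> x))" by (rule mu_mono) auto
    also have "\<dots> \<le> \<mu> ((UNIV - Z) \<inter> x)" using mu_Un[of Z "(UNIV - Z) \<inter> x"] Z by simp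
    finally show "\<mu> x \<le> \<mu> ((UNIV - Z) \<inter> x)" .
  qed
  ultimately have "Z \<in> sets M" by (simp add: sets_M lambda_system_def)
  with Z show "Z \<in> null_sets M" by (simp add: null_sets_def emeasure_M)
qed (auto simp: null_sets_def emeasure_M)

lemma null_UN: "(\<And>i::nat. \<mu> (Z i) = 0) \<Longrightarrow> \<mu> (\<Union>i. Z i) = 0"
  unfolding null_sets_M[symmetric] by (rule null_sets_UN)

lemma null_Un: "\<mu> Y = 0 \<Longrightarrow> \<mu> Z = 0 \<Longrightarrow> \<mu> (Y \<union> Z) = 0"
  unfolding null_sets_M[symmetric] by (rule null_sets.Un)

lemma null_subset: "\<mu> Z = 0 \<Longrightarrow> Y \<subseteq> Z \<Longrightarrow> \<mu> Y = 0"
  using mu_mono[of Y Z] by simp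

lemma AE_M_iff: "(AE x in M. P x) \<longleftrightarrow> \<mu> {x. \<not> P x} = 0"
proof
  assume "AE x in M. P x"
  then obtain N where "{x. \<not> P x} \<subseteq> N" "N \<in> null_sets M"
    by (auto simp: eventually_ae_filter)
  then show "\<mu> {x. \<not> P x} = 0" by (auto simp: null_sets_M intro: null_subset)
next
  assume "\<mu> {x. \<not> P x} = 0"
  then show "AE x in M. P x" by (intro AE_I'[of "{x. \<not> P x}"]) (auto simp: null_sets_M)
qed

lemma AE_M_I: "\<mu> Z = 0 \<Longrightarrow> (\<And>x. x \<notin> Z \<Longrightarrow> P x) \<Longrightarrow> AE x in M. P x"
  by (rule AE_I'[of Z]) (auto simp: null_sets_M)

lemma complete_M: "complete_measure M"
  by standard (use null_subset null_sets_M in \<open>metis null_setsD2\<close>)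

text \<open>
  Completeness makes a quasicontinuous representative measurable although it is defined only through
  a limit that may fail to exist on a null set.
\<close>

lemma measurable_M_AE_eq:
  assumes f: "f \<in> borel_measurable M" and eq: "AE x in M. f x = g x"
  shows "g \<in> borel_measurable M"
proof (rule measurableI)
  fix A :: "'b set" assume A: "A \<in> sets borel"
  show "g -` A \<inter> space M \<in> sets M"
  proof (rule complete_measure.in_sets_AE[OF complete_M])
    show "AE x in M. x \<in> f -` A \<inter> space M \<longleftrightarrow> x \<in> g -` A \<inter> space M"
      using eq by eventually_elim auto
    show "f -` A \<inter> space M \<in> sets M" using f A by (rule measurable_sets)
  qed auto
qed auto

lemma mu_cong_AE:
  assumes "\<mu> Z = 0" "A \<subseteq> B \<union> Z" "B \<subseteq> A \<union> Z" shows "\<mu> A = \<mu> B"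
  by (metis assms mu_mono mu_Un add.right_neutral order.trans antisym)

lemma mu_ball: "0 < r \<Longrightarrow> 0 < \<mu> (ball x r)" "0 < r \<Longrightarrow> \<mu> (ball x r) < \<infinity>"
  using mms by (auto simp: metric_measure_space_def)

lemma mu_bounded: assumes "bounded B" shows "\<mu> B < \<infinity>"
proof (cases "B = {}")
  case False
  then obtain x e where "B \<subseteq> cball x e" using assms by (metis bounded_def mem_cball subsetI)
  then have "B \<subseteq> ball x (max 0 e + 1)" by (auto simp: subset_iff)
  then have "\<mu> B \<le> \<mu> (ball x (max 0 e + 1))" by (rule mu_mono)
  also have "\<dots> < \<infinity>" by (rule mu_ball) auto
  finally show ?thesis .
qed auto

lemma L0_AE: "u \<in> L0 \<mu> \<longleftrightarrow> u \<in> borel_measurable M \<and> (AE x in M. \<bar>u x\<bar> \<noteq> \<infinity>)"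
  by (simp add: L0_def AE_M_iff)

end

lemma measurable_eabs [measurable (raw)]:
  "u \<in> borel_measurable M \<Longrightarrow> eabs u \<in> borel_measurable M"
  unfolding eabs_def by measurable

section \<open>Capacities of spaces with a domination principle\<close>

lemma eq_0_if_le_cmult:
  fixes c :: ennreal
  assumes "c < \<infinity>" "\<And>e::real. 0 < e \<Longrightarrow> x \<le> c * ennreal e" shows "x = 0"
proof -
  have "x \<le> 0 + ennreal e" if "0 < e" for e
  proof -
    obtain r where r: "c = ennreal r" "0 \<le> r" using assms(1) by (cases c) auto
    have "x \<le> c * ennreal (e / (r + 1))" using that r by (intro assms(2)) auto
    also have "\<dots> = ennreal (r * (e / (r+1)))" using r that by (simp add: ennreal_mult[symmetric])
    also have "\<dots> \<le> ennreal e" using that r by (intro ennreal_leI) (simp add: field_simps)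
    finally show ?thesis by simp
  qed
  then show ?thesis by (metis ennreal_le_epsilon le_zero_eq)
qed

lemma max_abs_diff_le: "\<bar>max \<bar>a\<bar> \<bar>b\<bar> - max \<bar>c\<bar> \<bar>d\<bar>\<bar> \<le> \<bar>a - c\<bar> + \<bar>b - d\<bar>" for a b c d :: real
  by (smt (verit))

text \<open>
  Domination by the supremum of a sequence, off a null set and where that supremum is finite. The
  finiteness proviso keeps the value \<open>\<infinity> - \<infinity> = \<infinity>\<close> out of the comparison of differences.
\<close>

definition sup_dominated ::
  "('a set \<Rightarrow> ennreal) \<Rightarrow> ('a \<Rightarrow> ereal) \<Rightarrow> (nat \<Rightarrow> 'a \<Rightarrow> ereal) \<Rightarrow> bool" where
  "sup_dominated \<mu> v w \<longleftrightarrow> (\<exists>Z. \<mu> Z = 0 \<and>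
     (\<forall>x. x \<notin> Z \<longrightarrow> (SUP i. \<bar>w i x\<bar>) \<noteq> \<infinity> \<longrightarrow> \<bar>v x\<bar> \<le> (SUP i. \<bar>w i x\<bar>)) \<and>
     (\<forall>x y. x \<notin> Z \<longrightarrow> y \<notin> Z \<longrightarrow> (SUP i. \<bar>w i x\<bar>) \<noteq> \<infinity> \<longrightarrow> (SUP i. \<bar>w i y\<bar>) \<noteq> \<infinity> \<longrightarrow>
        \<bar>v x - v y\<bar> \<le> (SUP i. \<bar>w i x - w i y\<bar>)))"

definition sum_dominated ::
  "('a set \<Rightarrow> ennreal) \<Rightarrow> ('a \<Rightarrow> ereal) \<Rightarrow> ('a \<Rightarrow> ereal) \<Rightarrow> ('a \<Rightarrow> ereal) \<Rightarrow> bool" where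
  "sum_dominated \<mu> v u w \<longleftrightarrow> (\<exists>Z. \<mu> Z = 0 \<and>
     (\<forall>x. x \<notin> Z \<longrightarrow> \<bar>u x\<bar> \<noteq> \<infinity> \<longrightarrow> \<bar>w x\<bar> \<noteq> \<infinity> \<longrightarrow> \<bar>v x\<bar> \<le> \<bar>u x\<bar> + \<bar>w x\<bar>) \<and>
     (\<forall>x y. x \<notin> Z \<longrightarrow> y \<notin> Z \<longrightarrow> \<bar>u x\<bar> \<noteq> \<infinity> \<longrightarrow> \<bar>w x\<bar> \<noteq> \<infinity> \<longrightarrow> \<bar>u y\<bar> \<noteq> \<infinity> \<longrightarrow> \<bar>w y\<bar> \<noteq> \<infinity> \<longrightarrow>
        \<bar>v x - v y\<bar> \<le> \<bar>u x - u y\<bar> + \<bar>w x - w y\<bar>))"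

lemma sum_dominatedI:
  assumes "\<mu> Z = 0"
    "\<And>x a b. x \<notin> Z \<Longrightarrow> u x = ereal a \<Longrightarrow> w x = ereal b \<Longrightarrow> \<bar>v x\<bar> \<le> ereal (\<bar>a\<bar> + \<bar>b\<bar>)"
    "\<And>x y a b c d. x \<notin> Z \<Longrightarrow> y \<notin> Z \<Longrightarrow> u x = ereal a \<Longrightarrow> w x = ereal b \<Longrightarrow> u y = ereal c \<Longrightarrow> w y = ereal d \<Longrightarrow>
         \<bar>v x - v y\<bar> \<le> ereal (\<bar>a - c\<bar> + \<bar>b - d\<bar>)"
  shows "sum_dominated \<mu> v u w"
  unfolding sum_dominated_def
proof (intro exI[of _ Z] conjI allI impI)
  fix x assume "x \<notin> Z" "\<bar>u x\<bar> \<noteq> \<infinity>" "\<bar>w x\<bar> \<noteq> \<infinity>"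
  moreover from this obtain a b where "u x = ereal a" "w x = ereal b" by auto
  ultimately show "\<bar>v x\<bar> \<le> \<bar>u x\<bar> + \<bar>w x\<bar>" using assms(2)[of x a b] by simp
next
  fix x y assume *: "x \<notin> Z" "y \<notin> Z" "\<bar>u x\<bar> \<noteq> \<infinity>" "\<bar>w x\<bar> \<noteq> \<infinity>" "\<bar>u y\<bar> \<noteq> \<infinity>" "\<bar>w y\<bar> \<noteq> \<infinity>"
  then obtain a b c d where "u x = ereal a" "w x = ereal b" "u y = ereal c" "w y = ereal d" by auto
  then show "\<bar>v x - v y\<bar> \<le> \<bar>u x - u y\<bar> + \<bar>w x - w y\<bar>" using assms(3)[of x y a b c d] * by simp
qed (rule assms)

lemma ereal_one_le_abs: "1 \<le> z \<Longrightarrow> 1 \<le> \<bar>z\<bar>" for z :: ereal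
  by (cases z) auto

text \<open>
  The weights \<open>4\<^sup>i\<close> are what two nested uses of \<open>Lp_norm_SUP_le\<close> with \<open>\<theta> = 1/2\<close> produce: one for \<open>L\<^sup>p\<close>
  and one for \<open>l\<^sup>q\<close>.
\<close>

locale capacity_space = mm_space \<mu> for \<mu> :: "'a::metric_space set \<Rightarrow> ennreal" +
  fixes F :: "('a \<Rightarrow> ereal) set" and N :: "('a \<Rightarrow> ereal) \<Rightarrow> ennreal" and p :: real
  assumes p_pos: "0 < p"
    and F_meas: "u \<in> F \<Longrightarrow> u \<in> borel_measurable (carath_measure \<mu>)"
    and N_fin: "u \<in> F \<Longrightarrow> N u < \<infinity>"
    and Lp_le_N: "u \<in> F \<Longrightarrow> Lp_norm (carath_measure \<mu>) p (eabs u) \<le> N u"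
    and zero_F: "(\<lambda>_. 0) \<in> F" "N (\<lambda>_. 0) = 0"
    and scale_F: "u \<in> F \<Longrightarrow> 0 < c \<Longrightarrow> (\<lambda>x. ereal c * u x) \<in> F"
                 "u \<in> F \<Longrightarrow> 0 < c \<Longrightarrow> N (\<lambda>x. ereal c * u x) \<le> ennreal c * N u"
    and dominated_F: "\<exists>K::real. \<forall>v w. v \<in> borel_measurable (carath_measure \<mu>) \<longrightarrow> (\<forall>i. w i \<in> F) \<longrightarrow>
           sup_dominated \<mu> v w \<longrightarrow> (SUP i. 4 ^ i * N (w i)) < \<infinity> \<longrightarrow>
           v \<in> F \<and> N v \<le> ennreal K * (SUP i. 4 ^ i * N (w i))"
    and dense_F: "u \<in> F \<Longrightarrow> 0 < \<epsilon> \<Longrightarrow> \<exists>f. continuous_on UNIV f \<and>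
           (\<lambda>x. u x - ereal (f x)) \<in> F \<and> N (\<lambda>x. u x - ereal (f x)) < ennreal \<epsilon>"
begin

abbreviation "cap \<equiv> capacity F N p"

lemma F_finite_AE: assumes "u \<in> F" shows "AE x in M. \<bar>u x\<bar> \<noteq> \<infinity>"
proof -
  have "AE x in M. eabs u x \<noteq> \<infinity>"
    using Lp_le_N[OF assms] N_fin[OF assms] F_meas[OF assms] p_pos
    by (intro Lp_norm_finite_AE) auto
  then show ?thesis by eventually_elim (auto simp: eabs_def)
qed

lemma dominated_F_nonneg:
  obtains K :: real where "0 \<le> K"
    "\<And>v w. v \<in> borel_measurable M \<Longrightarrow> \<forall>i. w i \<in> F \<Longrightarrow> sup_dominated \<mu> v w \<Longrightarrow>
       (SUP i. 4 ^ i * N (w i)) < \<infinity> \<Longrightarrow> v \<in> F \<and> N v \<le> ennreal K * (SUP i. 4 ^ i * N (w i))"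
proof -
  obtain K where K: "\<And>v w. v \<in> borel_measurable M \<Longrightarrow> \<forall>i. w i \<in> F \<Longrightarrow> sup_dominated \<mu> v w \<Longrightarrow>
       (SUP i. 4 ^ i * N (w i)) < \<infinity> \<Longrightarrow> v \<in> F \<and> N v \<le> ennreal K * (SUP i. 4 ^ i * N (w i))"
    using dominated_F by blast
  have "ennreal K = ennreal (max 0 K)" by (simp add: max_def ennreal_neg)
  show ?thesis by (rule that[of "max 0 K"]) (use K \<open>ennreal K = _\<close> in auto)
qed

text \<open>
  The quasi-triangle inequality in its useful form: sums, differences, maxima and absolute values
  are all dominated by \<open>|u| + |w|\<close>. It follows from the countable principle because
  \<open>a + b \<le> max (2 a) (2 b)\<close>.
\<close>

lemma sum_dominated_F:
  obtains K :: real where "0 < K"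
    "\<And>v u w. v \<in> borel_measurable M \<Longrightarrow> u \<in> F \<Longrightarrow> w \<in> F \<Longrightarrow> sum_dominated \<mu> v u w \<Longrightarrow>
      v \<in> F \<and> N v \<le> ennreal K * (N u + N w)"
proof -
  obtain K where K0: "0 \<le> K" and K: "\<And>v w. v \<in> borel_measurable M \<Longrightarrow> \<forall>i. w i \<in> F \<Longrightarrow> sup_dominated \<mu> v w \<Longrightarrow>
       (SUP i. 4 ^ i * N (w i)) < \<infinity> \<Longrightarrow> v \<in> F \<and> N v \<le> ennreal K * (SUP i. 4 ^ i * N (w i))"
    by (rule dominated_F_nonneg) (rule that)
  have "v \<in> F \<and> N v \<le> ennreal (8 * K + 1) * (N u + N w)"
    if v: "v \<in> borel_measurable M" and uw: "u \<in> F" "w \<in> F" and dom: "sum_dominated \<mu> v u w" for v u w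
  proof -
    obtain Z where Z: "\<mu> Z = 0"
      and le: "\<And>x. x \<notin> Z \<Longrightarrow> \<bar>u x\<bar> \<noteq> \<infinity> \<Longrightarrow> \<bar>w x\<bar> \<noteq> \<infinity> \<Longrightarrow> \<bar>v x\<bar> \<le> \<bar>u x\<bar> + \<bar>w x\<bar>"
      and diff: "\<And>x y. x \<notin> Z \<Longrightarrow> y \<notin> Z \<Longrightarrow> \<bar>u x\<bar> \<noteq> \<infinity> \<Longrightarrow> \<bar>w x\<bar> \<noteq> \<infinity> \<Longrightarrow> \<bar>u y\<bar> \<noteq> \<infinity> \<Longrightarrow> \<bar>w y\<bar> \<noteq> \<infinity> \<Longrightarrow>
         \<bar>v x - v y\<bar> \<le> \<bar>u x - u y\<bar> + \<bar>w x - w y\<bar>"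
      using dom unfolding sum_dominated_def by metis
    \<comment> \<open>The factor 2 makes the supremum of the sequence dominate the sum of its two nonzero terms.\<close>
    define W where "W = (\<lambda>i::nat. if i = 0 then (\<lambda>x. ereal 2 * u x) else if i = 1 then (\<lambda>x. ereal 2 * w x) else (\<lambda>_. 0))"
    have W: "W i \<in> F" for i using uw by (auto simp: W_def scale_F zero_F)
    have up: "\<bar>ereal 2 * u x\<bar> \<le> (SUP i. \<bar>W i x\<bar>)" "\<bar>ereal 2 * w x\<bar> \<le> (SUP i. \<bar>W i x\<bar>)" for x
      using SUP_upper[of 0 UNIV "\<lambda>i. \<bar>W i x\<bar>"] SUP_upper[of 1 UNIV "\<lambda>i. \<bar>W i x\<bar>"]
      by (auto simp: W_def)
    have fin: "\<bar>u x\<bar> \<noteq> \<infinity> \<and> \<bar>w x\<bar> \<noteq> \<infinity>" if "(SUP i. \<bar>W i x\<bar>) \<noteq> \<infinity>" for x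
      using up[of x] that by (cases "u x"; cases "w x") auto
    have half: "c \<le> S" if "c \<le> a + b" "ereal 2 * a \<le> S" "ereal 2 * b \<le> S" "0 \<le> a" "0 \<le> b" for a b c S :: ereal
    proof -
      have "a + b \<le> S" using that(2-) by (cases a; cases b; cases S) auto
      with that(1) show ?thesis by simp
    qed
    have "sup_dominated \<mu> v W"
      unfolding sup_dominated_def
    proof (intro exI[of _ Z] conjI allI impI)
      fix x assume x: "x \<notin> Z" "(SUP i. \<bar>W i x\<bar>) \<noteq> \<infinity>"
      show "\<bar>v x\<bar> \<le> (SUP i. \<bar>W i x\<bar>)"
        by (rule half[OF le[OF x(1)]]) (use fin[OF x(2)] up[of x] in \<open>auto simp: abs_mult\<close>)
    next
      fix x y assume *: "x \<notin> Z" "y \<notin> Z" "(SUP i. \<bar>W i x\<bar>) \<noteq> \<infinity>" "(SUP i. \<bar>W i y\<bar>) \<noteq> \<infinity>"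
      note f = fin[OF *(3)] fin[OF *(4)]
      have "ereal 2 * \<bar>u x - u y\<bar> = \<bar>W 0 x - W 0 y\<bar>"
        using f by (cases "u x"; cases "u y") (auto simp: W_def abs_if algebra_simps)
      moreover have "ereal 2 * \<bar>w x - w y\<bar> = \<bar>W 1 x - W 1 y\<bar>"
        using f by (cases "w x"; cases "w y") (auto simp: W_def abs_if algebra_simps)
      ultimately have "ereal 2 * \<bar>u x - u y\<bar> \<le> (SUP i. \<bar>W i x - W i y\<bar>)"
         "ereal 2 * \<bar>w x - w y\<bar> \<le> (SUP i. \<bar>W i x - W i y\<bar>)"
        by (auto intro: SUP_upper)
      then show "\<bar>v x - v y\<bar> \<le> (SUP i. \<bar>W i x - W i y\<bar>)"
        by (intro half[OF diff[OF *(1,2)]]) (use f in auto)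
    qed (use Z in simp)
    moreover have S: "(SUP i. 4 ^ i * N (W i)) \<le> 8 * (N u + N w)"
    proof (rule SUP_least)
      fix i :: nat
      have N01: "N (W 0) \<le> 2 * N u" "N (W 1) \<le> 2 * N w"
        using scale_F(2)[of _ 2] uw by (auto simp: W_def)
      have "N (W 0) \<le> 8 * N u + 8 * N w"
        using N01(1) mult_right_mono[of 2 "8::ennreal" "N u"] by (intro add_increasing2) auto
      moreover have "4 * N (W 1) \<le> 8 * N u + 8 * N w"
        using mult_left_mono[OF N01(2), of 4] by (intro add_increasing) (auto simp: mult.assoc[symmetric])
      moreover have "i \<noteq> 0 \<Longrightarrow> i \<noteq> 1 \<Longrightarrow> N (W i) = 0" by (simp add: W_def zero_F)
      ultimately show "4 ^ i * N (W i) \<le> 8 * (N u + N w)"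
        by (cases "i = 0"; cases "i = 1") (auto simp: distrib_left)
    qed
    moreover have "8 * (N u + N w) < \<infinity>"
      using N_fin uw by (simp add: ennreal_mult_less_top)
    ultimately have "v \<in> F \<and> N v \<le> ennreal K * (SUP i. 4 ^ i * N (W i))"
      by (intro K v allI W) (auto elim: le_less_trans)
    moreover have "ennreal K * (SUP i. 4 ^ i * N (W i)) \<le> ennreal K * (8 * (N u + N w))"
      using S by (rule mult_left_mono) simp
    moreover have "ennreal K * (8 * (N u + N w)) \<le> ennreal (8 * K + 1) * (N u + N w)"
    proof -
      have "ennreal K * (8 * (N u + N w)) = (ennreal K * ennreal 8) * (N u + N w)"
        by (simp add: mult.assoc)
      also have "ennreal K * ennreal 8 = ennreal (K * 8)"
        using K0 by (simp only: ennreal_mult zero_le_numeral)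
      also have "\<dots> * (N u + N w) \<le> ennreal (8 * K + 1) * (N u + N w)"
        by (intro mult_right_mono ennreal_leI) auto
      finally show ?thesis .
    qed
    ultimately show ?thesis by (meson order_trans)
  qed
  moreover have "0 < 8 * K + 1" using K0 by simp
  ultimately show ?thesis by (rule that[rotated])
qed

lemma F_cong_AE:
  assumes u: "u \<in> F" and eq: "AE x in M. u x = v x" shows "v \<in> F"
proof -
  obtain K where "0 < K" and K: "\<And>v u w. v \<in> borel_measurable M \<Longrightarrow> u \<in> F \<Longrightarrow> w \<in> F \<Longrightarrow> sum_dominated \<mu> v u w \<Longrightarrow>
      v \<in> F \<and> N v \<le> ennreal K * (N u + N w)"
    by (rule sum_dominated_F) (rule that)
  have "\<mu> {x. u x \<noteq> v x} = 0" using eq by (simp add: AE_M_iff)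
  then show ?thesis
    using measurable_M_AE_eq[OF F_meas[OF u] eq]
    by (intro K[of v u "\<lambda>_. 0", THEN conjunct1] u zero_F sum_dominatedI[of _ "{x. u x \<noteq> v x}"])
      (simp_all, metis abs_ereal.simps(1) order_refl, metis ereal_minus(1) abs_ereal.simps(1) order_refl)
qed

lemma cap_mono: "A \<subseteq> B \<Longrightarrow> cap A \<le> cap B"
  unfolding capacity_def by (rule INF_superset_mono) auto

lemma cap_le: "u \<in> F \<Longrightarrow> open V \<Longrightarrow> E \<subseteq> V \<Longrightarrow> (\<And>x. x \<in> V \<Longrightarrow> 1 \<le> u x) \<Longrightarrow> cap E \<le> enn_powr (N u) p"
  unfolding capacity_def by (rule INF_lower) auto

lemma cap_lessE:
  assumes "cap E < c"
  obtains u V where "u \<in> F" "open V" "E \<subseteq> V" "\<forall>x\<in>V. 1 \<le> u x" "enn_powr (N u) p < c"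
  using assms unfolding capacity_def INF_less_iff by auto

text \<open>
  The maximum of \<open>|u|\<close> and \<open>|w|\<close> is an admissible function for \<open>V\<close>. Subadditivity and the capacitary
  weak type estimate are both instances.
\<close>

lemma cap_le_two_functions:
  obtains K :: real where "0 < K" "\<And>u w V. u \<in> F \<Longrightarrow> w \<in> F \<Longrightarrow> open V \<Longrightarrow>
    \<forall>x\<in>V. 1 \<le> \<bar>u x\<bar> \<or> 1 \<le> \<bar>w x\<bar> \<Longrightarrow>
    cap V \<le> ennreal K * (enn_powr (N u) p + enn_powr (N w) p)"
proof -
  obtain K where K0: "0 < K" and K: "\<And>v u w. v \<in> borel_measurable M \<Longrightarrow> u \<in> F \<Longrightarrow> w \<in> F \<Longrightarrow> sum_dominated \<mu> v u w \<Longrightarrow>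
      v \<in> F \<and> N v \<le> ennreal K * (N u + N w)"
    by (rule sum_dominated_F) (rule that)
  show ?thesis
  proof (rule that[of "K powr p * 2 powr p"])
    fix u w V assume uw: "u \<in> F" "w \<in> F" and V: "open V" "\<forall>x\<in>V. 1 \<le> \<bar>u x\<bar> \<or> 1 \<le> \<bar>w x\<bar>"
    define v where "v x = max \<bar>u x\<bar> \<bar>w x\<bar>" for x
    have [measurable]: "u \<in> borel_measurable M" "w \<in> borel_measurable M" using uw F_meas by auto
    have "v \<in> borel_measurable M" unfolding v_def by measurable
    then have v: "v \<in> F \<and> N v \<le> ennreal K * (N u + N w)"
    proof (rule K[OF _ uw sum_dominatedI[of _ "{}"]])
      fix x y a b c d assume "u x = ereal a" "w x = ereal b" "u y = ereal c" "w y = ereal d"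
      then show "\<bar>v x - v y\<bar> \<le> ereal (\<bar>a - c\<bar> + \<bar>b - d\<bar>)"
        using max_abs_diff_le[of a b c d] by (simp add: v_def flip: ereal_max)
    next
      fix x a b assume "u x = ereal a" "w x = ereal b"
      then show "\<bar>v x\<bar> \<le> ereal (\<bar>a\<bar> + \<bar>b\<bar>)" by (simp add: v_def flip: ereal_max)
    qed auto
    have "cap V \<le> enn_powr (N v) p"
      using V by (intro cap_le[OF _ V(1)]) (auto simp: v v_def le_max_iff_disj)
    also have "\<dots> \<le> enn_powr (ennreal K * (N u + N w)) p"
      using v p_pos by (intro enn_powr_mono) auto
    also have "\<dots> = ennreal (K powr p) * enn_powr (N u + N w) p"
      using K0 p_pos by (simp add: enn_powr_mult enn_powr_ennreal)
    also have "\<dots> \<le> ennreal (K powr p) * (ennreal (2 powr p) * (enn_powr (N u) p + enn_powr (N w) p))"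
      by (intro mult_left_mono enn_powr_add_le p_pos) auto
    finally show "cap V \<le> ennreal (K powr p * 2 powr p) * (enn_powr (N u) p + enn_powr (N w) p)"
      by (simp add: ennreal_mult mult.assoc)
  qed (use K0 in auto)
qed

lemma cap_Un:
  obtains K :: real where "0 < K" "\<And>A B. cap (A \<union> B) \<le> ennreal K * (cap A + cap B)"
proof -
  obtain K where K0: "0 < K" and K: "\<And>u w V. u \<in> F \<Longrightarrow> w \<in> F \<Longrightarrow> open V \<Longrightarrow>
    \<forall>x\<in>V. 1 \<le> \<bar>u x\<bar> \<or> 1 \<le> \<bar>w x\<bar> \<Longrightarrow>
    cap V \<le> ennreal K * (enn_powr (N u) p + enn_powr (N w) p)"
    by (rule cap_le_two_functions) (rule that)
  have "cap (A \<union> B) \<le> ennreal K * (cap A + cap B)" for A B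
  proof (cases "cap A = \<infinity> \<or> cap B = \<infinity>")
    case True then show ?thesis using K0 by (auto simp: ennreal_mult_top)
  next
    case False
    have "cap (A \<union> B) \<le> ennreal K * (cap A + cap B) + ennreal e" if "0 < e" for e
    proof -
      define d where "d = e / (2 * K)"
      have d: "0 < ennreal d" "0 < d" using that K0 by (auto simp: d_def)
      have "cap A < cap A + ennreal d" "cap B < cap B + ennreal d"
        using False d by (auto simp: top.not_eq_extremum)
      then obtain u V w W where u: "u \<in> F" "open V" "A \<subseteq> V" "\<forall>x\<in>V. 1 \<le> u x" "enn_powr (N u) p < cap A + ennreal d"
        and w: "w \<in> F" "open W" "B \<subseteq> W" "\<forall>x\<in>W. 1 \<le> w x" "enn_powr (N w) p < cap B + ennreal d"
        by (elim cap_lessE) blast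
      have "cap (A \<union> B) \<le> cap (V \<union> W)" using u w by (intro cap_mono) auto
      also have "\<dots> \<le> ennreal K * (enn_powr (N u) p + enn_powr (N w) p)"
      proof (intro K u w ballI)
        fix x assume "x \<in> V \<union> W"
        then have "1 \<le> u x \<or> 1 \<le> w x" using u w by auto
        then show "1 \<le> \<bar>u x\<bar> \<or> 1 \<le> \<bar>w x\<bar>"
          by (auto intro: ereal_one_le_abs)
      qed (use u w in auto)
      also have "\<dots> \<le> ennreal K * ((cap A + ennreal d) + (cap B + ennreal d))"
        using u w by (intro mult_left_mono add_mono) auto
      also have "\<dots> = ennreal K * (cap A + cap B) + ennreal K * (ennreal d + ennreal d)"
        by (simp add: distrib_left ac_simps)
      also have "ennreal K * (ennreal d + ennreal d) = ennreal e"
        using d K0 by (simp add: ennreal_mult'[symmetric] ennreal_plus[symmetric] d_def del: ennreal_plus)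
      finally show ?thesis .
    qed
    then show ?thesis by (rule ennreal_le_epsilon)
  qed
  with K0 that show ?thesis by blast
qed

end

context capacity_space
begin

lemma sup_dominated_SUP: "sup_dominated \<mu> (\<lambda>x. SUP i. \<bar>w i x\<bar>) w"
  unfolding sup_dominated_def
proof (intro exI[of _ "{}"] conjI allI impI)
  fix x
  have "0 \<le> (SUP i. \<bar>w i x\<bar>)" by (rule SUP_upper2[of 0]) auto
  then show "\<bar>SUP i. \<bar>w i x\<bar>\<bar> \<le> (SUP i. \<bar>w i x\<bar>)" by simp
next
  fix x y assume fin: "(SUP i. \<bar>w i x\<bar>) \<noteq> \<infinity>" "(SUP i. \<bar>w i y\<bar>) \<noteq> \<infinity>"
  define D where "D = (SUP i. \<bar>w i x - w i y\<bar>)"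
  have pos: "0 \<le> (SUP i. \<bar>w i x\<bar>)" "0 \<le> (SUP i. \<bar>w i y\<bar>)" "0 \<le> D"
    unfolding D_def by (rule SUP_upper2[of 0], simp, simp)+
  have "\<bar>w i x\<bar> \<le> \<bar>w i y\<bar> + \<bar>w i x - w i y\<bar>" "\<bar>w i y\<bar> \<le> \<bar>w i x\<bar> + \<bar>w i x - w i y\<bar>" for i
    by (cases "w i x"; cases "w i y"; simp)+
  moreover have "\<bar>w i y\<bar> + \<bar>w i x - w i y\<bar> \<le> (SUP i. \<bar>w i y\<bar>) + D"
      "\<bar>w i x\<bar> + \<bar>w i x - w i y\<bar> \<le> (SUP i. \<bar>w i x\<bar>) + D" for i
    unfolding D_def by (intro add_mono SUP_upper UNIV_I)+
  ultimately have "(SUP i. \<bar>w i x\<bar>) \<le> (SUP i. \<bar>w i y\<bar>) + D" "(SUP i. \<bar>w i y\<bar>) \<le> (SUP i. \<bar>w i x\<bar>) + D"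
    by (meson SUP_least order_trans)+
  moreover obtain a b where "(SUP i. \<bar>w i x\<bar>) = ereal a" "(SUP i. \<bar>w i y\<bar>) = ereal b"
    using fin pos(1,2) by (cases "SUP i. \<bar>w i x\<bar>"; cases "SUP i. \<bar>w i y\<bar>") auto
  ultimately show "\<bar>(SUP i. \<bar>w i x\<bar>) - (SUP i. \<bar>w i y\<bar>)\<bar> \<le> (SUP i. \<bar>w i x - w i y\<bar>)"
    unfolding D_def[symmetric] using pos by (cases D) auto
qed simp

lemma SUP_geometric_in_F:
  "\<exists>K::real. 0 \<le> K \<and> (\<forall>w c. (\<forall>i. w i \<in> F) \<longrightarrow> (\<forall>i::nat. N (w i) \<le> ennreal (c * (1/4) ^ i)) \<longrightarrow>
      (\<lambda>x. SUP i. \<bar>w i x\<bar>) \<in> F \<and> N (\<lambda>x. SUP i. \<bar>w i x\<bar>) \<le> ennreal K * ennreal c)"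
proof -
  obtain K where K0: "0 \<le> K" and K: "\<And>v w. v \<in> borel_measurable M \<Longrightarrow> \<forall>i. w i \<in> F \<Longrightarrow> sup_dominated \<mu> v w \<Longrightarrow>
       (SUP i. 4 ^ i * N (w i)) < \<infinity> \<Longrightarrow> v \<in> F \<and> N v \<le> ennreal K * (SUP i. 4 ^ i * N (w i))"
    by (rule dominated_F_nonneg) (rule that)
  show ?thesis
  proof (intro exI[of _ K] conjI[OF K0] allI impI)
    fix w c assume w: "\<forall>i::nat. w i \<in> F" and c: "\<forall>i. N (w i) \<le> ennreal (c * (1/4) ^ i)"
    have [measurable]: "w i \<in> borel_measurable M" for i using w F_meas by auto
    have "(SUP i. 4 ^ i * N (w i)) \<le> ennreal c"
    proof (rule SUP_least)
      fix i
      have "4 ^ i * N (w i) \<le> ennreal (4 ^ i) * ennreal (c * (1/4) ^ i)"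
        using c[rule_format, of i] by (intro mult_mono) (auto simp flip: ennreal_power)
      also have "\<dots> = ennreal c"
        by (simp add: ennreal_mult'[symmetric] power_divide)
      finally show "4 ^ i * N (w i) \<le> ennreal c" .
    qed
    moreover have "(\<lambda>x. SUP i. \<bar>w i x\<bar>) \<in> borel_measurable M" by measurable
    ultimately show "(\<lambda>x. SUP i. \<bar>w i x\<bar>) \<in> F \<and> N (\<lambda>x. SUP i. \<bar>w i x\<bar>) \<le> ennreal K * ennreal c"
      using K[OF _ w sup_dominated_SUP] mult_left_mono[of "SUP i. 4 ^ i * N (w i)" "ennreal c" "ennreal K"]
        le_less_trans[of "SUP i. 4 ^ i * N (w i)" "ennreal c" \<infinity>]
      by (auto intro: order_trans)
  qed
qed

text \<open>
  Admissible functions for the \<open>E i\<close> can be chosen with norms at most \<open>e 4\<^sup>-\<^sup>i\<close>; their supremum is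
  then admissible for the union with norm at most a constant times \<open>e\<close>.
\<close>

lemma cap_null_UN:
  assumes "\<And>i::nat. cap (E i) = 0" shows "cap (\<Union>i. E i) = 0"
proof -
  obtain K where K: "\<forall>w c. (\<forall>i. w i \<in> F) \<longrightarrow> (\<forall>i::nat. N (w i) \<le> ennreal (c * (1/4) ^ i)) \<longrightarrow>
      (\<lambda>x. SUP i. \<bar>w i x\<bar>) \<in> F \<and> N (\<lambda>x. SUP i. \<bar>w i x\<bar>) \<le> ennreal K * ennreal c"
    using SUP_geometric_in_F by (elim exE conjE)
  have "enn_powr (cap (\<Union>i. E i)) (1/p) \<le> ennreal K * ennreal e" if e: "0 < e" for e
  proof -
    have "\<exists>u V. u \<in> F \<and> open V \<and> E i \<subseteq> V \<and> (\<forall>x\<in>V. 1 \<le> u x) \<and> N u \<le> ennreal (e * (1/4) ^ i)" for i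
    proof -
      have "cap (E i) < enn_powr (ennreal (e * (1/4) ^ i)) p"
        unfolding assms using e by (subst zero_less_iff_neq_zero) simp
      then obtain u V where "u \<in> F" "open V" "E i \<subseteq> V" "\<forall>x\<in>V. 1 \<le> u x"
         "enn_powr (N u) p < enn_powr (ennreal (e * (1/4) ^ i)) p"
        by (rule cap_lessE)
      moreover from this(5) have "N u \<le> ennreal (e * (1/4) ^ i)"
        using p_pos by (simp add: enn_powr_less_iff)
      ultimately show ?thesis by blast
    qed
    then obtain u V where uV: "\<And>i. u i \<in> F" "\<And>i. open (V i)" "\<And>i. E i \<subseteq> V i" "\<And>i x. x \<in> V i \<Longrightarrow> 1 \<le> u i x"
      "\<And>i. N (u i) \<le> ennreal (e * (1/4) ^ i)" by metis
    define v where "v x = (SUP i. \<bar>u i x\<bar>)" for x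
    have v: "v \<in> F" "N v \<le> ennreal K * ennreal e"
      using K[rule_format, of u e] uV unfolding v_def[abs_def] by auto
    have "cap (\<Union>i. E i) \<le> enn_powr (N v) p"
    proof (rule cap_le)
      show "open (\<Union>i. V i)" "(\<Union>i. E i) \<subseteq> (\<Union>i. V i)" using uV by blast+
      fix x assume "x \<in> (\<Union>i. V i)"
      then obtain i where "x \<in> V i" by auto
      then have "1 \<le> \<bar>u i x\<bar>" using uV(4) by (auto intro: ereal_one_le_abs)
      then show "1 \<le> v x" unfolding v_def by (rule SUP_upper2[rotated]) simp
    qed (rule v)
    then have "enn_powr (cap (\<Union>i. E i)) (1/p) \<le> enn_powr (enn_powr (N v) p) (1/p)"
      using p_pos by (intro enn_powr_mono) auto
    also have "\<dots> = N v" using p_pos by (simp add: enn_powr_inverse)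
    finally show ?thesis using v by simp
  qed
  then have "enn_powr (cap (\<Union>i. E i)) (1/p) = 0"
    by (intro eq_0_if_le_cmult[of "ennreal K"]) auto
  then show ?thesis by simp
qed

text \<open>
  Off a set \<open>E\<close> of small capacity \<open>u\<close> is continuous, so the superlevel set together with an open
  neighbourhood of \<open>E\<close> is open, and on it either \<open>|u|/t\<close> or the function admissible for \<open>E\<close> is at least
  one.
\<close>

lemma cap_superlevel:
  obtains K :: real where "0 < K"
    "\<And>u t. u \<in> F \<Longrightarrow> quasicontinuous F N p u \<Longrightarrow> 0 < t \<Longrightarrow>
      cap {x. \<bar>u x\<bar> > ereal t} \<le> ennreal (K * t powr (- p)) * enn_powr (N u) p"
proof -
  obtain K where K0: "0 < K" and K: "\<And>u w V. u \<in> F \<Longrightarrow> w \<in> F \<Longrightarrow> open V \<Longrightarrow>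
    \<forall>x\<in>V. 1 \<le> \<bar>u x\<bar> \<or> 1 \<le> \<bar>w x\<bar> \<Longrightarrow>
    cap V \<le> ennreal K * (enn_powr (N u) p + enn_powr (N w) p)"
    by (rule cap_le_two_functions) (rule that)
  show ?thesis
  proof (rule that[OF K0])
    fix u t assume u: "u \<in> F" and qc: "quasicontinuous F N p u" and t: "(0::real) < t"
    have "cap {x. \<bar>u x\<bar> > ereal t} \<le> ennreal (K * t powr (- p)) * enn_powr (N u) p + ennreal e" if e: "0 < e" for e
    proof -
      define d where "d = e / K"
      have d: "0 < d" using e K0 by (simp add: d_def)
      obtain E where E: "cap E < ennreal d" "continuous_on (- E) u"
        using qc d unfolding quasicontinuous_def by auto
      obtain w U where w: "w \<in> F" "open U" "E \<subseteq> U" "\<forall>x\<in>U. 1 \<le> w x" "enn_powr (N w) p < ennreal d"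
        by (rule cap_lessE[OF E(1)])
      have "continuous_on (- U) u" using E(2) w(3) by (elim continuous_on_subset) auto
      moreover have "open ({ereal t<..} \<union> {..<ereal (-t)})" by auto
      ultimately obtain A where A: "open A" "A \<inter> - U = u -` ({ereal t<..} \<union> {..<ereal (-t)}) \<inter> - U"
        unfolding continuous_on_open_invariant by blast
      have *: "\<bar>z\<bar> > ereal t \<longleftrightarrow> z \<in> {ereal t<..} \<union> {..<ereal (-t)}" for z
        using t by (cases z) auto
      have "{x. \<bar>u x\<bar> > ereal t} \<subseteq> A \<union> U" using A(2) unfolding * by blast
      then have "cap {x. \<bar>u x\<bar> > ereal t} \<le> cap (A \<union> U)" by (rule cap_mono)
      also have "\<dots> \<le> ennreal K * (enn_powr (N (\<lambda>x. ereal (1/t) * u x)) p + enn_powr (N w) p)"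
      proof (rule K)
        show "(\<lambda>x. ereal (1/t) * u x) \<in> F" using t u by (intro scale_F) auto
        show "\<forall>x\<in>A \<union> U. 1 \<le> \<bar>ereal (1/t) * u x\<bar> \<or> 1 \<le> \<bar>w x\<bar>"
        proof
          fix x assume x: "x \<in> A \<union> U"
          show "1 \<le> \<bar>ereal (1/t) * u x\<bar> \<or> 1 \<le> \<bar>w x\<bar>"
          proof (cases "x \<in> U")
            case True then show ?thesis using w by (auto intro: ereal_one_le_abs)
          next
            case False
            then have "\<bar>u x\<bar> > ereal t" using x A(2) unfolding * by blast
            then have "1 \<le> \<bar>ereal (1/t) * u x\<bar>"
              using t by (cases "u x") (auto simp: abs_mult field_simps)
            then show ?thesis ..
          qed
        qed
      qed (use w A in auto)
      also have "\<dots> \<le> ennreal K * (ennreal (t powr (-p)) * enn_powr (N u) p + ennreal d)"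
      proof (intro mult_left_mono add_mono)
        have "enn_powr (N (\<lambda>x. ereal (1/t) * u x)) p \<le> enn_powr (ennreal (1/t) * N u) p"
          using t u p_pos by (intro enn_powr_mono scale_F) auto
        also have "\<dots> = ennreal (t powr (-p)) * enn_powr (N u) p"
          using t p_pos by (simp add: enn_powr_mult enn_powr_ennreal powr_divide powr_minus field_simps)
        finally show "enn_powr (N (\<lambda>x. ereal (1/t) * u x)) p \<le> ennreal (t powr (-p)) * enn_powr (N u) p" .
      qed (use w in auto)
      also have "\<dots> = ennreal (K * t powr (- p)) * enn_powr (N u) p + ennreal e"
        using K0 d by (simp add: distrib_left ennreal_mult'[symmetric] mult.assoc[symmetric] d_def)
      finally show ?thesis .
    qed
    then show "cap {x. \<bar>u x\<bar> > ereal t} \<le> ennreal (K * t powr (- p)) * enn_powr (N u) p"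
      by (rule ennreal_le_epsilon)
  qed
qed

lemma quasicontinuous_diff:
  assumes "quasicontinuous F N p u" "continuous_on UNIV f"
  shows "quasicontinuous F N p (\<lambda>x. u x - ereal (f x))"
  unfolding quasicontinuous_def
proof (intro allI impI)
  fix e :: real assume "0 < e"
  then obtain E where E: "cap E < ennreal e" "continuous_on (- E) u"
    using assms unfolding quasicontinuous_def by auto
  have "continuous_on (- E) (\<lambda>x. u x - ereal (f x))"
    unfolding continuous_on_def
  proof
    fix x assume x: "x \<in> - E"
    have "(u \<longlongrightarrow> u x) (at x within - E)" using E x by (auto simp: continuous_on_def)
    moreover have "((\<lambda>x. ereal (f x)) \<longlongrightarrow> ereal (f x)) (at x within - E)"
      using continuous_on_subset[OF assms(2), of "- E"] x by (auto simp: continuous_on_def)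
    ultimately show "((\<lambda>x. u x - ereal (f x)) \<longlongrightarrow> u x - ereal (f x)) (at x within - E)"
      by (intro tendsto_diff_ereal_general) auto
  qed
  with E show "\<exists>E. cap E < ennreal e \<and> continuous_on (- E) (\<lambda>x. u x - ereal (f x))" by blast
qed

end

section \<open>Quasicontinuous representatives\<close>

context capacity_space
begin

text \<open>
  Choose continuous \<open>f\<^sub>k\<close> with \<open>N(u - f\<^sub>k) < 16\<^sup>-\<^sup>k\<close>. The open set \<open>G\<^sub>j\<close> where some later increment
  exceeds \<open>2\<^sup>-\<^sup>k\<close> has capacity of order \<open>8\<^sup>-\<^sup>j\<^sup>p\<close>, and off \<open>G\<^sub>j\<close> the \<open>f\<^sub>k\<close> converge uniformly. The limit is
  \<open>u\<close> almost everywhere because \<open>sup\<^sub>k 2\<^sup>k |u - f\<^sub>k|\<close> lies in the space and is therefore finite almost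
  everywhere.
\<close>

lemma quasicontinuous_representative:
  assumes u: "u \<in> F"
  obtains v :: "'a \<Rightarrow> real" where "(\<lambda>x. ereal (v x)) \<in> F" "quasicontinuous F N p (\<lambda>x. ereal (v x))"
    "AE x in M. u x = ereal (v x)"
proof -
  obtain K where K: "0 \<le> K" "\<forall>w c. (\<forall>i. w i \<in> F) \<longrightarrow> (\<forall>i::nat. N (w i) \<le> ennreal (c * (1/4) ^ i)) \<longrightarrow>
      (\<lambda>x. SUP i. \<bar>w i x\<bar>) \<in> F \<and> N (\<lambda>x. SUP i. \<bar>w i x\<bar>) \<le> ennreal K * ennreal c"
    using SUP_geometric_in_F by (elim exE conjE)
  obtain K1 where K10: "0 < K1" and K1: "\<And>v u w. v \<in> borel_measurable M \<Longrightarrow> u \<in> F \<Longrightarrow> w \<in> F \<Longrightarrow> sum_dominated \<mu> v u w \<Longrightarrow>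
      v \<in> F \<and> N v \<le> ennreal K1 * (N u + N w)"
    by (rule sum_dominated_F) (rule that)
  have "\<exists>f. continuous_on UNIV f \<and> (\<lambda>x. u x - ereal (f x)) \<in> F \<and>
           N (\<lambda>x. u x - ereal (f x)) < ennreal ((1/16) ^ k)" for k :: nat
    by (rule dense_F[OF u]) simp
  then obtain f where f: "\<And>k. continuous_on UNIV (f k)" and w: "\<And>k. (\<lambda>x. u x - ereal (f k x)) \<in> F"
    "\<And>k. N (\<lambda>x. u x - ereal (f k x)) < ennreal ((1/16) ^ k)"
    by metis
  define d where "d k x = 2 ^ k * (f (Suc k) x - f k x)" for k x
  have cont_d: "continuous_on A (d k)" for k A
    unfolding d_def[abs_def] by (intro continuous_intros continuous_on_subset[OF f]) auto
  have d: "(\<lambda>x. ereal (d k x)) \<in> F \<and> N (\<lambda>x. ereal (d k x)) \<le> ennreal (2 * K1 * (1/8) ^ k)" for k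
  proof -
    define e where "e x = ereal (f (Suc k) x - f k x)" for x
    have "e \<in> F \<and> N e \<le> ennreal K1 * (N (\<lambda>x. u x - ereal (f (Suc k) x)) + N (\<lambda>x. u x - ereal (f k x)))"
    proof (rule K1[OF _ w(1) w(1)])
      show "e \<in> borel_measurable M"
        unfolding e_def by (intro borel_measurable_ereal continuous_measurable_M continuous_intros f)
      show "sum_dominated \<mu> e (\<lambda>x. u x - ereal (f (Suc k) x)) (\<lambda>x. u x - ereal (f k x))"
      proof (rule sum_dominatedI[of _ "{}"])
        fix x a b assume "u x - ereal (f (Suc k) x) = ereal a" "u x - ereal (f k x) = ereal b"
        then show "\<bar>e x\<bar> \<le> ereal (\<bar>a\<bar> + \<bar>b\<bar>)" by (cases "u x") (auto simp: e_def)
      next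
        fix x y a b a' b' assume "u x - ereal (f (Suc k) x) = ereal a" "u x - ereal (f k x) = ereal b"
          "u y - ereal (f (Suc k) y) = ereal a'" "u y - ereal (f k y) = ereal b'"
        then show "\<bar>e x - e y\<bar> \<le> ereal (\<bar>a - a'\<bar> + \<bar>b - b'\<bar>)"
          by (cases "u x"; cases "u y") (auto simp: e_def)
      qed auto
    qed
    moreover have "ennreal K1 * (N (\<lambda>x. u x - ereal (f (Suc k) x)) + N (\<lambda>x. u x - ereal (f k x)))
        \<le> ennreal (2 * K1 * (1/16) ^ k)"
    proof -
      have "N (\<lambda>x. u x - ereal (f (Suc k) x)) \<le> ennreal ((1/16) ^ k)"
        by (rule order_trans[OF less_imp_le[OF w(2)]]) (auto intro!: ennreal_leI)
      then have "N (\<lambda>x. u x - ereal (f (Suc k) x)) + N (\<lambda>x. u x - ereal (f k x)) \<le> ennreal ((1/16) ^ k) + ennreal ((1/16) ^ k)"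
        using w(2)[of k] by (intro add_mono) auto
      also have "\<dots> = ennreal (2 * (1/16) ^ k)" by (simp flip: ennreal_plus)
      finally have "ennreal K1 * (N (\<lambda>x. u x - ereal (f (Suc k) x)) + N (\<lambda>x. u x - ereal (f k x))) \<le> ennreal K1 * ennreal (2 * (1/16) ^ k)"
        by (rule mult_left_mono) simp
      then show ?thesis using K10 by (simp add: ennreal_mult'[symmetric] mult_ac)
    qed
    ultimately have e: "e \<in> F" "N e \<le> ennreal (2 * K1 * (1/16) ^ k)" by auto
    have eq: "(\<lambda>x. ereal (d k x)) = (\<lambda>x. ereal (2 ^ k) * e x)" by (simp add: d_def e_def fun_eq_iff)
    have "N (\<lambda>x. ereal (d k x)) \<le> ennreal (2 ^ k) * N e"
      unfolding eq by (rule scale_F) (use e in auto)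
    also have "\<dots> \<le> ennreal (2 ^ k) * ennreal (2 * K1 * (1/16) ^ k)" by (intro mult_left_mono e) simp
    also have "\<dots> = ennreal (2 * K1 * (1/8) ^ k)"
      using K10 power_mult_distrib[of "2::real" "1/16" k] by (simp add: ennreal_mult'[symmetric] mult_ac)
    finally show ?thesis unfolding eq using e by (auto intro: scale_F)
  qed
  define G where "G j = (\<Union>i. {x. 1 < \<bar>d (j + i) x\<bar>})" for j
  have open_G: "open (G j)" for j
    unfolding G_def by (intro open_UN ballI open_Collect_less continuous_intros cont_d)
  have cap_G: "cap (G j) \<le> enn_powr (ennreal (K * (2 * K1) * (1/8) ^ j)) p" for j
  proof -
    define V where "V x = (SUP i. \<bar>ereal (d (j + i) x)\<bar>)" for x
    have "N (\<lambda>x. ereal (d (j + i) x)) \<le> ennreal (2 * K1 * (1/8) ^ j * (1/4) ^ i)" for i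
    proof -
      have "N (\<lambda>x. ereal (d (j + i) x)) \<le> ennreal (2 * K1 * (1/8) ^ (j + i))" using d by blast
      also have "\<dots> \<le> ennreal (2 * K1 * (1/8) ^ j * (1/4) ^ i)"
        unfolding power_add mult.assoc using K10
        by (intro ennreal_leI mult_left_mono power_mono) auto
      finally show ?thesis .
    qed
    then have V: "V \<in> F" "N V \<le> ennreal K * ennreal (2 * K1 * (1/8) ^ j)"
      using K(2)[rule_format, of "\<lambda>i x. ereal (d (j + i) x)" "2 * K1 * (1/8) ^ j"] d
      unfolding V_def[abs_def] by auto
    have "cap (G j) \<le> enn_powr (N V) p"
    proof (rule cap_le[OF V(1) open_G order_refl])
      fix x assume "x \<in> G j"
      then obtain i where "1 < \<bar>d (j + i) x\<bar>" by (auto simp: G_def)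
      then have "1 \<le> \<bar>ereal (d (j + i) x)\<bar>" by (simp add: one_ereal_def)
      then show "1 \<le> V x" unfolding V_def by (rule SUP_upper2[rotated]) simp
    qed
    also have "\<dots> \<le> enn_powr (ennreal K * ennreal (2 * K1 * (1/8) ^ j)) p"
      by (intro enn_powr_mono p_pos V)
    finally show ?thesis using K(1) K10 by (simp add: ennreal_mult'[symmetric] mult_ac)
  qed
  define v where "v x = lim (\<lambda>k. f k x)" for x
  have cont_v: "continuous_on (- G j) v" for j
  proof -
    define g where "g i x = f (Suc (j + i)) x - f (j + i) x" for i x
    have g: "\<bar>g i x\<bar> \<le> (1/2) ^ i" if "x \<in> - G j" for x i
    proof -
      have "2 ^ (j + i) * \<bar>g i x\<bar> \<le> 1" using that by (auto simp: G_def g_def d_def abs_mult not_less)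
      then have "\<bar>g i x\<bar> \<le> (1/2) ^ (j + i)" by (simp add: field_simps power_divide)
      also have "\<dots> \<le> (1/2) ^ i" by (rule power_decreasing) auto
      finally show ?thesis .
    qed
    have unif: "uniform_limit (- G j) (\<lambda>n x. \<Sum>i<n. g i x) (\<lambda>x. suminf (\<lambda>i. g i x)) sequentially"
      using g by (intro Weierstrass_m_test[where M="\<lambda>i. (1/2) ^ i"]) (auto intro: summable_geometric)
    have sum_g: "(\<Sum>i<n. g i x) = f (j + n) x - f j x" for n x
      by (induction n) (auto simp: g_def)
    have "continuous_on (- G j) (\<lambda>x. f j x + suminf (\<lambda>i. g i x))"
    proof (intro continuous_on_add continuous_on_subset[OF f] uniform_limit_theorem[OF _ unif])
      show "\<forall>\<^sub>F n in sequentially. continuous_on (- G j) (\<lambda>x. \<Sum>i<n. g i x)"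
        unfolding sum_g by (intro always_eventually allI continuous_intros continuous_on_subset[OF f]) auto
    qed auto
    moreover have "v x = f j x + suminf (\<lambda>i. g i x)" if x: "x \<in> - G j" for x
    proof -
      have "(\<lambda>n. \<Sum>i<n. g i x) \<longlonglongrightarrow> suminf (\<lambda>i. g i x)"
        using tendsto_uniform_limitI[OF unif x] .
      then have "(\<lambda>n. f j x + (f (j + n) x - f j x)) \<longlonglongrightarrow> f j x + suminf (\<lambda>i. g i x)"
        unfolding sum_g by (intro tendsto_intros)
      then have "(\<lambda>n. f (n + j) x) \<longlonglongrightarrow> f j x + suminf (\<lambda>i. g i x)"
        by (simp add: add.commute)
      then show ?thesis unfolding v_def by (intro limI) (rule LIMSEQ_offset)
    qed
    ultimately show ?thesis by (metis (no_types, lifting) continuous_on_cong)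
  qed
  have qc: "quasicontinuous F N p (\<lambda>x. ereal (v x))"
    unfolding quasicontinuous_def
  proof (intro allI impI)
    fix e :: real assume e: "0 < e"
    have "(\<lambda>j. ennreal (K * (2 * K1) * (1/8) ^ j)) \<longlonglongrightarrow> ennreal (K * (2 * K1) * 0)"
      by (intro tendsto_ennrealI tendsto_intros LIMSEQ_power_zero) auto
    then have "(\<lambda>j. enn_powr (ennreal (K * (2 * K1) * (1/8) ^ j)) p) \<longlonglongrightarrow> 0"
      by (intro tendsto_enn_powr_0 p_pos) simp
    then have "\<forall>\<^sub>F j in sequentially. enn_powr (ennreal (K * (2 * K1) * (1/8) ^ j)) p < ennreal e"
      using e by (simp add: order_tendsto_iff)
    then obtain j where "enn_powr (ennreal (K * (2 * K1) * (1/8) ^ j)) p < ennreal e"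
      by (auto simp: eventually_sequentially)
    then have "cap (G j) < ennreal e" using cap_G[of j] by (rule le_less_trans[rotated])
    then show "\<exists>E. cap E < ennreal e \<and> continuous_on (- E) (\<lambda>x. ereal (v x))"
      using cont_v by (intro exI[of _ "G j"]) (auto intro: continuous_on_ereal)
  qed
  define W where "W x = (SUP i. \<bar>ereal (2 ^ i) * (u x - ereal (f i x))\<bar>)" for x
  have "N (\<lambda>x. ereal (2 ^ i) * (u x - ereal (f i x))) \<le> ennreal (1 * (1/4) ^ i)" for i
  proof -
    have "N (\<lambda>x. ereal (2 ^ i) * (u x - ereal (f i x))) \<le> ennreal (2 ^ i) * N (\<lambda>x. u x - ereal (f i x))"
      by (rule scale_F) (use w in auto)
    also have "\<dots> \<le> ennreal (2 ^ i) * ennreal ((1/16) ^ i)" using w by (intro mult_left_mono) (auto simp: less_imp_le)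
    also have "\<dots> = ennreal ((1/8) ^ i)"
      using power_mult_distrib[of "2::real" "1/16" i] by (simp add: ennreal_mult'[symmetric])
    also have "\<dots> \<le> ennreal (1 * (1/4) ^ i)" unfolding mult_1 by (intro ennreal_leI power_mono) auto
    finally show ?thesis .
  qed
  moreover have "(\<lambda>x. ereal (2 ^ i) * (u x - ereal (f i x))) \<in> F" for i
    by (rule scale_F(1)[OF w(1)]) simp
  ultimately have "W \<in> F"
    using K(2)[rule_format, of "\<lambda>i x. ereal (2 ^ i) * (u x - ereal (f i x))" 1]
    unfolding W_def[abs_def] by blast
  from F_finite_AE[OF this] have ae: "AE x in M. u x = ereal (v x)"
  proof eventually_elim
    fix x assume W: "\<bar>W x\<bar> \<noteq> \<infinity>"
    have le: "\<bar>ereal (2 ^ i) * (u x - ereal (f i x))\<bar> \<le> W x" for i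
      unfolding W_def by (rule SUP_upper) simp
    obtain r where r: "W x = ereal r" using W by auto
    obtain a where a: "u x = ereal a" using le[of 0] r by (cases "u x") auto
    have "\<bar>f i x - a\<bar> \<le> r * (1/2) ^ i" for i
    proof -
      have "\<bar>2 ^ i * (a - f i x)\<bar> \<le> r" using le[of i] r a by simp
      then have "2 ^ i * \<bar>f i x - a\<bar> \<le> r" by (simp add: abs_mult abs_minus_commute)
      then show ?thesis by (simp add: field_simps power_divide)
    qed
    then have "\<forall>\<^sub>F i in sequentially. norm (f i x - a) \<le> r * (1/2) ^ i" by simp
    moreover have "(\<lambda>i. r * (1/2) ^ i) \<longlonglongrightarrow> 0"
      by (rule tendsto_mult_right_zero[OF LIMSEQ_power_zero]) simp
    ultimately have "(\<lambda>i. f i x - a) \<longlonglongrightarrow> 0" by (rule Lim_null_comparison)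
    then have "(\<lambda>i. f i x) \<longlonglongrightarrow> a" by (simp add: LIM_zero_iff)
    then show "u x = ereal (v x)" unfolding a v_def by (simp add: limI)
  qed
  show ?thesis by (rule that[OF F_cong_AE[OF u ae] qc ae])
qed

end

section \<open>Limits along a differentiation basis\<close>

text \<open>
  The suprema over basis sets of diameter below \<open>\<epsilon>\<close> increase with \<open>\<epsilon>\<close>, so their limit at zero is an
  infimum. The dual fact handles the lower limit.
\<close>

lemma Lim_at_right_0_mono:
  fixes f :: "real \<Rightarrow> ereal"
  assumes "\<And>a b. 0 < a \<Longrightarrow> a \<le> b \<Longrightarrow> f a \<le> f b"
  shows "Lim (at_right 0) f = (INF e\<in>{0<..}. f e)"
proof (rule tendsto_Lim)
  show "(f \<longlongrightarrow> (INF e\<in>{0<..}. f e)) (at_right 0)"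
  proof (rule order_tendstoI)
    fix a assume "a < (INF e\<in>{0<..}. f e)"
    then have "a < f e" if "0 < e" for e using that by (meson INF_lower greaterThan_iff less_le_trans)
    then show "\<forall>\<^sub>F x in at_right 0. a < f x"
      by (auto simp: eventually_at_right_field intro!: exI[of _ 1])
  next
    fix a assume "(INF e\<in>{0<..}. f e) < a"
    then obtain e where "0 < e" "f e < a" by (auto simp: INF_less_iff)
    then show "\<forall>\<^sub>F x in at_right 0. f x < a"
      using assms by (auto simp: eventually_at_right_field intro!: exI[of _ e] elim: le_less_trans[rotated])
  qed
qed simp

lemma Lim_at_right_0_antimono:
  fixes f :: "real \<Rightarrow> ereal"
  assumes "\<And>a b. 0 < a \<Longrightarrow> a \<le> b \<Longrightarrow> f b \<le> f a"
  shows "Lim (at_right 0) f = (SUP e\<in>{0<..}. f e)"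
proof (rule tendsto_Lim)
  show "(f \<longlongrightarrow> (SUP e\<in>{0<..}. f e)) (at_right 0)"
  proof (rule order_tendstoI)
    fix a assume "(SUP e\<in>{0<..}. f e) < a"
    then have "f e < a" if "0 < e" for e using that by (meson SUP_upper greaterThan_iff le_less_trans)
    then show "\<forall>\<^sub>F x in at_right 0. f x < a"
      by (auto simp: eventually_at_right_field intro!: exI[of _ 1])
  next
    fix a assume "a < (SUP e\<in>{0<..}. f e)"
    then obtain e where "0 < e" "a < f e" by (auto simp: less_SUP_iff)
    then show "\<forall>\<^sub>F x in at_right 0. a < f x"
      using assms by (auto simp: eventually_at_right_field intro!: exI[of _ e] elim: less_le_trans)
  qed
qed simp

lemma basis_limsup_eq: "basis_limsup \<B> x \<phi> = (INF e\<in>{0<..}. SUP B \<in> {B \<in> \<B> x. diameter B < e}. \<phi> B)"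
  unfolding basis_limsup_def by (intro Lim_at_right_0_mono SUP_subset_mono) auto

lemma basis_liminf_eq: "basis_liminf \<B> x \<phi> = (SUP e\<in>{0<..}. INF B \<in> {B \<in> \<B> x. diameter B < e}. \<phi> B)"
  unfolding basis_liminf_def by (intro Lim_at_right_0_antimono INF_superset_mono) auto

lemma basis_limsup_lessE:
  assumes "basis_limsup \<B> x \<phi> < t"
  obtains e where "0 < e" "\<forall>B\<in>\<B> x. diameter B < e \<longrightarrow> \<phi> B < t"
proof -
  obtain e where e: "0 < e" "(SUP B \<in> {B \<in> \<B> x. diameter B < e}. \<phi> B) < t"
    using assms by (auto simp: basis_limsup_eq INF_less_iff)
  have "\<phi> B < t" if "B \<in> \<B> x" "diameter B < e" for B
    using that by (intro le_less_trans[OF _ e(2)] SUP_upper) auto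
  with e(1) that show ?thesis by blast
qed

lemma has_basis_limitI:
  assumes ne: "\<And>e. 0 < e \<Longrightarrow> \<exists>B\<in>\<B> x. diameter B < e"
    and lim: "\<And>t::real. 0 < t \<Longrightarrow> \<exists>e>0. \<forall>B\<in>\<B> x. diameter B < e \<longrightarrow> ereal (a - t) \<le> \<phi> B \<and> \<phi> B \<le> ereal (a + t)"
  shows "has_basis_limit \<B> x \<phi> (ereal a)"
proof -
  have 1: "basis_liminf \<B> x \<phi> \<le> basis_limsup \<B> x \<phi>"
    unfolding basis_limsup_eq basis_liminf_eq
  proof (intro SUP_least INF_greatest)
    fix e d :: real assume "e \<in> {0<..}" "d \<in> {0<..}"
    then obtain B where B: "B \<in> \<B> x" "diameter B < min e d" using ne[of "min e d"] by auto
    have "(INF B \<in> {B \<in> \<B> x. diameter B < e}. \<phi> B) \<le> \<phi> B" using B by (intro INF_lower) auto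
    also have "\<phi> B \<le> (SUP B \<in> {B \<in> \<B> x. diameter B < d}. \<phi> B)" using B by (intro SUP_upper) auto
    finally show "(INF B \<in> {B \<in> \<B> x. diameter B < e}. \<phi> B) \<le> (SUP B \<in> {B \<in> \<B> x. diameter B < d}. \<phi> B)" .
  qed
  have 2: "basis_limsup \<B> x \<phi> \<le> ereal a"
  proof (rule ereal_le_epsilon2)
    fix t :: real assume "0 < t"
    then obtain e where "0 < e" "\<forall>B\<in>\<B> x. diameter B < e \<longrightarrow> \<phi> B \<le> ereal (a + t)" using lim by blast
    then show "basis_limsup \<B> x \<phi> \<le> ereal a + ereal t"
      unfolding basis_limsup_eq by (intro INF_lower2[of e] SUP_least) auto
  qed
  have 3: "ereal a \<le> basis_liminf \<B> x \<phi>"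
  proof (rule ereal_le_epsilon2)
    fix t :: real assume "0 < t"
    then obtain e where "0 < e" "\<forall>B\<in>\<B> x. diameter B < e \<longrightarrow> ereal (a - t) \<le> \<phi> B" using lim by blast
    then have "ereal (a - t) \<le> basis_liminf \<B> x \<phi>"
      unfolding basis_liminf_eq by (intro SUP_upper2[of e] INF_greatest) auto
    then have "ereal (a - t) + ereal t \<le> basis_liminf \<B> x \<phi> + ereal t" by (rule add_right_mono)
    then show "ereal a \<le> basis_liminf \<B> x \<phi> + ereal t" by simp
  qed
  show ?thesis unfolding has_basis_limit_def using 1 2 3 by (auto intro: antisym order_trans)
qed

section \<open>Equivalence of the three claims\<close>

context capacity_space
begin

lemma median_cong_AE:
  assumes "AE x in M. u x = v x" shows "median \<mu> \<gamma> u A = median \<mu> \<gamma> v A"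
proof -
  have Z: "\<mu> {x. u x \<noteq> v x} = 0" using assms by (simp add: AE_M_iff)
  have "\<mu> {x \<in> A. u x > ereal a} = \<mu> {x \<in> A. v x > ereal a}" for a
    by (rule mu_cong_AE[OF Z]) auto
  then show ?thesis by (simp add: median_def)
qed

abbreviation "MedSup \<B> \<gamma> u t \<equiv> {x. basis_limsup \<B> x (median \<mu> \<gamma> (\<lambda>y. \<bar>u y\<bar>)) > ereal t}"

text \<open>
  The constant does not depend on \<open>\<gamma>\<close>: it is the product of the constants in the domination
  principle, in subadditivity and in the capacitary weak type estimate.
\<close>

lemma weak_type_if_Lebesgue_points:
  assumes claim1: "\<forall>u \<in> F. quasicontinuous F N p u \<longrightarrow>
         (\<exists>E. cap E = 0 \<and>
            (\<forall>\<gamma>::real. 0 < \<gamma> \<and> \<gamma> < 1 \<longrightarrow>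
               (\<forall>x \<in> - E. has_basis_limit \<B> x (median \<mu> \<gamma> u) (u x))))"
  shows "\<exists>C::real. 0 \<le> C \<and> (\<forall>\<gamma>::real. 0 < \<gamma> \<and> \<gamma> < 1 \<longrightarrow> (\<forall>t::real. 0 < t \<longrightarrow> (\<forall>u \<in> F.
            cap (MedSup \<B> \<gamma> u t)
              \<le> ennreal (C * t powr (- p)) * enn_powr (N u) p)))"
proof -
  obtain K1 where K10: "0 < K1" and K1: "\<And>v u w. v \<in> borel_measurable M \<Longrightarrow> u \<in> F \<Longrightarrow> w \<in> F \<Longrightarrow> sum_dominated \<mu> v u w \<Longrightarrow>
      v \<in> F \<and> N v \<le> ennreal K1 * (N u + N w)"
    by (rule sum_dominated_F) (rule that)
  obtain K2 where K20: "0 < K2" and K2: "\<And>A B. cap (A \<union> B) \<le> ennreal K2 * (cap A + cap B)"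
    by (rule cap_Un) (rule that)
  obtain K3 where K30: "0 < K3" and K3: "\<And>u t. u \<in> F \<Longrightarrow> quasicontinuous F N p u \<Longrightarrow> 0 < t \<Longrightarrow>
      cap {x. \<bar>u x\<bar> > ereal t} \<le> ennreal (K3 * t powr (- p)) * enn_powr (N u) p"
    by (rule cap_superlevel) (rule that)
  define C where "C = K2 * K3 * K1 powr p"
  have "cap (MedSup \<B> \<gamma> u t)
              \<le> ennreal (C * t powr (- p)) * enn_powr (N u) p"
    if \<gamma>: "0 < \<gamma>" "\<gamma> < 1" and t: "0 < t" and u: "u \<in> F" for \<gamma> t u
  proof -
    obtain v where v: "(\<lambda>x. ereal (v x)) \<in> F" "quasicontinuous F N p (\<lambda>x. ereal (v x))"
      and ae: "AE x in M. u x = ereal (v x)"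
      by (rule quasicontinuous_representative[OF u])
    define w where "w x = ereal \<bar>v x\<bar>" for x
    have "w \<in> F \<and> N w \<le> ennreal K1 * (N u + N (\<lambda>_. 0))"
    proof (rule K1[OF _ u zero_F(1)])
      have "(\<lambda>x. \<bar>ereal (v x)\<bar>) \<in> borel_measurable M"
        using F_meas[OF v(1)] by (rule borel_measurable_ereal_abs)
      then show "w \<in> borel_measurable M" unfolding w_def by simp
      show "sum_dominated \<mu> w u (\<lambda>_. 0)"
        by (rule sum_dominatedI[of _ "{x. u x \<noteq> ereal (v x)}"]) (use ae in \<open>auto simp: AE_M_iff w_def\<close>)
    qed
    then have w: "w \<in> F" "N w \<le> ennreal K1 * N u" by (auto simp: zero_F)
    have qc: "quasicontinuous F N p w"
      unfolding quasicontinuous_def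
    proof (intro allI impI)
      fix e :: real assume "0 < e"
      then obtain E where E: "cap E < ennreal e" "continuous_on (- E) (\<lambda>x. ereal (v x))"
        using v(2) unfolding quasicontinuous_def by auto
      have "continuous_on (- E) v"
        using E(2) by (simp add: continuous_on_def)
      then have "continuous_on (- E) w" unfolding w_def by (intro continuous_on_ereal continuous_intros)
      with E show "\<exists>E. cap E < ennreal e \<and> continuous_on (- E) w" by blast
    qed
    obtain E where E: "cap E = 0" "\<And>x. x \<in> - E \<Longrightarrow> has_basis_limit \<B> x (median \<mu> \<gamma> w) (w x)"
      using claim1 w(1) qc \<gamma> by blast
    have "median \<mu> \<gamma> (\<lambda>y. \<bar>u y\<bar>) = median \<mu> \<gamma> w"
      using ae by (intro ext median_cong_AE) (auto simp: w_def elim: eventually_mono)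
    then have "(MedSup \<B> \<gamma> u t) \<subseteq> E \<union> {x. \<bar>w x\<bar> > ereal t}"
      using E(2) by (auto simp: has_basis_limit_def w_def)
    then have "cap (MedSup \<B> \<gamma> u t) \<le> cap (E \<union> {x. \<bar>w x\<bar> > ereal t})"
      by (rule cap_mono)
    also have "\<dots> \<le> ennreal K2 * (cap E + cap {x. \<bar>w x\<bar> > ereal t})" by (rule K2)
    also have "\<dots> \<le> ennreal K2 * (ennreal (K3 * t powr (- p)) * enn_powr (N w) p)"
      unfolding E(1) add_0 by (intro mult_left_mono K3 w qc t) auto
    also have "\<dots> \<le> ennreal K2 * (ennreal (K3 * t powr (- p)) * enn_powr (ennreal K1 * N u) p)"
      by (intro mult_left_mono enn_powr_mono p_pos w) auto
    also have "\<dots> = ennreal (C * t powr (- p)) * enn_powr (N u) p"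
      using K10 K20 K30 p_pos
      by (simp add: enn_powr_mult enn_powr_ennreal C_def ennreal_mult mult_ac)
    finally show ?thesis .
  qed
  then show ?thesis using K10 K20 K30 by (intro exI[of _ C]) (auto simp: C_def)
qed

lemma tendsto_0_if_weak_type:
  assumes C: "\<And>u. u \<in> F \<Longrightarrow> c u \<le> ennreal C * enn_powr (N u) p"
    and u: "\<forall>k. u k \<in> F" "(\<lambda>k. N (u k)) \<longlonglongrightarrow> 0"
  shows "(\<lambda>k. c (u k)) \<longlonglongrightarrow> 0"
proof (rule tendsto_sandwich[of "\<lambda>_. 0"])
  show "(\<lambda>k. ennreal C * enn_powr (N (u k)) p) \<longlonglongrightarrow> 0"
    using ennreal_tendsto_cmult[OF _ tendsto_enn_powr_0[OF p_pos u(2)], of "ennreal C"] by simp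
qed (use C u in auto)

text \<open>
  A point is \<open>good\<close> for \<open>n\<close> if on small basis sets \<open>|u - u(x)|\<close> exceeds \<open>4/(n+1)\<close> only on a part of
  relative measure below \<open>1/(n+2)\<close>. Every approximation \<open>f\<^sub>k\<close> confines the points that are not good to the
  set \<open>Bad k n\<close>, whose capacity tends to zero with \<open>k\<close>. A point that is good for all \<open>n\<close> has converging
  medians of every order, which makes the exceptional set independent of \<open>\<gamma>\<close>. Basis sets of measure zero
  are covered as well, since their medians are infinite and so place the point in \<open>Bad k n\<close>.
\<close>

lemma Lebesgue_points_if_continuity:
  assumes basis: "differentiation_basis \<mu> \<B>"
    and claim3: "\<forall>\<gamma>::real. 0 < \<gamma> \<and> \<gamma> < 1 \<longrightarrow> (\<forall>t::real. 0 < t \<longrightarrow>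
         (\<forall>u :: nat \<Rightarrow> 'a \<Rightarrow> ereal. (\<forall>k. u k \<in> F) \<and> (\<lambda>k. N (u k)) \<longlonglongrightarrow> 0 \<longrightarrow>
            (\<lambda>k. cap (MedSup \<B> \<gamma> (u k) t)) \<longlonglongrightarrow> 0))"
    and u: "u \<in> F" "quasicontinuous F N p u"
  shows "\<exists>E. cap E = 0 \<and> (\<forall>\<gamma>::real. 0 < \<gamma> \<and> \<gamma> < 1 \<longrightarrow>
               (\<forall>x \<in> - E. has_basis_limit \<B> x (median \<mu> \<gamma> u) (u x)))"
proof -
  obtain K2 where K20: "0 < K2" and K2: "\<And>A B. cap (A \<union> B) \<le> ennreal K2 * (cap A + cap B)"
    by (rule cap_Un) (rule that)
  obtain K3 where K30: "0 < K3" and K3: "\<And>u t. u \<in> F \<Longrightarrow> quasicontinuous F N p u \<Longrightarrow> 0 < t \<Longrightarrow>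
      cap {x. \<bar>u x\<bar> > ereal t} \<le> ennreal (K3 * t powr (- p)) * enn_powr (N u) p"
    by (rule cap_superlevel) (rule that)
  have "\<exists>f. continuous_on UNIV f \<and> (\<lambda>x. u x - ereal (f x)) \<in> F \<and>
           N (\<lambda>x. u x - ereal (f x)) < ennreal ((1/2) ^ k)" for k :: nat
    by (rule dense_F[OF u(1)]) simp
  then obtain f where f: "\<And>k. continuous_on UNIV (f k)" and w': "\<And>k. (\<lambda>x. u x - ereal (f k x)) \<in> F"
    "\<And>k. N (\<lambda>x. u x - ereal (f k x)) < ennreal ((1/2) ^ k)"
    by metis
  define w where "w k x = u x - ereal (f k x)" for k x
  have w: "w k \<in> F" "quasicontinuous F N p (w k)" for k
    using w' quasicontinuous_diff[OF u(2) f] by (auto simp: w_def[abs_def])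
  have Nw: "(\<lambda>k. N (w k)) \<longlonglongrightarrow> 0"
  proof (rule tendsto_sandwich[of "\<lambda>_. 0"])
    have "(\<lambda>k. ennreal ((1/2) ^ k)) \<longlonglongrightarrow> ennreal 0"
      by (intro tendsto_ennrealI LIMSEQ_power_zero) auto
    then show "(\<lambda>k. ennreal ((1/2) ^ k)) \<longlonglongrightarrow> 0" by simp
  qed (use w'(2) in \<open>auto simp: w_def[abs_def] less_imp_le\<close>)
  define t where "t n = 1 / (real n + 1)" for n
  define g where "g n = 1 / (real n + 2)" for n
  have tg: "0 < t n" "0 < g n" "g n < 1" for n by (auto simp: t_def g_def)
  define good where "good n x \<longleftrightarrow> (\<exists>a e. u x = ereal a \<and> 0 < e \<and> (\<forall>B\<in>\<B> x. diameter B < e \<longrightarrow>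
     \<mu> {y\<in>B. ereal (4 * t n) < \<bar>u y - u x\<bar>} < ennreal (g n) * \<mu> B))" for n x
  define Bad where "Bad k n = (MedSup \<B> (g n) (w k) (t n)) \<union> {x. \<bar>w k x\<bar> > ereal (t n)}" for k n
  have good: "good n x" if x: "x \<notin> Bad k n" for k n x
  proof -
    have le: "basis_limsup \<B> x (median \<mu> (g n) (\<lambda>y. \<bar>w k y\<bar>)) \<le> ereal (t n)" and wx: "\<bar>w k x\<bar> \<le> ereal (t n)"
      using x by (auto simp: Bad_def)
    have "basis_limsup \<B> x (median \<mu> (g n) (\<lambda>y. \<bar>w k y\<bar>)) < ereal (2 * t n)"
      by (rule le_less_trans[OF le]) (use tg in auto)
    then obtain e where e: "0 < e" "\<forall>B\<in>\<B> x. diameter B < e \<longrightarrow> median \<mu> (g n) (\<lambda>y. \<bar>w k y\<bar>) B < ereal (2 * t n)"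
      by (rule basis_limsup_lessE)
    obtain d where d: "0 < d" "\<And>y. dist y x < d \<Longrightarrow> dist (f k y) (f k x) < t n"
      using f[of k] tg(1)[of n] unfolding continuous_on_iff by (metis UNIV_I)
    obtain a where a: "u x = ereal a" using wx by (cases "u x") (auto simp: w_def)
    have "\<mu> {y\<in>B. ereal (4 * t n) < \<bar>u y - u x\<bar>} < ennreal (g n) * \<mu> B"
      if B: "B \<in> \<B> x" "diameter B < min e d" for B
    proof -
      have Bb: "bounded B" "x \<in> B" using basis B(1) by (auto simp: differentiation_basis_def)
      have "median \<mu> (g n) (\<lambda>y. \<bar>w k y\<bar>) B < ereal (2 * t n)" using e B by auto
      then obtain b where b: "\<mu> {y\<in>B. \<bar>w k y\<bar> > ereal b} < ennreal (g n) * \<mu> B" "b < 2 * t n"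
        unfolding median_def INF_less_iff by auto
      \<comment> \<open>Of \<open>4t\<close>, the continuous part and \<open>w(x)\<close> use up at most \<open>t\<close> each, which leaves \<open>2t > b\<close>.\<close>
      have "{y\<in>B. ereal (4 * t n) < \<bar>u y - u x\<bar>} \<subseteq> {y\<in>B. \<bar>w k y\<bar> > ereal b}"
      proof safe
        fix y assume y: "y \<in> B" "ereal (4 * t n) < \<bar>u y - u x\<bar>"
        have "dist y x < d"
          using diameter_bounded_bound[OF Bb(1) y(1) Bb(2)] B(2) by simp
        then have "\<bar>f k y - f k x\<bar> < t n" using d(2) by (simp add: dist_real_def)
        then show "\<bar>w k y\<bar> > ereal b"
          using y(2) wx b(2) unfolding w_def a by (cases "u y") auto
      qed
      then show ?thesis using b(1) mu_mono le_less_trans by blast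
    qed
    with a e(1) d(1) show "good n x"
      unfolding good_def by (intro exI[of _ a] exI[of _ "min e d"]) auto
  qed
  have cap0: "cap {x. \<not> good n x} = 0" for n
  proof -
    have 1: "(\<lambda>k. cap (MedSup \<B> (g n) (w k) (t n))) \<longlonglongrightarrow> 0"
      using claim3 tg w Nw by blast
    have 2: "(\<lambda>k. cap {x. \<bar>w k x\<bar> > ereal (t n)}) \<longlonglongrightarrow> 0"
    proof (rule tendsto_sandwich[of "\<lambda>_. 0"])
      show "(\<lambda>k. ennreal (K3 * t n powr (-p)) * enn_powr (N (w k)) p) \<longlonglongrightarrow> 0"
        using ennreal_tendsto_cmult[OF _ tendsto_enn_powr_0[OF p_pos Nw], of "ennreal (K3 * t n powr (-p))"] by simp
    qed (use K3[OF w tg(1)] in auto)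
    have "(\<lambda>k. ennreal K2 * (cap (MedSup \<B> (g n) (w k) (t n)) + cap {x. \<bar>w k x\<bar> > ereal (t n)})) \<longlonglongrightarrow> ennreal K2 * (0 + 0)"
      by (intro ennreal_tendsto_cmult tendsto_add 1 2) simp
    moreover have "cap {x. \<not> good n x} \<le> ennreal K2 * (cap (MedSup \<B> (g n) (w k) (t n)) + cap {x. \<bar>w k x\<bar> > ereal (t n)})" for k
    proof -
      have "cap {x. \<not> good n x} \<le> cap (Bad k n)" using good by (intro cap_mono) blast
      also have "\<dots> \<le> ennreal K2 * (cap (MedSup \<B> (g n) (w k) (t n)) + cap {x. \<bar>w k x\<bar> > ereal (t n)})"
        unfolding Bad_def by (rule K2)
      finally show ?thesis .
    qed
    ultimately have "cap {x. \<not> good n x} \<le> ennreal K2 * (0 + 0)"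
      by (intro LIMSEQ_le_const) auto
    then show ?thesis by simp
  qed
  have "has_basis_limit \<B> x (median \<mu> \<gamma> u) (u x)"
    if \<gamma>: "0 < \<gamma>" "\<gamma> < 1" and x: "\<And>n. good n x" for \<gamma> x
  proof -
    obtain a where a: "u x = ereal a" using x[of 0] by (auto simp: good_def)
    show ?thesis unfolding a
    proof (rule has_basis_limitI)
      show "\<exists>B\<in>\<B> x. diameter B < e" if "0 < e" for e
        using basis that by (auto simp: differentiation_basis_def)
    next
      fix r :: real assume r: "0 < r"
      define m where "m = min (min \<gamma> (1 - \<gamma>)) (r / 4)"
      have m: "0 < m" using \<gamma> r by (simp add: m_def)
      obtain n where n: "inverse (real (Suc n)) < m" using reals_Archimedean[OF m] by blast
      have "t n < m" using n by (simp add: t_def field_simps)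
      moreover have "g n \<le> t n" by (simp add: t_def g_def field_simps)
      ultimately have tn: "4 * t n \<le> r" "g n \<le> \<gamma>" "g n \<le> 1 - \<gamma>" by (auto simp: m_def)
      obtain e where e: "0 < e" "\<forall>B\<in>\<B> x. diameter B < e \<longrightarrow>
          \<mu> {y\<in>B. ereal (4 * t n) < \<bar>u y - u x\<bar>} < ennreal (g n) * \<mu> B"
        using x[of n] by (auto simp: good_def)
      have "ereal (a - r) \<le> median \<mu> \<gamma> u B \<and> median \<mu> \<gamma> u B \<le> ereal (a + r)" if B: "B \<in> \<B> x" "diameter B < e" for B
      proof
        have small: "\<mu> {y\<in>B. ereal (4 * t n) < \<bar>u y - u x\<bar>} < ennreal (g n) * \<mu> B" using e B by blast
        have "bounded B" using basis B(1) by (auto simp: differentiation_basis_def)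
        then obtain b where b: "\<mu> B = ennreal b" "0 \<le> b" using mu_bounded[of B] by (cases "\<mu> B") auto
        show "median \<mu> \<gamma> u B \<le> ereal (a + r)"
          unfolding median_def
        proof (rule INF_lower, simp)
          have "\<mu> {y\<in>B. ereal (a + r) < u y} \<le> \<mu> {y\<in>B. ereal (4 * t n) < \<bar>u y - u x\<bar>}"
          proof (rule mu_mono, safe)
            fix y assume "y \<in> B" "ereal (a + r) < u y"
            then show "ereal (4 * t n) < \<bar>u y - u x\<bar>" using tn unfolding a by (cases "u y") auto
          qed
          also note small
          also have "ennreal (g n) * \<mu> B \<le> ennreal \<gamma> * \<mu> B" using tn by (intro mult_right_mono ennreal_leI) auto
          finally show "\<mu> {y\<in>B. ereal (a + r) < u y} < ennreal \<gamma> * \<mu> B" .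
        qed
        show "ereal (a - r) \<le> median \<mu> \<gamma> u B"
          unfolding median_def
        proof (rule INF_greatest)
          fix c assume c: "c \<in> {c. \<mu> {y\<in>B. ereal c < u y} < ennreal \<gamma> * \<mu> B}"
          show "ereal (a - r) \<le> ereal c"
          proof (rule ccontr)
            assume "\<not> ereal (a - r) \<le> ereal c"
            then have ca: "c < a - r" by simp
            have "\<mu> B \<le> \<mu> ({y\<in>B. ereal c < u y} \<union> {y\<in>B. ereal (4 * t n) < \<bar>u y - u x\<bar>})"
            proof (rule mu_mono, safe)
              fix y assume "y \<in> B" "\<not> ereal (4 * t n) < \<bar>u y - u x\<bar>"
              then show "ereal c < u y" using tn ca unfolding a by (cases "u y") auto
            qed
            also have "\<dots> \<le> \<mu> {y\<in>B. ereal c < u y} + \<mu> {y\<in>B. ereal (4 * t n) < \<bar>u y - u x\<bar>}" by (rule mu_Un)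
            \<comment> \<open>The two parts cannot cover \<open>B\<close>, as their relative measures add up to less than one.\<close>
            also have "\<dots> < ennreal (\<gamma> * b + g n * b)"
              using c small b \<gamma> tg(2)[of n] by (intro add_mono_ennreal) (auto simp: ennreal_mult)
            also have "\<dots> \<le> ennreal b"
            proof (rule ennreal_leI)
              have "(\<gamma> + g n) * b \<le> 1 * b" using tn b by (intro mult_right_mono) auto
              then show "\<gamma> * b + g n * b \<le> b" by (simp add: algebra_simps)
            qed
            finally show False using b by simp
          qed
        qed
      qed
      with e(1) show "\<exists>e>0. \<forall>B\<in>\<B> x. diameter B < e \<longrightarrow> ereal (a - r) \<le> median \<mu> \<gamma> u B \<and> median \<mu> \<gamma> u B \<le> ereal (a + r)"
        by blast
    qed
  qed
  with cap_null_UN[OF cap0] show ?thesis by (intro exI[of _ "\<Union>n. {x. \<not> good n x}"]) auto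
qed

theorem Lebesgue_points_iff_weak_type:
  assumes basis: "differentiation_basis \<mu> \<B>"
  defines "claim1 \<equiv>
      (\<forall>u \<in> F. quasicontinuous F N p u \<longrightarrow>
         (\<exists>E. capacity F N p E = 0 \<and>
            (\<forall>\<gamma>::real. 0 < \<gamma> \<and> \<gamma> < 1 \<longrightarrow>
               (\<forall>x \<in> - E. has_basis_limit \<B> x (median \<mu> \<gamma> u) (u x)))))"
    and "claim2 \<equiv>
      (\<forall>\<gamma>::real. 0 < \<gamma> \<and> \<gamma> < 1 \<longrightarrow>
         (\<exists>C::real. 0 \<le> C \<and> (\<forall>t::real. 0 < t \<longrightarrow> (\<forall>u \<in> F.
            capacity F N p (MedSup \<B> \<gamma> u t)
              \<le> ennreal (C * t powr (- p)) * enn_powr (N u) p))))"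
    and "claim3 \<equiv>
      (\<forall>\<gamma>::real. 0 < \<gamma> \<and> \<gamma> < 1 \<longrightarrow> (\<forall>t::real. 0 < t \<longrightarrow>
         (\<forall>u :: nat \<Rightarrow> 'a \<Rightarrow> ereal. (\<forall>k. u k \<in> F) \<and> (\<lambda>k. N (u k)) \<longlonglongrightarrow> 0 \<longrightarrow>
            (\<lambda>k. capacity F N p
                   (MedSup \<B> \<gamma> (u k) t)) \<longlonglongrightarrow> 0)))"
  shows "(claim1 \<longleftrightarrow> claim2) \<and> (claim2 \<longleftrightarrow> claim3)"
proof -
  have 12: "claim2" if c1: claim1
  proof -
    obtain C where C: "0 \<le> C" "\<forall>\<gamma>::real. 0 < \<gamma> \<and> \<gamma> < 1 \<longrightarrow> (\<forall>t::real. 0 < t \<longrightarrow> (\<forall>u \<in> F.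
            cap (MedSup \<B> \<gamma> u t)
              \<le> ennreal (C * t powr (- p)) * enn_powr (N u) p))"
      using weak_type_if_Lebesgue_points[OF c1[unfolded claim1_def]] by (elim exE conjE)
    show ?thesis
      unfolding claim2_def by (intro allI impI exI[of _ C] conjI C(1)) (use C(2) in blast)
  qed
  have 23: "claim3" if c2: claim2
    unfolding claim3_def
  proof (intro allI impI, elim conjE)
    fix \<gamma> t :: real and u :: "nat \<Rightarrow> 'a \<Rightarrow> ereal"
    assume "0 < \<gamma>" "\<gamma> < 1" "0 < t" and u: "\<forall>k. u k \<in> F" "(\<lambda>k. N (u k)) \<longlonglongrightarrow> 0"
    then obtain C :: real where C: "\<forall>t>0. \<forall>u\<in>F.
        cap (MedSup \<B> \<gamma> u t) \<le> ennreal (C * t powr (- p)) * enn_powr (N u) p"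
      using c2[unfolded claim2_def, rule_format, of \<gamma>] by auto
    show "(\<lambda>k. cap (MedSup \<B> \<gamma> (u k) t)) \<longlonglongrightarrow> 0"
      by (rule tendsto_0_if_weak_type[OF C[rule_format, OF \<open>0 < t\<close>] u])
  qed
  have 31: "claim1" if claim3
    using Lebesgue_points_if_continuity[OF basis that[unfolded claim3_def]] unfolding claim1_def by blast
  show ?thesis using 12 23 31 by blast
qed

end

section \<open>Spaces defined by fractional gradients\<close>

lemma e2ennreal_le: "x \<le> enn2ereal y \<Longrightarrow> e2ennreal x \<le> y"
  using e2ennreal_mono[of x "enn2ereal y"] by simp

lemma abs_le_enn2ereal_iff: "\<bar>z\<bar> \<le> enn2ereal y \<longleftrightarrow> e2ennreal \<bar>z\<bar> \<le> y"
  by (metis e2ennreal_le enn2ereal_e2ennreal abs_ereal_pos less_eq_ennreal.rep_eq)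

lemma e2ennreal_cmult_abs: "0 < c \<Longrightarrow> e2ennreal (ereal c * \<bar>z\<bar>) = ennreal c * e2ennreal \<bar>z\<bar>"
  by (cases z) (auto simp: ennreal_mult ennreal_mult_top)

lemma ereal_cmult_diff: "0 < c \<Longrightarrow> \<bar>ereal c * a - ereal c * b\<bar> = ereal c * \<bar>a - b\<bar>"
  by (cases a; cases b) (auto simp: abs_mult simp flip: right_diff_distrib)

text \<open>
  \<open>R\<close> stands for either of the quasi-norms \<open>L\<^sup>p(l\<^sup>q)\<close> and \<open>l\<^sup>q(L\<^sup>p)\<close> of a sequence of functions.
\<close>

locale gradient_space = mm_space \<mu> for \<mu> :: "'a::metric_space set \<Rightarrow> ennreal" +
  fixes p s :: real and R :: "(int \<Rightarrow> 'a \<Rightarrow> ennreal) \<Rightarrow> ennreal"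
  assumes p_pos: "0 < p" and s_pos: "0 < s"
    and R_mono: "(\<And>k x. g k x \<le> h k x) \<Longrightarrow> R g \<le> R h"
    and R_cmult: "(\<And>k. g k \<in> borel_measurable (carath_measure \<mu>)) \<Longrightarrow> R (\<lambda>k x. c * g k x) = c * R g"
    and R_SUP: "\<exists>C::real. 0 \<le> C \<and> (\<forall>g :: nat \<Rightarrow> int \<Rightarrow> 'a \<Rightarrow> ennreal.
        (\<forall>i k. g i k \<in> borel_measurable (carath_measure \<mu>)) \<longrightarrow>
        R (\<lambda>k x. SUP i. g i k x) \<le> ennreal C * (SUP i. 4 ^ i * R (g i)))"
begin

abbreviation "grad_norm u \<equiv> INF g \<in> fractional_s_gradients \<mu> s u. R g"

definition gnorm :: "('a \<Rightarrow> ereal) \<Rightarrow> ennreal" where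
  "gnorm u = Lp_norm M p (eabs u) + grad_norm u"

definition gspace :: "('a \<Rightarrow> ereal) set" where
  "gspace = {u \<in> Lp \<mu> p. gnorm u < \<infinity>}"

lemma R_zero: "R (\<lambda>_ _. 0) = 0"
  using R_cmult[of "\<lambda>_ _. 0" 0] by simp

lemma gspace_measurable: "u \<in> gspace \<Longrightarrow> u \<in> borel_measurable M"
  by (simp add: gspace_def Lp_def L0_def)

lemma gspace_zero: "(\<lambda>_. 0) \<in> gspace" "gnorm (\<lambda>_. 0) = 0"
proof -
  have "(\<lambda>_ _. 0) \<in> fractional_s_gradients \<mu> s (\<lambda>_. 0)"
    unfolding fractional_s_gradients_def by (auto intro!: exI[of _ "{}"] simp: zero_ereal_def)
  then have "grad_norm (\<lambda>_. 0) \<le> 0"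
    using R_zero by (metis INF_lower)
  moreover have eabs0: "eabs (\<lambda>_ :: 'a. 0) = (\<lambda>_. 0)" by (simp add: fun_eq_iff eabs_def zero_ereal_def)
  ultimately show "gnorm (\<lambda>_. 0) = 0" by (simp add: gnorm_def)
  then show "(\<lambda>_. 0) \<in> gspace" by (simp add: gspace_def Lp_def L0_def eabs0)
qed

lemma gspace_scale:
  assumes u: "u \<in> gspace" and c: "0 < c"
  shows "(\<lambda>x. ereal c * u x) \<in> gspace" "gnorm (\<lambda>x. ereal c * u x) \<le> ennreal c * gnorm u"
proof -
  have [measurable]: "u \<in> borel_measurable M" using u by (rule gspace_measurable)
  have Lp: "Lp_norm M p (eabs (\<lambda>x. ereal c * u x)) = ennreal c * Lp_norm M p (eabs u)"
  proof -
    have "eabs (\<lambda>x. ereal c * u x) = (\<lambda>x. ennreal c * eabs u x)"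
      using c by (auto simp: eabs_def fun_eq_iff e2ennreal_cmult_abs[symmetric] ereal_cmult_diff[of c _ 0, simplified])
    then show ?thesis using p_pos by (simp add: Lp_norm_cmult)
  qed
  define I where "I = grad_norm (\<lambda>x. ereal c * u x)"
  have "ennreal (1/c) * I \<le> R g" if g: "g \<in> fractional_s_gradients \<mu> s u" for g
  proof -
    have gm: "g k \<in> borel_measurable M" for k using g by (simp add: fractional_s_gradients_def)
    have "(\<lambda>k x. ennreal c * g k x) \<in> fractional_s_gradients \<mu> s (\<lambda>x. ereal c * u x)"
    proof -
      obtain E where E: "\<mu> E = 0" "\<And>k x y. x \<in> - E \<Longrightarrow> y \<in> - E \<Longrightarrow> 2 powi (- k - 1) \<le> dist x y \<Longrightarrow> dist x y < 2 powi (- k) \<Longrightarrow>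
         e2ennreal \<bar>u x - u y\<bar> \<le> ennreal (dist x y powr s) * (g k x + g k y)"
        using g by (auto simp: fractional_s_gradients_def)
      have "e2ennreal \<bar>ereal c * u x - ereal c * u y\<bar> \<le> ennreal (dist x y powr s) * (ennreal c * g k x + ennreal c * g k y)"
        if "x \<in> - E" "y \<in> - E" "2 powi (- k - 1) \<le> dist x y" "dist x y < 2 powi (- k)" for x y k
        using mult_left_mono[OF E(2)[OF that], of "ennreal c"] c
        by (simp add: ereal_cmult_diff e2ennreal_cmult_abs distrib_left mult_ac)
      then show ?thesis using gm E(1) unfolding fractional_s_gradients_def by (auto intro!: exI[of _ E])
    qed
    then have "I \<le> R (\<lambda>k x. ennreal c * g k x)" unfolding I_def by (rule INF_lower)
    also have "\<dots> = ennreal c * R g" by (rule R_cmult[OF gm])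
    finally have "ennreal (1/c) * I \<le> ennreal (1/c) * (ennreal c * R g)" by (rule mult_left_mono) simp
    also have "\<dots> = R g" using c by (simp add: mult.assoc[symmetric] ennreal_mult'[symmetric])
    finally show ?thesis .
  qed
  then have "ennreal (1/c) * I \<le> grad_norm u" by (rule INF_greatest)
  then have "ennreal c * (ennreal (1/c) * I) \<le> ennreal c * grad_norm u"
    by (rule mult_left_mono) simp
  moreover have "ennreal c * (ennreal (1/c) * I) = I"
    using c by (simp add: mult.assoc[symmetric] ennreal_mult'[symmetric])
  ultimately show N: "gnorm (\<lambda>x. ereal c * u x) \<le> ennreal c * gnorm u"
    unfolding gnorm_def Lp distrib_left by (intro add_left_mono) (simp add: I_def)
  have "ennreal c * gnorm u < \<infinity>" using u by (simp add: gspace_def ennreal_mult_less_top)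
  moreover have "Lp_norm M p (eabs (\<lambda>x. ereal c * u x)) < \<infinity>"
    using u unfolding Lp by (simp add: gspace_def Lp_def ennreal_mult_less_top)
  moreover have "AE x in M. \<bar>ereal c * u x\<bar> \<noteq> \<infinity>"
  proof -
    have "AE x in M. \<bar>u x\<bar> \<noteq> \<infinity>" using u by (simp add: gspace_def Lp_def L0_AE)
    then show ?thesis by eventually_elim auto
  qed
  ultimately show "(\<lambda>x. ereal c * u x) \<in> gspace"
    using N by (auto simp: gspace_def Lp_def L0_AE)
qed

text \<open>
  If \<open>h\<^sub>i\<close> is a fractional gradient of \<open>w\<^sub>i\<close> for each \<open>i\<close>, then \<open>sup\<^sub>i h\<^sub>i\<close> is one of \<open>v\<close>, so the
  inequality for \<open>N\<close> reduces to those for \<open>R\<close> and for the \<open>L\<^sup>p\<close> norm.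
\<close>

lemma gspace_dominated:
  "\<exists>K::real. \<forall>v w. v \<in> borel_measurable M \<longrightarrow> (\<forall>i. w i \<in> gspace) \<longrightarrow>
      sup_dominated \<mu> v w \<longrightarrow> (SUP i. 4 ^ i * gnorm (w i)) < \<infinity> \<longrightarrow>
      v \<in> gspace \<and> gnorm v \<le> ennreal K * (SUP i. 4 ^ i * gnorm (w i))"
proof -
  obtain C1 :: real where C1: "0 < C1" "\<And>(M :: 'a measure) (f :: nat \<Rightarrow> 'a \<Rightarrow> ennreal). \<forall>i. f i \<in> borel_measurable M \<Longrightarrow>
       Lp_norm M p (\<lambda>x. SUP i. f i x) \<le> ennreal C1 * (SUP i. ennreal ((1/(1/4)) ^ i) * Lp_norm M p (f i))"
    by (rule Lp_norm_SUP_le[OF p_pos, of "1/4"]) (simp, simp, rule that)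
  obtain C2 where C2: "0 \<le> C2" "\<forall>g :: nat \<Rightarrow> int \<Rightarrow> 'a \<Rightarrow> ennreal.
        (\<forall>i k. g i k \<in> borel_measurable M) \<longrightarrow>
        R (\<lambda>k x. SUP i. g i k x) \<le> ennreal C2 * (SUP i. 4 ^ i * R (g i))"
    using R_SUP by (elim exE conjE)
  show ?thesis
  proof (rule exI[of _ "C1 + C2"], intro allI impI)
    fix v and w :: "nat \<Rightarrow> 'a \<Rightarrow> ereal"
    assume v: "v \<in> borel_measurable M" and w: "\<forall>i. w i \<in> gspace"
      and dom: "sup_dominated \<mu> v w" and fin: "(SUP i. 4 ^ i * gnorm (w i)) < \<infinity>"
    define S where "S = (SUP i. 4 ^ i * gnorm (w i))"
    have wm [measurable]: "w i \<in> borel_measurable M" for i using w gspace_measurable by blast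
    obtain Z where Z: "\<mu> Z = 0"
      and Z1: "\<And>x. x \<notin> Z \<Longrightarrow> (SUP i. \<bar>w i x\<bar>) \<noteq> \<infinity> \<Longrightarrow> \<bar>v x\<bar> \<le> (SUP i. \<bar>w i x\<bar>)"
      and Z2: "\<And>x y. x \<notin> Z \<Longrightarrow> y \<notin> Z \<Longrightarrow> (SUP i. \<bar>w i x\<bar>) \<noteq> \<infinity> \<Longrightarrow> (SUP i. \<bar>w i y\<bar>) \<noteq> \<infinity> \<Longrightarrow>
        \<bar>v x - v y\<bar> \<le> (SUP i. \<bar>w i x - w i y\<bar>)"
      using dom unfolding sup_dominated_def by blast
    define a where "a x = (SUP i. eabs (w i) x)" for x
    have am [measurable]: "a \<in> borel_measurable M" unfolding a_def[abs_def] by measurable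
    have wa: "(SUP i. \<bar>w i x\<bar>) \<le> enn2ereal (a x)" for x
    proof (rule SUP_least)
      fix i
      have "eabs (w i) x \<le> a x" unfolding a_def by (rule SUP_upper) simp
      then show "\<bar>w i x\<bar> \<le> enn2ereal (a x)" by (simp add: abs_le_enn2ereal_iff eabs_def)
    qed
    have Lp_a: "Lp_norm M p a \<le> ennreal C1 * S"
    proof -
      have "Lp_norm M p a \<le> ennreal C1 * (SUP i. ennreal ((1/(1/4)) ^ i) * Lp_norm M p (eabs (w i)))"
        unfolding a_def[abs_def] by (intro C1(2) allI) measurable
      also have "\<dots> \<le> ennreal C1 * S"
        unfolding S_def gnorm_def
        by (intro mult_left_mono SUP_mono' mult_mono) (auto simp flip: ennreal_power)
      finally show ?thesis .
    qed
    also have "\<dots> < \<infinity>" using fin by (simp add: S_def ennreal_mult_less_top)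
    finally have Lp_a_fin: "Lp_norm M p a < \<infinity>" .
    have ae_a: "AE x in M. a x \<noteq> \<infinity>" by (rule Lp_norm_finite_AE[OF p_pos am Lp_a_fin])
    have ae_w: "AE x in M. x \<notin> Z \<and> (SUP i. \<bar>w i x\<bar>) \<noteq> \<infinity>"
    proof -
      have "AE x in M. x \<notin> Z" using Z by (intro AE_M_I[of Z]) auto
      with ae_a show ?thesis
      proof eventually_elim
        fix x assume "a x \<noteq> \<infinity>" "x \<notin> Z"
        then show "x \<notin> Z \<and> (SUP i. \<bar>w i x\<bar>) \<noteq> \<infinity>" using wa[of x] by (cases "a x") auto
      qed
    qed
    have ae_v: "AE x in M. eabs v x \<le> a x"
      using ae_w
    proof eventually_elim
      fix x assume "x \<notin> Z \<and> (SUP i. \<bar>w i x\<bar>) \<noteq> \<infinity>"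
      then have "\<bar>v x\<bar> \<le> enn2ereal (a x)" using Z1[of x] wa[of x] by (auto intro: order_trans)
      then show "eabs v x \<le> a x" by (simp add: abs_le_enn2ereal_iff eabs_def)
    qed
    have Lp_v: "Lp_norm M p (eabs v) \<le> ennreal C1 * S"
      using Lp_norm_mono_AE[OF p_pos ae_v] Lp_a by (rule order_trans)
    have v_L0: "v \<in> L0 \<mu>"
    proof -
      have "AE x in M. \<bar>v x\<bar> \<noteq> \<infinity>"
        using ae_v ae_a
      proof eventually_elim
        fix x assume "eabs v x \<le> a x" "a x \<noteq> \<infinity>"
        then show "\<bar>v x\<bar> \<noteq> \<infinity>" by (auto simp: eabs_def top_unique)
      qed
      with v show ?thesis by (simp add: L0_AE)
    qed
    have INF_le: "grad_norm v \<le> ennreal C2 * (S + ennreal e)" if e: "0 < e" for e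
    proof -
      have "\<exists>h. h \<in> fractional_s_gradients \<mu> s (w i) \<and> R h \<le> gnorm (w i) + ennreal (e * (1/4) ^ i)" for i
      proof -
        have "grad_norm (w i) < \<infinity>"
          using w by (auto simp: gspace_def gnorm_def less_top[symmetric])
        moreover have "(0::ennreal) < ennreal (e * (1/4) ^ i)" using e by simp
        ultimately have "grad_norm (w i) < grad_norm (w i) + ennreal (e * (1/4) ^ i)"
          by (metis ennreal_add_left_cancel_less add.right_neutral infinity_ennreal_def less_irrefl)
        then obtain h where h: "h \<in> fractional_s_gradients \<mu> s (w i)"
          "R h < grad_norm (w i) + ennreal (e * (1/4) ^ i)"
          unfolding INF_less_iff by blast
        have "grad_norm (w i) \<le> gnorm (w i)" unfolding gnorm_def by simp
        then have "R h \<le> gnorm (w i) + ennreal (e * (1/4) ^ i)" using less_imp_le[OF h(2)] by (meson add_right_mono order_trans)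
        with h(1) show ?thesis by blast
      qed
      then obtain h where h: "\<And>i. h i \<in> fractional_s_gradients \<mu> s (w i)" "\<And>i. R (h i) \<le> gnorm (w i) + ennreal (e * (1/4) ^ i)"
        by metis
      have hm: "h i k \<in> borel_measurable M" for i k using h(1) by (simp add: fractional_s_gradients_def)
      have "\<exists>E. \<mu> E = 0 \<and> (\<forall>k. \<forall>x\<in>- E. \<forall>y\<in>- E. 2 powi (- k - 1) \<le> dist x y \<and> dist x y < 2 powi (- k) \<longrightarrow>
         e2ennreal \<bar>w i x - w i y\<bar> \<le> ennreal (dist x y powr s) * (h i k x + h i k y))" for i
        using h(1)[of i] by (simp add: fractional_s_gradients_def)
      then obtain E where E: "\<And>i. \<mu> (E i) = 0" "\<And>i k x y. x \<notin> E i \<Longrightarrow> y \<notin> E i \<Longrightarrow> 2 powi (- k - 1) \<le> dist x y \<Longrightarrow> dist x y < 2 powi (- k) \<Longrightarrow>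
         e2ennreal \<bar>w i x - w i y\<bar> \<le> ennreal (dist x y powr s) * (h i k x + h i k y)"
        by (metis ComplI)
      define H where "H k x = (SUP i. h i k x)" for k x
      define Y where "Y = {x. \<not> (x \<notin> Z \<and> (SUP i. \<bar>w i x\<bar>) \<noteq> \<infinity>)} \<union> (\<Union>i. E i)"
      have Y: "\<mu> Y = 0" unfolding Y_def by (intro null_Un null_UN E(1) ae_w[unfolded AE_M_iff])
      have "H \<in> fractional_s_gradients \<mu> s v"
        unfolding fractional_s_gradients_def
      proof (intro CollectI conjI allI exI[of _ Y] ballI impI)
        show "H k \<in> borel_measurable M" for k unfolding H_def[abs_def] using hm by measurable
        fix k x y assume x: "x \<in> - Y" and y: "y \<in> - Y" and d: "2 powi (- k - 1) \<le> dist x y \<and> dist x y < 2 powi (- k)"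
        define D where "D = ennreal (dist x y powr s) * (H k x + H k y)"
        have "\<bar>v x - v y\<bar> \<le> (SUP i. \<bar>w i x - w i y\<bar>)"
          using x y by (intro Z2) (auto simp: Y_def)
        also have "\<dots> \<le> enn2ereal D"
        proof (rule SUP_least)
          fix i
          have "e2ennreal \<bar>w i x - w i y\<bar> \<le> ennreal (dist x y powr s) * (h i k x + h i k y)"
            using x y d by (intro E(2)) (auto simp: Y_def)
          also have "\<dots> \<le> D"
            unfolding D_def H_def by (intro mult_left_mono add_mono SUP_upper) auto
          finally show "\<bar>w i x - w i y\<bar> \<le> enn2ereal D" by (simp add: abs_le_enn2ereal_iff)
        qed
        finally show "e2ennreal \<bar>v x - v y\<bar> \<le> ennreal (dist x y powr s) * (H k x + H k y)"
          by (simp add: abs_le_enn2ereal_iff D_def)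
      qed (rule Y)
      then have "grad_norm v \<le> R H" by (rule INF_lower)
      also have "\<dots> \<le> ennreal C2 * (SUP i. 4 ^ i * R (h i))"
        unfolding H_def using hm by (intro C2(2)[rule_format]) auto
      also have "\<dots> \<le> ennreal C2 * (S + ennreal e)"
      proof (intro mult_left_mono SUP_least)
        fix i
        have "4 ^ i * R (h i) \<le> 4 ^ i * (gnorm (w i) + ennreal (e * (1/4) ^ i))" using h(2) by (intro mult_left_mono) auto
        also have "\<dots> = 4 ^ i * gnorm (w i) + ennreal (4 ^ i) * ennreal (e * (1/4) ^ i)"
          by (simp add: distrib_left flip: ennreal_power)
        also have "ennreal (4 ^ i) * ennreal (e * (1/4) ^ i) = ennreal e"
          by (simp add: ennreal_mult'[symmetric] power_divide)
        also have "4 ^ i * gnorm (w i) + ennreal e \<le> S + ennreal e"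
          unfolding S_def by (intro add_right_mono SUP_upper) auto
        finally show "4 ^ i * R (h i) \<le> S + ennreal e" .
      qed auto
      finally show ?thesis .
    qed
    have INF_le': "grad_norm v \<le> ennreal C2 * S"
    proof (rule ennreal_le_epsilon)
      fix e :: real assume e: "0 < e"
      have "grad_norm v \<le> ennreal C2 * (S + ennreal (e / (C2 + 1)))"
        using e C2(1) by (intro INF_le) auto
      also have "\<dots> = ennreal C2 * S + ennreal (C2 * (e / (C2 + 1)))"
        using C2(1) e by (simp add: distrib_left ennreal_mult[symmetric])
      also have "\<dots> \<le> ennreal C2 * S + ennreal e"
        using C2(1) e by (intro add_left_mono ennreal_leI) (simp add: field_simps)
      finally show "grad_norm v \<le> ennreal C2 * S + ennreal e" .
    qed
    have N: "gnorm v \<le> ennreal (C1 + C2) * S"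
      using add_mono[OF Lp_v INF_le'] C1(1) C2(1) by (simp add: gnorm_def ennreal_plus distrib_right)
    moreover have "ennreal (C1 + C2) * S < \<infinity>" using fin by (simp add: S_def ennreal_mult_less_top)
    moreover have "Lp_norm M p (eabs v) < \<infinity>"
      using Lp_norm_mono_AE[OF p_pos ae_v] Lp_a_fin by (rule le_less_trans)
    ultimately show "v \<in> gspace \<and> gnorm v \<le> ennreal (C1 + C2) * (SUP i. 4 ^ i * gnorm (w i))"
      using v_L0 by (auto simp: gspace_def Lp_def S_def)
  qed
qed

lemma capacity_spaceI:
  assumes "\<And>u \<epsilon>. u \<in> gspace \<Longrightarrow> 0 < \<epsilon> \<Longrightarrow> \<exists>f. continuous_on UNIV f \<and>
           (\<lambda>x. u x - ereal (f x)) \<in> gspace \<and> gnorm (\<lambda>x. u x - ereal (f x)) < ennreal \<epsilon>"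
  shows "capacity_space \<mu> gspace gnorm p"
proof unfold_locales
  show "Lp_norm M p (eabs u) \<le> gnorm u" for u by (simp add: gnorm_def)
  show "u \<in> gspace \<Longrightarrow> gnorm u < \<infinity>" for u by (simp add: gspace_def)
qed (fact p_pos gspace_measurable gspace_zero gspace_scale gspace_dominated assms)+

end

section \<open>Triebel--Lizorkin and Besov norms of gradient sequences\<close>

lemma lq_norm_top [simp]: "lq_norm top a = (SUP k. a k)"
  by (simp add: lq_norm_def)

lemma lq_norm_finite: "q < \<infinity> \<Longrightarrow> lq_norm q a = Lp_norm (count_space UNIV) (enn2real q) a"
  by (auto simp: lq_norm_def)

lemma enn2real_pos: "0 < q \<Longrightarrow> q < \<infinity> \<Longrightarrow> 0 < enn2real q"
  by (simp add: enn2real_positive_iff)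

lemma lq_norm_mono: "0 < q \<Longrightarrow> (\<And>k. a k \<le> b k) \<Longrightarrow> lq_norm q a \<le> lq_norm q b"
  by (cases "q = \<infinity>") (auto simp: lq_norm_def enn2real_pos less_top[symmetric] intro!: SUP_mono' Lp_norm_mono)

lemma lq_norm_cmult: "0 < q \<Longrightarrow> lq_norm q (\<lambda>k. c * a k) = c * lq_norm q a"
  by (cases "q = \<infinity>") (auto simp: lq_norm_def SUP_mult_left_ennreal less_top[symmetric] enn2real_pos intro!: Lp_norm_cmult)

lemma lq_norm_SUP_le:
  assumes q: "0 < q"
  obtains C :: real where "0 < C"
    "\<And>(f :: nat \<Rightarrow> int \<Rightarrow> ennreal). lq_norm q (\<lambda>k. SUP i. f i k) \<le> ennreal C * (SUP i. 2 ^ i * lq_norm q (f i))"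
proof (cases "q = \<infinity>")
  case True
  have "lq_norm q (\<lambda>k. SUP i. f i k) \<le> ennreal 1 * (SUP i. 2 ^ i * lq_norm q (f i))" for f :: "nat \<Rightarrow> int \<Rightarrow> ennreal"
  proof -
    have "f i k \<le> (SUP i. 2 ^ i * (SUP k. f i k))" for i k
    proof -
      have "f i k \<le> (SUP k. f i k)" by (rule SUP_upper) simp
      also have "\<dots> = 1 * (SUP k. f i k)" by simp
      also have "\<dots> \<le> 2 ^ i * (SUP k. f i k)" by (intro mult_right_mono one_le_power) auto
      also have "\<dots> \<le> (SUP i. 2 ^ i * (SUP k. f i k))" by (rule SUP_upper) simp
      finally show ?thesis .
    qed
    then show ?thesis using True by (auto simp: lq_norm_def intro!: SUP_least)
  qed
  then show ?thesis by (rule that[rotated]) simp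
next
  case False
  then have q': "0 < enn2real q" using q by (intro enn2real_pos) (auto simp: less_top)
  obtain C :: real where C: "0 < C" "\<And>(M :: int measure) (f :: nat \<Rightarrow> int \<Rightarrow> ennreal). \<forall>i. f i \<in> borel_measurable M \<Longrightarrow>
       Lp_norm M (enn2real q) (\<lambda>x. SUP i. f i x) \<le> ennreal C * (SUP i. ennreal ((1/(1/2)) ^ i) * Lp_norm M (enn2real q) (f i))"
    by (rule Lp_norm_SUP_le[OF q', of "1/2"]) (simp, simp, rule that)
  have "lq_norm q (\<lambda>k. SUP i. f i k) \<le> ennreal C * (SUP i. 2 ^ i * lq_norm q (f i))" for f :: "nat \<Rightarrow> int \<Rightarrow> ennreal"
    using C(2)[of f "count_space UNIV"] False by (simp add: lq_norm_def flip: ennreal_power)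
  then show ?thesis by (rule that[rotated]) (rule C)
qed

lemma measurable_lq_norm:
  fixes g :: "int \<Rightarrow> 'b \<Rightarrow> ennreal"
  assumes [measurable]: "\<And>k. g k \<in> borel_measurable M"
  shows "(\<lambda>x. lq_norm q (\<lambda>k. g k x)) \<in> borel_measurable M"
proof (cases "q = \<infinity>")
  case False
  interpret sigma_finite_measure "count_space (UNIV :: int set)"
    by (rule sigma_finite_measure_count_space)
  have "(\<lambda>(x, k). enn_powr (g k x) (enn2real q)) \<in> borel_measurable (M \<Otimes>\<^sub>M count_space UNIV)"
    using measurable_compose[OF measurable_pair_swap' measurable_pair_measure_countable1[of UNIV "\<lambda>(k, x). enn_powr (g k x) (enn2real q)" M borel]]
    by (simp add: case_prod_beta)
  then have "(\<lambda>x. \<integral>\<^sup>+k. enn_powr (g k x) (enn2real q) \<partial>count_space UNIV) \<in> borel_measurable M"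
    by (rule borel_measurable_nn_integral)
  then show ?thesis using False by (simp add: lq_norm_def Lp_norm_def)
qed (simp add: lq_norm_def)

lemma le_lq_norm: assumes "0 < q" shows "a k \<le> lq_norm q a"
proof (cases "q = \<infinity>")
  case False
  then have q': "0 < enn2real q" using assms by (intro enn2real_pos) (auto simp: less_top)
  have "enn_powr (a k) (enn2real q) = (\<integral>\<^sup>+j. enn_powr (a k) (enn2real q) * indicator {k} j \<partial>count_space UNIV)"
    by (simp add: nn_integral_cmult_indicator)
  also have "\<dots> \<le> (\<integral>\<^sup>+j. enn_powr (a j) (enn2real q) \<partial>count_space UNIV)"
    by (intro nn_integral_mono) (auto split: split_indicator)
  also have "\<dots> = enn_powr (lq_norm q a) (enn2real q)"
    using False q' by (simp add: lq_norm_def enn_powr_Lp_norm)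
  finally show ?thesis using q' by (simp add: enn_powr_le_iff)
qed (auto simp: lq_norm_def intro: SUP_upper)

definition TL_norm :: "'a measure \<Rightarrow> real \<Rightarrow> ennreal \<Rightarrow> (int \<Rightarrow> 'a \<Rightarrow> ennreal) \<Rightarrow> ennreal" where
  "TL_norm M p q g = Lp_norm M p (\<lambda>x. lq_norm q (\<lambda>k. g k x))"

definition Besov_norm :: "'a measure \<Rightarrow> real \<Rightarrow> ennreal \<Rightarrow> (int \<Rightarrow> 'a \<Rightarrow> ennreal) \<Rightarrow> ennreal" where
  "Besov_norm M p q g = lq_norm q (\<lambda>k. Lp_norm M p (g k))"

lemma SUP_nested_power:
  fixes a :: "nat \<Rightarrow> ennreal"
  assumes "0 \<le> C" "0 \<le> D"
  shows "ennreal C * (SUP i. 2 ^ i * (ennreal D * (2 ^ i * a i))) = ennreal (C * D) * (SUP i. 4 ^ i * a i)"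
proof -
  have "2 ^ i * (ennreal D * (2 ^ i * a i)) = ennreal D * (4 ^ i * a i)" for i
  proof -
    have "(4::ennreal) ^ i = 2 ^ i * 2 ^ i" by (simp add: power_mult_distrib[symmetric])
    then show ?thesis by (simp add: mult_ac)
  qed
  then show ?thesis using assms by (simp add: SUP_mult_left_ennreal[symmetric] ennreal_mult mult.assoc)
qed

context mm_space
begin

lemma gradient_space_TL:
  assumes p: "0 < p" and s: "0 < s" and q: "0 < q"
  shows "gradient_space \<mu> p s (TL_norm M p q)"
proof unfold_locales
  fix g h :: "int \<Rightarrow> 'a \<Rightarrow> ennreal" assume "\<And>k x. g k x \<le> h k x"
  then show "TL_norm M p q g \<le> TL_norm M p q h"
    unfolding TL_norm_def by (intro Lp_norm_mono p lq_norm_mono q)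
next
  fix g :: "int \<Rightarrow> 'a \<Rightarrow> ennreal" and c assume "\<And>k. g k \<in> borel_measurable M"
  then show "TL_norm M p q (\<lambda>k x. c * g k x) = c * TL_norm M p q g"
    unfolding TL_norm_def lq_norm_cmult[OF q] by (intro Lp_norm_cmult p measurable_lq_norm)
next
  obtain C where C: "0 < C" "\<And>(f :: nat \<Rightarrow> int \<Rightarrow> ennreal). lq_norm q (\<lambda>k. SUP i. f i k) \<le> ennreal C * (SUP i. 2 ^ i * lq_norm q (f i))"
    by (rule lq_norm_SUP_le[OF q]) (rule that)
  obtain D :: real where D: "0 < D" "\<And>(M :: 'a measure) (f :: nat \<Rightarrow> 'a \<Rightarrow> ennreal). \<forall>i. f i \<in> borel_measurable M \<Longrightarrow>
       Lp_norm M p (\<lambda>x. SUP i. f i x) \<le> ennreal D * (SUP i. ennreal ((1/(1/2)) ^ i) * Lp_norm M p (f i))"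
    by (rule Lp_norm_SUP_le[OF p, of "1/2"]) (simp, simp, rule that)
  have "TL_norm M p q (\<lambda>k x. SUP i. g i k x) \<le> ennreal (C * D) * (SUP i. 4 ^ i * TL_norm M p q (g i))"
    if g: "\<forall>i k. g i k \<in> borel_measurable M" for g :: "nat \<Rightarrow> int \<Rightarrow> 'a \<Rightarrow> ennreal"
  proof -
    define b where "b i x = lq_norm q (\<lambda>k. g i k x)" for i x
    have bm [measurable]: "b i \<in> borel_measurable M" for i unfolding b_def[abs_def] using g by (intro measurable_lq_norm) auto
    have "TL_norm M p q (\<lambda>k x. SUP i. g i k x) \<le> Lp_norm M p (\<lambda>x. ennreal C * (SUP i. 2 ^ i * b i x))"
      unfolding TL_norm_def b_def by (intro Lp_norm_mono p C)
    also have "\<dots> = ennreal C * Lp_norm M p (\<lambda>x. SUP i. 2 ^ i * b i x)"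
      by (rule Lp_norm_cmult[OF p]) measurable
    also have "\<dots> \<le> ennreal C * (ennreal D * (SUP i. ennreal ((1/(1/2)) ^ i) * Lp_norm M p (\<lambda>x. 2 ^ i * b i x)))"
      by (intro mult_left_mono D(2) allI) auto
    also have "\<dots> = ennreal C * (ennreal D * (SUP i. 2 ^ i * (2 ^ i * Lp_norm M p (b i))))"
      by (simp add: Lp_norm_cmult[OF p] flip: ennreal_power)
    also have "\<dots> = ennreal C * (SUP i. 2 ^ i * (ennreal D * (2 ^ i * Lp_norm M p (b i))))"
      by (simp add: SUP_mult_left_ennreal mult_ac)
    also have "\<dots> = ennreal (C * D) * (SUP i. 4 ^ i * TL_norm M p q (g i))"
      using C(1) D(1) by (subst SUP_nested_power) (auto simp: TL_norm_def b_def[abs_def])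
    finally show ?thesis .
  qed
  then show "\<exists>C\<ge>0. \<forall>g :: nat \<Rightarrow> int \<Rightarrow> 'a \<Rightarrow> ennreal. (\<forall>i k. g i k \<in> borel_measurable M) \<longrightarrow>
        TL_norm M p q (\<lambda>k x. SUP i. g i k x) \<le> ennreal C * (SUP i. 4 ^ i * TL_norm M p q (g i))"
    using C(1) D(1) by (intro exI[of _ "C * D"]) auto
qed (use p s in auto)

lemma gradient_space_Besov:
  assumes p: "0 < p" and s: "0 < s" and q: "0 < q"
  shows "gradient_space \<mu> p s (Besov_norm M p q)"
proof unfold_locales
  fix g h :: "int \<Rightarrow> 'a \<Rightarrow> ennreal" assume "\<And>k x. g k x \<le> h k x"
  then show "Besov_norm M p q g \<le> Besov_norm M p q h"
    unfolding Besov_norm_def by (intro Lp_norm_mono p lq_norm_mono q)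
next
  fix g :: "int \<Rightarrow> 'a \<Rightarrow> ennreal" and c assume "\<And>k. g k \<in> borel_measurable M"
  then show "Besov_norm M p q (\<lambda>k x. c * g k x) = c * Besov_norm M p q g"
    unfolding Besov_norm_def by (simp add: Lp_norm_cmult[OF p] lq_norm_cmult[OF q])
next
  obtain C where C: "0 < C" "\<And>(f :: nat \<Rightarrow> int \<Rightarrow> ennreal). lq_norm q (\<lambda>k. SUP i. f i k) \<le> ennreal C * (SUP i. 2 ^ i * lq_norm q (f i))"
    by (rule lq_norm_SUP_le[OF q]) (rule that)
  obtain D :: real where D: "0 < D" "\<And>(M :: 'a measure) (f :: nat \<Rightarrow> 'a \<Rightarrow> ennreal). \<forall>i. f i \<in> borel_measurable M \<Longrightarrow>
       Lp_norm M p (\<lambda>x. SUP i. f i x) \<le> ennreal D * (SUP i. ennreal ((1/(1/2)) ^ i) * Lp_norm M p (f i))"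
    by (rule Lp_norm_SUP_le[OF p, of "1/2"]) (simp, simp, rule that)
  have "Besov_norm M p q (\<lambda>k x. SUP i. g i k x) \<le> ennreal (C * D) * (SUP i. 4 ^ i * Besov_norm M p q (g i))"
    if g: "\<forall>i k. g i k \<in> borel_measurable M" for g :: "nat \<Rightarrow> int \<Rightarrow> 'a \<Rightarrow> ennreal"
  proof -
    define b where "b i k = Lp_norm M p (g i k)" for i k
    have "Besov_norm M p q (\<lambda>k x. SUP i. g i k x) \<le> lq_norm q (\<lambda>k. ennreal D * (SUP i. 2 ^ i * b i k))"
      unfolding Besov_norm_def b_def using D(2)[of "\<lambda>i. g i k" M for k] g
      by (intro lq_norm_mono q) (simp flip: ennreal_power)
    also have "\<dots> = ennreal D * lq_norm q (\<lambda>k. SUP i. 2 ^ i * b i k)"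
      by (rule lq_norm_cmult[OF q])
    also have "\<dots> \<le> ennreal D * (ennreal C * (SUP i. 2 ^ i * lq_norm q (\<lambda>k. 2 ^ i * b i k)))"
      by (intro mult_left_mono C) auto
    also have "\<dots> = ennreal D * (ennreal C * (SUP i. 2 ^ i * (2 ^ i * lq_norm q (b i))))"
      by (simp add: lq_norm_cmult[OF q])
    also have "\<dots> = ennreal C * (SUP i. 2 ^ i * (ennreal D * (2 ^ i * lq_norm q (b i))))"
      by (simp add: SUP_mult_left_ennreal mult_ac)
    also have "\<dots> = ennreal (C * D) * (SUP i. 4 ^ i * Besov_norm M p q (g i))"
      using C(1) D(1) by (subst SUP_nested_power) (auto simp: Besov_norm_def b_def[abs_def])
    finally show ?thesis .
  qed
  then show "\<exists>C\<ge>0. \<forall>g :: nat \<Rightarrow> int \<Rightarrow> 'a \<Rightarrow> ennreal. (\<forall>i k. g i k \<in> borel_measurable M) \<longrightarrow>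
        Besov_norm M p q (\<lambda>k x. SUP i. g i k x) \<le> ennreal C * (SUP i. 4 ^ i * Besov_norm M p q (g i))"
    using C(1) D(1) by (intro exI[of _ "C * D"]) auto
qed (use p s in auto)

end

section \<open>Density of continuous functions by Hoelder truncation\<close>

lemma powr_add_le:
  fixes a b :: real
  assumes "0 \<le> a" "0 \<le> b" "0 < s" "s \<le> 1"
  shows "(a + b) powr s \<le> a powr s + b powr s"
proof (cases "a + b = 0")
  case False
  define c where "c = a + b"
  have c: "0 < c" using False assms by (simp add: c_def)
  have *: "t / c \<le> (t / c) powr s" if "0 \<le> t" "t \<le> c" for t
  proof (cases "t = 0")
    case False
    then have "(t / c) powr 1 \<le> (t / c) powr s" using that c assms by (intro powr_mono') auto
    then show ?thesis using that c by simp
  qed auto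
  have "1 = a / c + b / c" using c by (simp add: c_def add_divide_distrib[symmetric])
  also have "\<dots> \<le> (a / c) powr s + (b / c) powr s" using assms by (intro add_mono *) (auto simp: c_def)
  also have "\<dots> = (a powr s + b powr s) / c powr s"
    using assms c by (simp add: powr_divide add_divide_distrib)
  finally show ?thesis using c by (simp add: field_simps c_def)
qed (use assms in auto)

lemma dist_powr_triangle:
  assumes "0 < s" "s \<le> 1"
  shows "dist x z powr s \<le> dist x y powr s + dist y z powr s"
proof -
  have "dist x z powr s \<le> (dist x y + dist y z) powr s"
    using assms by (intro powr_mono2 dist_triangle) auto
  also have "\<dots> \<le> dist x y powr s + dist y z powr s" using assms by (intro powr_add_le) auto
  finally show ?thesis .
qed

lemma abs_clamp_diff_le: "\<bar>max (-L) (min L a) - max (-L) (min L b)\<bar> \<le> \<bar>a - b\<bar>" for a b L :: real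
  by (smt (verit))

text \<open>
  The McShane extension \<open>y \<mapsto> inf\<^sub>x (w(x) + c d(x,y)\<^sup>s)\<close>, truncated to \<open>[-L, L]\<close>. It applies because
  \<open>d\<^sup>s\<close> is again a metric for \<open>s \<le> 1\<close>.
\<close>

lemma Hoelder_extension:
  fixes w :: "'a::metric_space \<Rightarrow> real"
  assumes ne: "E \<noteq> {}" and s: "0 < s" "s \<le> 1" and c: "0 \<le> c"
    and bd: "\<And>x. x \<in> E \<Longrightarrow> \<bar>w x\<bar> \<le> L"
    and H: "\<And>x y. x \<in> E \<Longrightarrow> y \<in> E \<Longrightarrow> \<bar>w x - w y\<bar> \<le> c * dist x y powr s"
  obtains f where "\<And>x. x \<in> E \<Longrightarrow> f x = w x" "\<And>x. \<bar>f x\<bar> \<le> L" "\<And>x y. \<bar>f x - f y\<bar> \<le> c * dist x y powr s"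
proof -
  define f0 where "f0 y = (INF x\<in>E. w x + c * dist x y powr s)" for y
  have bdd: "bdd_below ((\<lambda>x. w x + c * dist x y powr s) ` E)" for y
  proof (rule bdd_belowI2)
    fix x assume "x \<in> E"
    then have "- L \<le> w x" using bd[of x] by linarith
    moreover have "0 \<le> c * dist x y powr s" using c by simp
    ultimately show "- L \<le> w x + c * dist x y powr s" by linarith
  qed
  have le: "f0 y \<le> f0 z + c * dist z y powr s" for y z
  proof -
    have "f0 y - c * dist z y powr s \<le> w x + c * dist x z powr s" if "x \<in> E" for x
    proof -
      have "f0 y \<le> w x + c * dist x y powr s" unfolding f0_def by (rule cINF_lower[OF bdd that])
      also have "c * dist x y powr s \<le> c * (dist x z powr s + dist z y powr s)"
        using c s by (intro mult_left_mono dist_powr_triangle)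
      finally show ?thesis by (simp add: algebra_simps)
    qed
    then have "f0 y - c * dist z y powr s \<le> f0 z" unfolding f0_def[of z] by (rule cINF_greatest[OF ne])
    then show ?thesis by simp
  qed
  have H0: "\<bar>f0 y - f0 z\<bar> \<le> c * dist y z powr s" for y z
    using le[of y z] le[of z y] by (simp add: dist_commute abs_le_iff)
  have eq: "f0 y = w y" if "y \<in> E" for y
  proof (rule antisym)
    show "f0 y \<le> w y" unfolding f0_def using cINF_lower[OF bdd that, of y] by simp
    show "w y \<le> f0 y" unfolding f0_def
    proof (rule cINF_greatest[OF ne])
      fix x assume "x \<in> E"
      then show "w y \<le> w x + c * dist x y powr s" using H[of x y] that by linarith
    qed
  qed
  have L: "0 \<le> L" using ne bd by (meson abs_ge_zero ex_in_conv order_trans)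
  show ?thesis
  proof (rule that[of "\<lambda>x. max (-L) (min L (f0 x))"])
    show "max (- L) (min L (f0 x)) = w x" if "x \<in> E" for x
      using bd[OF that] eq[OF that] by (simp add: abs_le_iff max_def min_def)
    show "\<bar>max (- L) (min L (f0 x))\<bar> \<le> L" for x using L by (simp add: abs_le_iff)
    show "\<bar>max (- L) (min L (f0 x)) - max (- L) (min L (f0 y))\<bar> \<le> c * dist x y powr s" for x y
      using abs_clamp_diff_le H0[of x y] by (rule order_trans)
  qed
qed

lemma continuous_on_Hoelder:
  fixes f :: "'a::metric_space \<Rightarrow> real"
  assumes "\<And>x y :: 'a. \<bar>f x - f y\<bar> \<le> c * dist x y powr s" "0 < s"
  shows "continuous_on UNIV f"
  unfolding continuous_on_def
proof
  fix x :: 'a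
  have "((\<lambda>y. c * dist y x powr s) \<longlongrightarrow> c * dist x x powr s) (at x)"
    using assms(2) by (intro tendsto_mult_left tendsto_powr' tendsto_intros) (auto intro: always_eventually)
  then have "((\<lambda>y. c * dist y x powr s) \<longlongrightarrow> 0) (at x)" by simp
  then have "((\<lambda>y. f y - f x) \<longlongrightarrow> 0) (at x)"
    by (rule Lim_null_comparison[rotated]) (use assms(1) in \<open>auto intro: always_eventually\<close>)
  then show "(f \<longlongrightarrow> f x) (at x)" by (simp add: LIM_zero_iff)
qed

text \<open>
  The half-open shells that fractional gradients distinguish cover all positive distances.
\<close>

lemma ex_dyadic_scale:
  fixes d :: real assumes "0 < d"
  shows "\<exists>k::int. 2 powi (- k - 1) \<le> d \<and> d < 2 powi (- k)"
proof -
  define m where "m = \<lfloor>log 2 d\<rfloor>"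
  have "2 powr m \<le> d \<and> d < 2 powr (m + 1)"
    using floor_log_eq_powr_iff[OF assms, of 2 m] by (simp add: m_def)
  then have "2 powi m \<le> d \<and> d < 2 powi (m + 1)"
    using powr_real_of_int'[of 2 m] powr_real_of_int'[of 2 "m + 1"] by simp
  then show ?thesis by (intro exI[of _ "- m - 1"]) (simp add: add.commute)
qed

context mm_space
begin

lemma L0_diff_continuous:
  assumes "u \<in> L0 \<mu>" "continuous_on UNIV f" shows "(\<lambda>x. u x - ereal (f x)) \<in> L0 \<mu>"
proof -
  have [measurable]: "f \<in> borel_measurable M" using assms(2) by (rule continuous_measurable_M)
  have [measurable]: "u \<in> borel_measurable M" using assms(1) by (simp add: L0_def)
  have "(\<lambda>x. u x - ereal (f x)) \<in> borel_measurable M" by measurable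
  moreover have "AE x in M. \<bar>u x\<bar> \<noteq> \<infinity>" using assms(1) by (simp add: L0_AE)
  then have "AE x in M. \<bar>u x - ereal (f x)\<bar> \<noteq> \<infinity>" by eventually_elim auto
  ultimately show ?thesis by (simp add: L0_AE)
qed

text \<open>
  A single gradient serves for all scales, and conversely the supremum over all scales of a
  fractional gradient is a gradient. Finiteness almost everywhere is what handles the diagonal \<open>x = y\<close>,
  which no scale covers.
\<close>

lemma TL_top_norm_eq_hajlasz_norm:
  assumes u: "u \<in> L0 \<mu>"
  shows "hajlasz_triebel_lizorkin_norm \<mu> s p \<infinity> u = hajlasz_norm \<mu> s p u"
proof -
  have "(INF g \<in> fractional_s_gradients \<mu> s u. Lp_norm M p (\<lambda>x. SUP k. g k x)) = (INF g \<in> s_gradients \<mu> s u. Lp_norm M p g)"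
  proof (rule antisym)
    show "(INF g \<in> fractional_s_gradients \<mu> s u. Lp_norm M p (\<lambda>x. SUP k. g k x)) \<le> (INF g \<in> s_gradients \<mu> s u. Lp_norm M p g)"
    proof (rule INF_greatest)
      fix g assume "g \<in> s_gradients \<mu> s u"
      then have "(\<lambda>_. g) \<in> fractional_s_gradients \<mu> s u"
        by (auto simp: s_gradients_def fractional_s_gradients_def)
      then have "(INF g \<in> fractional_s_gradients \<mu> s u. Lp_norm M p (\<lambda>x. SUP k. g k x)) \<le> Lp_norm M p (\<lambda>x. SUP k::int. g x)"
        by (rule INF_lower)
      then show "(INF g \<in> fractional_s_gradients \<mu> s u. Lp_norm M p (\<lambda>x. SUP k. g k x)) \<le> Lp_norm M p g" by simp
    qed
    show "(INF g \<in> s_gradients \<mu> s u. Lp_norm M p g) \<le> (INF g \<in> fractional_s_gradients \<mu> s u. Lp_norm M p (\<lambda>x. SUP k. g k x))"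
    proof (rule INF_greatest)
      fix g assume g: "g \<in> fractional_s_gradients \<mu> s u"
      have gm: "g k \<in> borel_measurable M" for k using g by (simp add: fractional_s_gradients_def)
      obtain E where E: "\<mu> E = 0" "\<forall>k. \<forall>x \<in> - E. \<forall>y \<in> - E.
         2 powi (- k - 1) \<le> dist x y \<and> dist x y < 2 powi (- k) \<longrightarrow>
         e2ennreal \<bar>u x - u y\<bar> \<le> ennreal (dist x y powr s) * (g k x + g k y)"
        using g unfolding fractional_s_gradients_def by blast
      define Z where "Z = E \<union> {x. \<bar>u x\<bar> = \<infinity>}"
      have Z: "\<mu> Z = 0" unfolding Z_def using E(1) u by (intro null_Un) (auto simp: L0_def)
      have "(\<lambda>x. SUP k. g k x) \<in> s_gradients \<mu> s u"
        unfolding s_gradients_def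
      proof (intro CollectI conjI exI[of _ Z] ballI Z)
        show "(\<lambda>x. SUP k. g k x) \<in> borel_measurable M" using gm by measurable
        fix x y assume xy: "x \<in> - Z" "y \<in> - Z"
        show "e2ennreal \<bar>u x - u y\<bar> \<le> ennreal (dist x y powr s) * ((SUP k. g k x) + (SUP k. g k y))"
        proof (cases "x = y")
          case True
          then have "\<bar>u x - u y\<bar> = ereal 0" using xy by (cases "u x") (auto simp: Z_def)
          then show ?thesis by simp
        next
          case False
          then obtain k where k: "2 powi (- k - 1) \<le> dist x y \<and> dist x y < 2 powi (- k)"
            using ex_dyadic_scale[of "dist x y"] by auto
          have "e2ennreal \<bar>u x - u y\<bar> \<le> ennreal (dist x y powr s) * (g k x + g k y)"
            using E(2) xy k by (auto simp: Z_def)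
          also have "\<dots> \<le> ennreal (dist x y powr s) * ((SUP k. g k x) + (SUP k. g k y))"
            by (intro mult_left_mono add_mono SUP_upper) auto
          finally show ?thesis .
        qed
      qed
      then show "(INF g \<in> s_gradients \<mu> s u. Lp_norm M p g) \<le> Lp_norm M p (\<lambda>x. SUP k. g k x)" by (rule INF_lower)
    qed
  qed
  then show ?thesis by (simp add: hajlasz_triebel_lizorkin_norm_def hajlasz_norm_def)
qed

text \<open>
  Let \<open>h\<close> be the maximum of \<open>|u|\<close> and a gradient \<open>g\<close>. On \<open>{h \<le> n}\<close> the function \<open>u\<close> is Hoelder with
  constant \<open>2n\<close> and bounded by \<open>n\<close>; let \<open>f\<close> be an extension with the same bounds. Then \<open>u - f\<close> vanishes
  on \<open>{h \<le> n}\<close>, and off this set all terms are at most a multiple of \<open>h\<close>. So the norm of \<open>u - f\<close> is at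
  most \<open>6 \<parallel>h 1\<^bsub>{h > n}\<^esub>\<parallel>\<^sub>p\<close>, which tends to zero.
\<close>

lemma hajlasz_continuous_dense:
  assumes p: "0 < p" and s: "0 < s" "s \<le> 1" and u: "u \<in> hajlasz_space \<mu> s p" and \<epsilon>: "0 < \<epsilon>"
  shows "\<exists>f. continuous_on UNIV f \<and> (\<lambda>x. u x - ereal (f x)) \<in> hajlasz_space \<mu> s p \<and>
     hajlasz_norm \<mu> s p (\<lambda>x. u x - ereal (f x)) < ennreal \<epsilon>"
proof -
  have uL0: "u \<in> L0 \<mu>" and um [measurable]: "u \<in> borel_measurable M" and Lpu: "Lp_norm M p (eabs u) < \<infinity>"
    using u by (auto simp: hajlasz_space_def Lp_def L0_def)
  have "(INF g \<in> s_gradients \<mu> s u. Lp_norm M p g) < \<infinity>"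
    using u by (auto simp: hajlasz_space_def hajlasz_norm_def less_top[symmetric])
  then obtain g where g: "g \<in> s_gradients \<mu> s u" and Lpg: "Lp_norm M p g < \<infinity>"
    unfolding INF_less_iff by blast
  have gm [measurable]: "g \<in> borel_measurable M" using g by (simp add: s_gradients_def)
  obtain E where E: "\<mu> E = 0" "\<forall>x \<in> - E. \<forall>y \<in> - E. e2ennreal \<bar>u x - u y\<bar> \<le> ennreal (dist x y powr s) * (g x + g y)"
    using g unfolding s_gradients_def by blast
  define Z where "Z = E \<union> {x. \<bar>u x\<bar> = \<infinity>}"
  have Z: "\<mu> Z = 0" unfolding Z_def using E(1) uL0 by (intro null_Un) (auto simp: L0_def)
  define h where "h x = max (eabs u x) (g x)" for x
  have hm [measurable]: "h \<in> borel_measurable M" unfolding h_def[abs_def] by measurable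
  have Lph: "Lp_norm M p h < \<infinity>"
  proof -
    have "enn_powr (Lp_norm M p h) p = (\<integral>\<^sup>+x. enn_powr (h x) p \<partial>M)" using p by (rule enn_powr_Lp_norm)
    also have "\<dots> \<le> (\<integral>\<^sup>+x. enn_powr (eabs u x) p + enn_powr (g x) p \<partial>M)"
      by (intro nn_integral_mono) (auto simp: h_def max_def)
    also have "\<dots> = enn_powr (Lp_norm M p (eabs u)) p + enn_powr (Lp_norm M p g) p"
      using p by (simp add: enn_powr_Lp_norm nn_integral_add)
    also have "\<dots> < \<infinity>" using Lpu Lpg by (auto simp: less_top[symmetric])
    finally show ?thesis by (simp add: less_top[symmetric])
  qed
  define D where "D n = {x. ennreal (real n) < h x}" for n :: nat
  have Dm [measurable]: "D n \<in> sets M" for n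
  proof -
    have "{x \<in> space M. ennreal (real n) < h x} \<in> sets M" by measurable
    then show ?thesis by (simp add: D_def)
  qed
  have lim: "(\<lambda>n. Lp_norm M p (\<lambda>x. h x * indicator (D n) x)) \<longlonglongrightarrow> 0"
  proof (rule Lp_norm_tendsto_0_dominated[OF p _ hm Lph])
    show "AE x in M. h x * indicator (D n) x \<le> h x" for n by (auto split: split_indicator)
    have "AE x in M. h x \<noteq> \<infinity>" by (rule Lp_norm_finite_AE[OF p hm Lph])
    then show "AE x in M. (\<lambda>n. h x * indicator (D n) x) \<longlonglongrightarrow> 0"
    proof eventually_elim
      fix x assume "h x \<noteq> \<infinity>"
      then obtain r where r: "h x = ennreal r" "0 \<le> r" by (cases "h x") auto
      obtain m :: nat where m: "r \<le> real m" using real_arch_simple by blast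
      have "h x * indicator (D n) x = 0" if "m \<le> n" for n
        using r m that by (auto simp: D_def ennreal_less_iff split: split_indicator)
      then show "(\<lambda>n. h x * indicator (D n) x) \<longlonglongrightarrow> 0"
        by (intro tendsto_eventually) (auto simp: eventually_sequentially)
    qed
  qed measurable
  have "(\<lambda>n. 6 * Lp_norm M p (\<lambda>x. h x * indicator (D n) x)) \<longlonglongrightarrow> 6 * 0"
    by (intro ennreal_tendsto_cmult lim) auto
  then have small: "\<forall>\<^sub>F n in sequentially. 6 * Lp_norm M p (\<lambda>x. h x * indicator (D n) x) < ennreal \<epsilon>"
    using \<epsilon> by (simp add: order_tendsto_iff)
  \<comment> \<open>Balls have positive measure, so the set on which the extension is based is eventually nonempty.\<close>
  have "\<exists>x0. x0 \<notin> Z \<and> h x0 \<noteq> \<infinity>"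
  proof (rule ccontr)
    assume no: "\<nexists>x0. x0 \<notin> Z \<and> h x0 \<noteq> \<infinity>"
    have "AE x in M. h x \<noteq> \<infinity>" by (rule Lp_norm_finite_AE[OF p hm Lph])
    then have "\<mu> (Z \<union> {x. \<not> h x \<noteq> \<infinity>}) = 0" unfolding AE_M_iff by (intro null_Un Z)
    then have "\<mu> (ball undefined 1) = 0" by (rule null_subset) (use no in blast)
    then show False using mu_ball(1)[of 1 undefined] by simp
  qed
  then obtain x0 where x0: "x0 \<notin> Z" "h x0 \<noteq> \<infinity>" by blast
  then obtain r where r: "h x0 = ennreal r" "0 \<le> r" by (cases "h x0") auto
  obtain n0 :: nat where "r \<le> real n0" using real_arch_simple by blast
  then have n0: "h x0 \<le> ennreal (real n0)" using r by (simp add: ennreal_leI)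
  obtain n where n: "n0 \<le> n" "6 * Lp_norm M p (\<lambda>x. h x * indicator (D n) x) < ennreal \<epsilon>"
    using small unfolding eventually_sequentially by (meson linear order_refl)
  define A where "A = - (Z \<union> D n)"
  have "ennreal (real n0) \<le> ennreal (real n)" using n(1) by (intro ennreal_leI) simp
  then have "x0 \<in> A" using x0(1) order_trans[OF n0] by (auto simp: A_def D_def not_less)
  then have A0: "A \<noteq> {}" by blast
  define w where "w x = real_of_ereal (u x)" for x
  have uw: "u x = ereal (w x)" if "x \<notin> Z" for x
    using that by (simp add: w_def Z_def ereal_real)
  have uwd: "ennreal \<bar>w x - w y\<bar> \<le> ennreal (dist x y powr s) * (g x + g y)" if "x \<notin> Z" "y \<notin> Z" for x y
  proof -
    have "e2ennreal \<bar>u x - u y\<bar> \<le> ennreal (dist x y powr s) * (g x + g y)"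
      using E(2) that by (auto simp: Z_def)
    then show ?thesis using uw that by simp
  qed
  have habs: "ennreal \<bar>w x\<bar> \<le> h x" if "x \<notin> Z" for x
    using uw[OF that] by (simp add: h_def eabs_def)
  have Abd: "\<bar>w x\<bar> \<le> real n" "g x \<le> ennreal (real n)" if "x \<in> A" for x
  proof -
    have "h x \<le> ennreal (real n)" "x \<notin> Z" using that by (auto simp: A_def D_def not_less)
    then show "\<bar>w x\<bar> \<le> real n" "g x \<le> ennreal (real n)"
      using habs[of x] by (auto simp: h_def dest: order_trans)
  qed
  obtain f where f: "\<And>x. x \<in> A \<Longrightarrow> f x = w x" "\<And>x. \<bar>f x\<bar> \<le> real n"
    "\<And>x y. \<bar>f x - f y\<bar> \<le> (2 * real n) * dist x y powr s"
  proof (rule Hoelder_extension[OF A0 s, of "2 * real n" w "real n"])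
    fix x y assume xy: "x \<in> A" "y \<in> A"
    have "ennreal \<bar>w x - w y\<bar> \<le> ennreal (dist x y powr s) * (g x + g y)"
      using xy by (intro uwd) (auto simp: A_def)
    also have "\<dots> \<le> ennreal (dist x y powr s) * (ennreal (real n) + ennreal (real n))"
      using xy by (intro mult_left_mono add_mono Abd) auto
    also have "\<dots> = ennreal ((2 * real n) * dist x y powr s)"
      by (simp add: ennreal_mult[symmetric] mult_ac flip: ennreal_plus)
    finally show "\<bar>w x - w y\<bar> \<le> (2 * real n) * dist x y powr s" by (subst (asm) ennreal_le_iff) auto
  qed (use Abd in auto)
  have cont: "continuous_on UNIV f" using f(3) s(1) by (rule continuous_on_Hoelder)
  define v where "v x = u x - ereal (f x)" for x
  have vL0: "v \<in> L0 \<mu>" unfolding v_def[abs_def] by (rule L0_diff_continuous[OF uL0 cont])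
  have v: "v x = ereal (w x - f x)" if "x \<notin> Z" for x using uw[OF that] by (simp add: v_def)
  have hD: "ennreal (real n) \<le> h x" if "x \<in> D n" for x using that by (simp add: D_def)
  have Lpv: "Lp_norm M p (eabs v) \<le> 2 * Lp_norm M p (\<lambda>x. h x * indicator (D n) x)"
  proof -
    have "AE x in M. eabs v x \<le> 2 * (h x * indicator (D n) x)"
    proof (rule AE_M_I[OF Z])
      fix x assume x: "x \<notin> Z"
      show "eabs v x \<le> 2 * (h x * indicator (D n) x)"
      proof (cases "x \<in> D n")
        case True
        have "eabs v x = ennreal \<bar>w x - f x\<bar>" using v[OF x] by (simp add: eabs_def)
        also have "\<dots> \<le> ennreal (\<bar>w x\<bar> + real n)"
          using f(2)[of x] by (intro ennreal_leI) linarith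
        also have "\<dots> = ennreal \<bar>w x\<bar> + ennreal (real n)" by simp
        also have "\<dots> \<le> h x + h x" using habs[OF x] hD[OF True] by (rule add_mono)
        finally show ?thesis using True by (simp add: mult_2)
      next
        case False
        then have "f x = w x" using x by (intro f) (auto simp: A_def)
        then show ?thesis using v[OF x] by (simp add: eabs_def)
      qed
    qed
    then have "Lp_norm M p (eabs v) \<le> Lp_norm M p (\<lambda>x. 2 * (h x * indicator (D n) x))" by (rule Lp_norm_mono_AE[OF p])
    also have "\<dots> = 2 * Lp_norm M p (\<lambda>x. h x * indicator (D n) x)" by (rule Lp_norm_cmult[OF p]) measurable
    finally show ?thesis .
  qed
  define G where "G x = 4 * (h x * indicator (D n) x)" for x
  have "G \<in> s_gradients \<mu> s v"
    unfolding s_gradients_def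
  proof (intro CollectI conjI exI[of _ Z] ballI Z)
    show "G \<in> borel_measurable M" unfolding G_def[abs_def] by measurable
    fix x y assume "x \<in> - Z" "y \<in> - Z"
    then have xy: "x \<notin> Z" "y \<notin> Z" by auto
    show "e2ennreal \<bar>v x - v y\<bar> \<le> ennreal (dist x y powr s) * (G x + G y)"
    proof (cases "x \<in> D n \<or> y \<in> D n")
      case False
      then have "f x = w x" "f y = w y" using xy by (auto intro!: f simp: A_def)
      then show ?thesis using v xy by (simp add: e2ennreal_neg)
    next
      case True
      have gh: "g z \<le> h z" for z by (simp add: h_def)
      have gn: "g z \<le> ennreal (real n)" if "z \<notin> D n" for z using that gh[of z] by (auto simp: D_def not_less)
      have sum: "g x + g y + (ennreal (real n) + ennreal (real n)) \<le> G x + G y"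
      proof -
        have 4: "4 * t = t + t + (t + t)" for t :: ennreal
          by (metis (no_types, lifting) mult_2 numeral_Bit0 distrib_right)
        consider "x \<in> D n" "y \<in> D n" | "x \<in> D n" "y \<notin> D n" | "x \<notin> D n" "y \<in> D n" using True by blast
        then show ?thesis
        proof cases
          case 1
          have "g x + g y + (ennreal (real n) + ennreal (real n)) \<le> (h x + h y) + (h x + h y)"
            using 1 by (intro add_mono gh hD)
          also have "\<dots> = 2 * h x + 2 * h y" unfolding mult_2 by (simp only: ac_simps)
          also have "\<dots> \<le> 4 * h x + 4 * h y" by (intro add_mono mult_right_mono) auto
          also have "\<dots> = G x + G y" using 1 by (simp add: G_def)
          finally show ?thesis .
        next
          case 2
          have "g x + g y + (ennreal (real n) + ennreal (real n)) \<le> (h x + h x) + (h x + h x)"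
            using 2 by (intro add_mono gh hD order_trans[OF gn]) auto
          then show ?thesis using 2 by (simp add: G_def 4)
        next
          case 3
          have "g x + g y + (ennreal (real n) + ennreal (real n)) \<le> (h y + h y) + (h y + h y)"
            using 3 by (intro add_mono gh hD order_trans[OF gn]) auto
          then show ?thesis using 3 by (simp add: G_def 4)
        qed
      qed
      have "e2ennreal \<bar>v x - v y\<bar> = ennreal \<bar>w x - f x - (w y - f y)\<bar>" using v xy by simp
      also have "\<dots> \<le> ennreal (\<bar>w x - w y\<bar> + \<bar>f x - f y\<bar>)"
        by (intro ennreal_leI) linarith
      also have "\<dots> = ennreal \<bar>w x - w y\<bar> + ennreal \<bar>f x - f y\<bar>" by simp
      also have "\<dots> \<le> ennreal (dist x y powr s) * (g x + g y) + ennreal ((2 * real n) * dist x y powr s)"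
        by (intro add_mono uwd xy ennreal_leI f)
      also have "ennreal ((2 * real n) * dist x y powr s) = ennreal (dist x y powr s) * (ennreal (real n) + ennreal (real n))"
        by (simp add: ennreal_mult[symmetric] mult_ac flip: ennreal_plus)
      also have "ennreal (dist x y powr s) * (g x + g y) + \<dots> = ennreal (dist x y powr s) * (g x + g y + (ennreal (real n) + ennreal (real n)))"
        by (simp only: distrib_left)
      also have "\<dots> \<le> ennreal (dist x y powr s) * (G x + G y)" by (intro mult_left_mono sum) simp
      finally show ?thesis .
    qed
  qed
  then have "(INF g \<in> s_gradients \<mu> s v. Lp_norm M p g) \<le> Lp_norm M p G" by (rule INF_lower)
  also have "\<dots> = 4 * Lp_norm M p (\<lambda>x. h x * indicator (D n) x)"
    unfolding G_def[abs_def] by (rule Lp_norm_cmult[OF p]) measurable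
  finally have "hajlasz_norm \<mu> s p v \<le> 2 * Lp_norm M p (\<lambda>x. h x * indicator (D n) x) + 4 * Lp_norm M p (\<lambda>x. h x * indicator (D n) x)"
    unfolding hajlasz_norm_def by (intro add_mono Lpv)
  also have "\<dots> = 6 * Lp_norm M p (\<lambda>x. h x * indicator (D n) x)"
    by (simp flip: distrib_right)
  also have "\<dots> < ennreal \<epsilon>" by (rule n)
  finally have N: "hajlasz_norm \<mu> s p v < ennreal \<epsilon>" .
  have "hajlasz_norm \<mu> s p v < \<infinity>" using N by (rule less_trans) simp
  moreover from this have "Lp_norm M p (eabs v) < \<infinity>" by (simp add: hajlasz_norm_def less_top[symmetric])
  ultimately have "v \<in> hajlasz_space \<mu> s p" using vL0 by (simp add: hajlasz_space_def Lp_def)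
  with N cont show ?thesis unfolding v_def[abs_def] by blast
qed

end

section \<open>Separated nets and interpolation in doubling spaces\<close>

text \<open>
  Maximality under inclusion makes an \<open>r\<close>-separated set \<open>r\<close>-dense.
\<close>

lemma ex_maximal_separated:
  fixes r :: real assumes r: "0 < r"
  shows "\<exists>S :: 'a::metric_space set. (\<forall>i\<in>S. \<forall>j\<in>S. i \<noteq> j \<longrightarrow> r \<le> dist i j) \<and> (\<forall>x. \<exists>i\<in>S. dist x i < r)"
proof -
  define \<A> where "\<A> = {S :: 'a set. \<forall>i\<in>S. \<forall>j\<in>S. i \<noteq> j \<longrightarrow> r \<le> dist i j}"
  have "\<exists>S\<in>\<A>. \<forall>X\<in>\<A>. S \<subseteq> X \<longrightarrow> X = S"
  proof (rule subset_Zorn')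
    fix C assume C: "subset.chain \<A> C"
    show "\<Union>C \<in> \<A>"
      unfolding \<A>_def
    proof (intro CollectI ballI impI)
      fix i j assume "i \<in> \<Union>C" "j \<in> \<Union>C" and ij: "i \<noteq> j"
      then obtain X Y where X: "X \<in> C" "i \<in> X" and Y: "Y \<in> C" "j \<in> Y" by blast
      have "X \<subseteq> Y \<or> Y \<subseteq> X" "X \<in> \<A>" "Y \<in> \<A>" using C X(1) Y(1) by (auto simp: subset_chain_def)
      then show "r \<le> dist i j" using X(2) Y(2) ij unfolding \<A>_def by blast
    qed
  qed
  then obtain S where S: "S \<in> \<A>" "\<And>X. X \<in> \<A> \<Longrightarrow> S \<subseteq> X \<Longrightarrow> X = S" by blast
  have "\<exists>i\<in>S. dist x i < r" for x
  proof (rule ccontr)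
    assume no: "\<not> (\<exists>i\<in>S. dist x i < r)"
    then have "insert x S \<in> \<A>" using S(1) by (auto simp: \<A>_def not_less dist_commute)
    then have "x \<in> S" using S(2)[of "insert x S"] by blast
    with no r show False by force
  qed
  with S(1) show ?thesis by (intro exI[of _ S]) (auto simp: \<A>_def)
qed

context mm_space
begin

lemma doubling_iterate:
  assumes "doubling \<mu>"
  obtains c :: real where "1 \<le> c" "\<And>x r k. 0 < r \<Longrightarrow> \<mu> (ball x (2 ^ k * r)) \<le> ennreal (c ^ k) * \<mu> (ball x r)"
proof -
  obtain Cd where Cd: "\<And>x r. 0 < r \<Longrightarrow> \<mu> (ball x (2 * r)) \<le> ennreal Cd * \<mu> (ball x r)"
    using assms by (auto simp: doubling_def)
  define c where "c = max 1 Cd"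
  have c: "\<mu> (ball x (2 * r)) \<le> ennreal c * \<mu> (ball x r)" if "0 < r" for x r
    by (rule order_trans[OF Cd[OF that]]) (auto simp: c_def intro!: mult_right_mono ennreal_leI)
  have "\<mu> (ball x (2 ^ k * r)) \<le> ennreal (c ^ k) * \<mu> (ball x r)" if r: "0 < r" for x r k
  proof (induction k)
    case (Suc k)
    have "\<mu> (ball x (2 * (2 ^ k * r))) \<le> ennreal c * \<mu> (ball x (2 ^ k * r))" using r by (intro c) auto
    also have "\<dots> \<le> ennreal c * (ennreal (c ^ k) * \<mu> (ball x r))" by (intro mult_left_mono Suc) auto
    finally show ?case by (simp add: c_def ennreal_mult mult_ac)
  qed auto
  then show ?thesis by (intro that[of c]) (auto simp: c_def)
qed

lemma disjoint_half_balls: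
  fixes S :: "'a set"
  assumes sep: "\<And>i j. i \<in> S \<Longrightarrow> j \<in> S \<Longrightarrow> i \<noteq> j \<Longrightarrow> r \<le> dist i j"
    and "i \<in> S" "j \<in> S" "x \<in> ball i (r / 2)" "x \<in> ball j (r / 2)"
  shows "i = j"
proof (rule ccontr)
  assume "i \<noteq> j"
  then have "r \<le> dist i j" using assms by auto
  moreover have "dist i j \<le> dist i x + dist j x" by (metis dist_commute dist_triangle)
  ultimately show False using assms(4,5) by simp
qed

text \<open>
  The balls of radius \<open>r/2\<close> about points of \<open>S\<close> are disjoint, those near \<open>x\<close> lie in one ball about
  \<open>x\<close>, and by doubling each of them carries a fixed fraction of the measure of that ball.
\<close>

lemma separated_card_le:
  fixes S :: "'a set"
  assumes c: "1 \<le> c" "\<And>x r k. 0 < r \<Longrightarrow> \<mu> (ball x (2 ^ k * r)) \<le> ennreal (c ^ k) * \<mu> (ball x r)"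
    and r: "0 < r" and sep: "\<And>i j. i \<in> S \<Longrightarrow> j \<in> S \<Longrightarrow> i \<noteq> j \<Longrightarrow> r \<le> dist i j"
  shows "finite {i\<in>S. dist x i < 2 ^ k * r} \<and> card {i\<in>S. dist x i < 2 ^ k * r} \<le> nat \<lceil>c ^ (k + 3)\<rceil>"
proof (rule finite_if_finite_subsets_card_bdd)
  fix T assume T: "T \<subseteq> {i\<in>S. dist x i < 2 ^ k * r}" "finite T"
  define m where "m = \<mu> (ball x (2 ^ (k + 1) * r))"
  have m: "0 < m" "m < \<infinity>" unfolding m_def using r mu_ball[of "2 ^ (k + 1) * r" x] by auto
  have half_r: "0 < r / 2" using r by simp
  \<comment> \<open>The exponent \<open>k + 3\<close> comes from \<open>B(x, 2\<^bsup>k+1\<^esup> r) \<subseteq> B(i, 2\<^bsup>k+3\<^esup> r/2)\<close>.\<close>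
  have k1: "1 \<le> (2::real) ^ k" by simp
  have half: "r / 2 \<le> 2 ^ k * r" using mult_right_mono[OF k1, of r] r by linarith
  have "of_nat (card T) * m = (\<Sum>i\<in>T. m)" by simp
  also have "\<dots> \<le> (\<Sum>i\<in>T. ennreal (c ^ (k + 3)) * \<mu> (ball i (r / 2)))"
  proof (rule sum_mono)
    fix i assume "i \<in> T"
    then have "dist x i < 2 ^ k * r" using T by auto
    have "ball x (2 ^ (k + 1) * r) \<subseteq> ball i (2 ^ (k + 3) * (r / 2))"
    proof
      fix y assume "y \<in> ball x (2 ^ (k + 1) * r)"
      then have "dist x y < 2 * (2 ^ k * r)" by simp
      moreover have "dist i y \<le> dist x i + dist x y" by (metis dist_commute dist_triangle)
      ultimately have "dist i y < 4 * (2 ^ k * r)" using \<open>dist x i < 2 ^ k * r\<close> zero_le_dist[of x i] by linarith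
      then show "y \<in> ball i (2 ^ (k + 3) * (r / 2))" by (simp add: power_add mult_ac)
    qed
    then have "m \<le> \<mu> (ball i (2 ^ (k + 3) * (r / 2)))" unfolding m_def by (rule mu_mono)
    also have "\<dots> \<le> ennreal (c ^ (k + 3)) * \<mu> (ball i (r / 2))" by (rule c(2)[OF half_r])
    finally show "m \<le> ennreal (c ^ (k + 3)) * \<mu> (ball i (r / 2))" .
  qed
  also have "\<dots> = ennreal (c ^ (k + 3)) * (\<Sum>i\<in>T. emeasure M (ball i (r / 2)))"
    by (simp add: sum_distrib_left emeasure_M)
  also have "(\<Sum>i\<in>T. emeasure M (ball i (r / 2))) = emeasure M (\<Union>i\<in>T. ball i (r / 2))"
  proof (rule sum_emeasure)
    show "disjoint_family_on (\<lambda>i. ball i (r / 2)) T"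
      using disjoint_half_balls[of S r, OF sep] T unfolding disjoint_family_on_def by blast
  qed (use T in auto)
  also have "\<dots> = \<mu> (\<Union>i\<in>T. ball i (r / 2))" by (intro emeasure_M open_sets_M open_UN) auto
  also have "\<dots> \<le> m"
    unfolding m_def
  proof (rule mu_mono, safe)
    fix i y assume i: "i \<in> T" and "y \<in> ball i (r / 2)"
    then have "dist i y < 2 ^ k * r" using half by simp
    moreover have "dist x i < 2 ^ k * r" using i T by auto
    moreover have "dist x y \<le> dist x i + dist i y" by (rule dist_triangle)
    ultimately have "dist x y < 2 * (2 ^ k * r)" by linarith
    then show "y \<in> ball x (2 ^ (k + 1) * r)" by simp
  qed
  finally have le: "of_nat (card T) * m \<le> ennreal (c ^ (k + 3)) * m" by (simp add: mult_left_mono)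
  obtain b where b: "m = ennreal b" "0 < b" using m by (cases m) auto
  have "ennreal (real (card T) * b) \<le> ennreal (c ^ (k + 3) * b)"
    using le b c(1) by (simp add: ennreal_mult ennreal_of_nat_eq_real_of_nat)
  then have "real (card T) * b \<le> c ^ (k + 3) * b" using b c(1) by (subst (asm) ennreal_le_iff) auto
  then have "real (card T) \<le> c ^ (k + 3)" using b by simp
  then show "card T \<le> nat \<lceil>c ^ (k + 3)\<rceil>" by linarith
qed

lemma separated_countable:
  fixes S :: "'a set"
  assumes "doubling \<mu>" and r: "0 < r" and sep: "\<And>i j. i \<in> S \<Longrightarrow> j \<in> S \<Longrightarrow> i \<noteq> j \<Longrightarrow> r \<le> dist i j"
  shows "countable S"
proof -
  obtain c where c: "1 \<le> c" "\<And>x r k. 0 < r \<Longrightarrow> \<mu> (ball x (2 ^ k * r)) \<le> ennreal (c ^ k) * \<mu> (ball x r)"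
    by (rule doubling_iterate[OF assms(1)]) (rule that)
  have "S \<subseteq> (\<Union>k. {i\<in>S. dist undefined i < 2 ^ k * r})"
  proof
    fix i assume i: "i \<in> S"
    obtain k where "dist undefined i / r < 2 ^ k" using real_arch_pow[of 2] by auto
    then show "i \<in> (\<Union>k. {i\<in>S. dist undefined i < 2 ^ k * r})" using i r by (auto simp: field_simps)
  qed
  moreover have "countable (\<Union>k. {i\<in>S. dist undefined i < 2 ^ k * r})"
  proof (rule countable_UN)
    show "countable {i\<in>S. dist undefined i < 2 ^ k * r}" for k
      using separated_card_le[of c r S undefined k] c r sep by (intro countable_finite) blast
  qed auto
  ultimately show ?thesis by (rule countable_subset)
qed

end

text \<open>
  The function is \<open>\<Sum>\<^sub>i \<psi>\<^sub>i c\<^sub>i / \<Sum>\<^sub>i \<psi>\<^sub>i\<close> with \<open>\<psi>\<^sub>i = max 0 (2 - d(\<cdot>,i)/r)\<close>. Being a local average it is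
  close to any number that all nearby \<open>c\<^sub>i\<close> are close to; the Lipschitz bound comes from the at most \<open>K\<close>
  weights that vary between \<open>x\<close> and \<open>y\<close> and the oscillation of the values near \<open>x\<close>.
\<close>

lemma partition_of_unity_interpolation:
  fixes c :: "'a::metric_space \<Rightarrow> real"
  assumes r: "0 < r" and dense: "\<And>x. \<exists>i\<in>S. dist x i < r"
    and fin: "\<And>x. finite {i\<in>S. dist x i < 3 * r}" and K: "\<And>x. card {i\<in>S. dist x i < 3 * r} \<le> K"
  obtains f where "continuous_on UNIV f"
    "\<And>x a H. \<forall>i\<in>S. dist x i < 2 * r \<longrightarrow> \<bar>c i - a\<bar> \<le> H \<Longrightarrow> \<bar>f x - a\<bar> \<le> H"
    "\<And>x y H. dist x y < r \<Longrightarrow> \<forall>i\<in>S. \<forall>j\<in>S. dist x i < 3 * r \<longrightarrow> dist x j < 3 * r \<longrightarrow> \<bar>c i - c j\<bar> \<le> H \<Longrightarrow>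
       \<bar>f x - f y\<bar> \<le> real K * (dist x y / r) * H"
proof -
  define J where "J x = {i\<in>S. dist x i < 3 * r}" for x
  define \<psi> where "\<psi> i x = max 0 (2 - dist x i / r)" for i x :: 'a
  define P where "P x = (\<Sum>i\<in>J x. \<psi> i x)" for x
  define f where "f x = (\<Sum>i\<in>J x. \<psi> i x * c i) / P x" for x
  have \<psi>0: "0 \<le> \<psi> i x" for i x by (simp add: \<psi>_def)
  have \<psi>_out: "\<psi> i x = 0" if "2 * r \<le> dist x i" for i x
    using that r by (simp add: \<psi>_def field_simps)
  have \<psi>_Lip: "\<bar>\<psi> i x - \<psi> i y\<bar> \<le> dist x y / r" for i x y
  proof -
    have "\<bar>\<psi> i x - \<psi> i y\<bar> \<le> \<bar>dist x i / r - dist y i / r\<bar>" unfolding \<psi>_def by (smt (verit))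
    also have "\<dots> = \<bar>dist x i - dist y i\<bar> / r" using r by (simp add: diff_divide_distrib[symmetric])
    also have "\<dots> \<le> dist x y / r"
      using r abs_dist_diff_le[of x i y] by (intro divide_right_mono) (auto simp: dist_commute)
    finally show ?thesis .
  qed
  have finJ: "finite (J x)" for x unfolding J_def by (rule fin)
  have P1: "1 \<le> P x" for x
  proof -
    obtain i where i: "i \<in> S" "dist x i < r" using dense by blast
    then have "1 \<le> \<psi> i x" using r by (simp add: \<psi>_def field_simps)
    also have "\<dots> \<le> P x" unfolding P_def using i r by (intro member_le_sum \<psi>0 finJ) (auto simp: J_def)
    finally show ?thesis .
  qed
  have Pf: "P x * f x = (\<Sum>i\<in>J x. \<psi> i x * c i)" for x using P1[of x] by (simp add: f_def)
  have near: "\<bar>f x - a\<bar> \<le> H" if H: "\<forall>i\<in>S. dist x i < 2 * r \<longrightarrow> \<bar>c i - a\<bar> \<le> H" for x a H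
  proof -
    have "P x * (f x - a) = (\<Sum>i\<in>J x. \<psi> i x * (c i - a))"
      by (simp only: right_diff_distrib Pf sum_subtractf) (simp add: P_def sum_distrib_right)
    then have "P x * \<bar>f x - a\<bar> = \<bar>\<Sum>i\<in>J x. \<psi> i x * (c i - a)\<bar>"
      using P1[of x] by (metis abs_mult abs_of_nonneg order_trans zero_le_one)
    also have "\<dots> \<le> (\<Sum>i\<in>J x. \<bar>\<psi> i x * (c i - a)\<bar>)" by (rule sum_abs)
    also have "\<dots> \<le> (\<Sum>i\<in>J x. \<psi> i x * H)"
    proof (rule sum_mono)
      fix i assume i: "i \<in> J x"
      show "\<bar>\<psi> i x * (c i - a)\<bar> \<le> \<psi> i x * H"
      proof (cases "dist x i < 2 * r")
        case True
        then show ?thesis using H i \<psi>0[of i x] by (auto simp: abs_mult J_def intro!: mult_left_mono)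
      qed (use \<psi>_out in auto)
    qed
    also have "\<dots> = P x * H" by (simp add: P_def sum_distrib_right)
    finally show ?thesis using P1[of x] by simp
  qed
  have Lip: "\<bar>f x - f y\<bar> \<le> real K * (dist x y / r) * H"
    if xy: "dist x y < r" and H: "\<forall>i\<in>S. \<forall>j\<in>S. dist x i < 3 * r \<longrightarrow> dist x j < 3 * r \<longrightarrow> \<bar>c i - c j\<bar> \<le> H" for x y H
  proof -
    have Jy: "(\<Sum>i\<in>J y. \<psi> i y * b i) = (\<Sum>i\<in>J x. \<psi> i y * b i)" for b :: "'a \<Rightarrow> real"
    proof -
      have zero: "\<psi> i y = 0" if "i \<in> S" "i \<notin> J x \<or> i \<notin> J y" for i
      proof (rule \<psi>_out, rule ccontr)
        assume "\<not> 2 * r \<le> dist y i"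
        then have "dist y i < 2 * r" by simp
        moreover have "dist x i \<le> dist x y + dist y i" by (rule dist_triangle)
        ultimately show False using that xy r by (auto simp: J_def)
      qed
      have "(\<Sum>i\<in>J y. \<psi> i y * b i) = (\<Sum>i\<in>J x \<inter> J y. \<psi> i y * b i)"
        using zero by (intro sum.mono_neutral_right finJ) (auto simp: J_def)
      also have "\<dots> = (\<Sum>i\<in>J x. \<psi> i y * b i)"
        using zero by (intro sum.mono_neutral_left finJ) (auto simp: J_def)
      finally show ?thesis .
    qed
    have Py: "P y = (\<Sum>i\<in>J x. \<psi> i y)" using Jy[of "\<lambda>_. 1"] by (simp add: P_def)
    have Pfy: "P y * f y = (\<Sum>i\<in>J x. \<psi> i y * c i)" using Jy Pf by simp
    have osc: "\<bar>c i - f y\<bar> \<le> H" if i: "i \<in> J x" for i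
    proof -
      have "\<bar>f y - c i\<bar> \<le> H"
      proof (rule near, intro ballI impI)
        fix j assume j: "j \<in> S" "dist y j < 2 * r"
        have "dist x j \<le> dist x y + dist y j" by (rule dist_triangle)
        then have "dist x j < 3 * r" using j xy by simp
        then show "\<bar>c j - c i\<bar> \<le> H" using H i j by (auto simp: J_def)
      qed
      then show ?thesis by (simp add: abs_minus_commute)
    qed
    have Jx0: "J x \<noteq> {}" using P1[of x] by (auto simp: P_def)
    have H0: "0 \<le> H" using osc Jx0 by (meson abs_ge_zero ex_in_conv order_trans)
    have "P x * (f x - f y) = (\<Sum>i\<in>J x. \<psi> i x * (c i - f y))"
      by (simp only: right_diff_distrib Pf sum_subtractf) (simp add: P_def sum_distrib_right)
    moreover have "0 = (\<Sum>i\<in>J x. \<psi> i y * (c i - f y))"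
      using Pfy by (simp add: Py right_diff_distrib sum_subtractf sum_distrib_right[symmetric])
    ultimately have "P x * (f x - f y) = (\<Sum>i\<in>J x. (\<psi> i x - \<psi> i y) * (c i - f y))"
      by (simp add: left_diff_distrib sum_subtractf)
    then have "P x * \<bar>f x - f y\<bar> = \<bar>\<Sum>i\<in>J x. (\<psi> i x - \<psi> i y) * (c i - f y)\<bar>"
      using P1[of x] by (metis abs_mult abs_of_nonneg order_trans zero_le_one)
    also have "\<dots> \<le> (\<Sum>i\<in>J x. \<bar>(\<psi> i x - \<psi> i y) * (c i - f y)\<bar>)" by (rule sum_abs)
    also have "\<dots> \<le> (\<Sum>i\<in>J x. (dist x y / r) * H)"
      unfolding abs_mult using osc \<psi>_Lip r by (intro sum_mono mult_mono) auto
    also have "\<dots> = real (card (J x)) * ((dist x y / r) * H)" by simp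
    also have "\<dots> \<le> real K * ((dist x y / r) * H)"
      using K[of x] r H0 by (intro mult_right_mono) (auto simp: J_def)
    finally have *: "P x * \<bar>f x - f y\<bar> \<le> real K * (dist x y / r) * H" by (simp add: mult.assoc)
    have "1 * \<bar>f x - f y\<bar> \<le> P x * \<bar>f x - f y\<bar>" using P1[of x] by (intro mult_right_mono) auto
    with * show ?thesis by simp
  qed
  have cont: "continuous_on UNIV f"
    unfolding continuous_on_def
  proof
    fix x :: 'a
    define H where "H = Max ((\<lambda>(i, j). \<bar>c i - c j\<bar>) ` (J x \<times> J x))"
    have H: "\<forall>i\<in>S. \<forall>j\<in>S. dist x i < 3 * r \<longrightarrow> dist x j < 3 * r \<longrightarrow> \<bar>c i - c j\<bar> \<le> H"
      unfolding H_def using finJ[of x] by (auto intro!: Max_ge simp: J_def)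
    have "((\<lambda>y. real K * (dist x y / r) * H) \<longlongrightarrow> real K * (dist x x / r) * H) (at x)"
      using r by (intro tendsto_intros) auto
    then have "((\<lambda>y. real K * (dist x y / r) * H) \<longlongrightarrow> 0) (at x)" by simp
    moreover have "\<forall>\<^sub>F y in at x. norm (f y - f x) \<le> real K * (dist x y / r) * H"
      unfolding eventually_at
      using r Lip[OF _ H] by (intro exI[of _ r]) (auto simp: dist_commute abs_minus_commute)
    ultimately have "((\<lambda>y. f y - f x) \<longlongrightarrow> 0) (at x)" by (rule Lim_null_comparison[rotated])
    then show "(f \<longlongrightarrow> f x) (at x)" by (simp add: LIM_zero_iff)
  qed
  show ?thesis by (rule that[OF cont near Lip])
qed

section \<open>Density of continuous functions by sampling at one scale\<close>

definition from_scale :: "int \<Rightarrow> (int \<Rightarrow> 'a \<Rightarrow> ennreal) \<Rightarrow> int \<Rightarrow> 'a \<Rightarrow> ennreal" where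
  "from_scale m g k x = (if m \<le> k then g k x else 0)"

lemma measurable_from_scale:
  "(\<And>k. g k \<in> borel_measurable M) \<Longrightarrow> from_scale m g k \<in> borel_measurable M"
  unfolding from_scale_def[abs_def] by (cases "m \<le> k") simp_all

text \<open>
  The properties of \<open>R\<close> that separate \<open>q < \<infinity>\<close> from \<open>q = \<infinity>\<close>: geometric weights in the scale are
  summable uniformly in their centre, and the tails of a finite \<open>R\<close> tend to zero. The shift by \<open>3\<close>
  accounts for the distances up to \<open>8 \<cdot> 2\<^sup>-\<^sup>n\<close> that occur between sampling points.
\<close>

locale smoothable_gradient_space = gradient_space +
  assumes s_less_1: "s < 1" and doubling: "doubling \<mu>"
    and Lp_le_R: "Lp_norm (carath_measure \<mu>) p (g k) \<le> R g"
    and R_geometric: "0 < \<theta> \<Longrightarrow> \<theta> < 1 \<Longrightarrow> \<exists>C::real. \<forall>m h. h \<in> borel_measurable (carath_measure \<mu>) \<longrightarrow>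
      R (\<lambda>k x. ennreal (\<theta> ^ nat \<bar>k - m\<bar>) * h x) \<le> ennreal C * Lp_norm (carath_measure \<mu>) p h"
    and R_from_scale: "(\<And>k. g k \<in> borel_measurable (carath_measure \<mu>)) \<Longrightarrow> R g < \<infinity> \<Longrightarrow>
      (\<lambda>n::nat. R (from_scale (int n - 3) g)) \<longlonglongrightarrow> 0"
begin

lemma R_add_le:
  obtains C :: real where "0 \<le> C"
    "\<And>g h. (\<forall>k. g k \<in> borel_measurable M) \<Longrightarrow> (\<forall>k. h k \<in> borel_measurable M) \<Longrightarrow>
       R (\<lambda>k x. g k x + h k x) \<le> ennreal C * (R g + R h)"
proof -
  obtain C where C: "0 \<le> C" "\<forall>g :: nat \<Rightarrow> int \<Rightarrow> 'a \<Rightarrow> ennreal.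
        (\<forall>i k. g i k \<in> borel_measurable M) \<longrightarrow>
        R (\<lambda>k x. SUP i. g i k x) \<le> ennreal C * (SUP i. 4 ^ i * R (g i))"
    using R_SUP by (elim exE conjE)
  show ?thesis
  proof (rule that[of "8 * C"])
    fix g h :: "int \<Rightarrow> 'a \<Rightarrow> ennreal" assume m: "\<forall>k. g k \<in> borel_measurable M" "\<forall>k. h k \<in> borel_measurable M"
    define G where "G i = (if i = 0 then g else if i = 1 then h else (\<lambda>_ _. 0))" for i :: nat
    have Gm: "G i k \<in> borel_measurable M" for i k using m by (simp add: G_def)
    have le: "g k x + h k x \<le> 2 * (SUP i. G i k x)" for k x
    proof -
      have "g k x = G 0 k x" "h k x = G 1 k x" by (auto simp: G_def)
      then have "g k x + h k x \<le> (SUP i. G i k x) + (SUP i. G i k x)" by (auto intro!: add_mono SUP_upper)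
      then show ?thesis by (simp add: mult_2)
    qed
    have "R (\<lambda>k x. g k x + h k x) \<le> R (\<lambda>k x. 2 * (SUP i. G i k x))" by (rule R_mono[OF le])
    also have "\<dots> = 2 * R (\<lambda>k x. SUP i. G i k x)" using Gm by (intro R_cmult borel_measurable_SUP) auto
    also have "\<dots> \<le> 2 * (ennreal C * (SUP i. 4 ^ i * R (G i)))" using C(2) Gm by (intro mult_left_mono) auto
    also have "(SUP i. 4 ^ i * R (G i)) \<le> 4 * (R g + R h)"
    proof (rule SUP_least)
      fix i :: nat
      consider "i = 0" | "i = 1" | "i \<noteq> 0" "i \<noteq> 1" by blast
      then show "4 ^ i * R (G i) \<le> 4 * (R g + R h)"
      proof cases
        case 1
        have "1 * R g \<le> 4 * (R g + R h)" by (intro mult_mono) auto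
        then show ?thesis using 1 by (simp add: G_def)
      next
        case 2
        then show ?thesis by (auto simp: G_def intro!: mult_left_mono)
      qed (simp add: G_def R_zero)
    qed
    finally have "R (\<lambda>k x. g k x + h k x) \<le> 2 * (ennreal C * (4 * (R g + R h)))" by (simp add: mult_left_mono)
    also have "\<dots> = (2 * 4) * (ennreal C * (R g + R h))" by (simp only: mult_ac)
    also have "\<dots> = ennreal (8 * C) * (R g + R h)" using C(1) by (simp add: ennreal_mult mult.assoc)
    finally show "R (\<lambda>k x. g k x + h k x) \<le> ennreal (8 * C) * (R g + R h)" .
  qed (use C in auto)
qed

end

context mm_space
begin

text \<open>
  Otherwise \<open>A\<^sup>p\<close> would exceed its mean over the ball at almost every point of the ball.
\<close>

lemma ex_sampling_point:
  assumes p: "0 < p" and [measurable]: "A \<in> borel_measurable M" and Z: "\<mu> Z = 0" and r: "0 < r"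
  shows "\<exists>z\<in>ball i r. z \<notin> Z \<and>
    enn_powr (A z) p * \<mu> (ball i r) \<le> (\<integral>\<^sup>+x. enn_powr (A x) p * indicator (ball i r) x \<partial>M)"
proof (rule ccontr)
  define B where "B = ball i r"
  have [measurable]: "B \<in> sets M" by (simp add: B_def)
  define I where "I = (\<integral>\<^sup>+x. enn_powr (A x) p * indicator B x \<partial>M)"
  assume "\<not> (\<exists>z\<in>ball i r. z \<notin> Z \<and>
    enn_powr (A z) p * \<mu> (ball i r) \<le> (\<integral>\<^sup>+x. enn_powr (A x) p * indicator (ball i r) x \<partial>M))"
  then have less: "I < enn_powr (A z) p * \<mu> B" if "z \<in> B" "z \<notin> Z" for z
    using that by (auto simp: B_def I_def not_le)
  obtain b where b: "\<mu> B = ennreal b" "0 < b"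
    using mu_ball[OF r, of i] by (cases "\<mu> B") (auto simp: B_def)
  have B: "emeasure M B = ennreal b" using b by (simp add: emeasure_M)
  have neq: "\<not> (AE x in M. x \<notin> B)"
  proof
    assume "AE x in M. x \<notin> B"
    then have "\<mu> B = 0" by (simp add: AE_M_iff)
    then show False using b by simp
  qed
  obtain z where "z \<in> B" "z \<notin> Z"
  proof (rule ccontr)
    assume "\<not> thesis"
    then have "B \<subseteq> Z" using that by blast
    then have "\<mu> B = 0" using Z null_subset by blast
    then show False using b by simp
  qed
  then have Ifin: "I < \<infinity>" using less[of z] by (auto elim: less_le_trans)
  then obtain c where c: "I = ennreal c" "0 \<le> c" by (cases I) auto
  define a where "a = ennreal (c / b)"
  have aI: "a * ennreal b = I" using b c by (simp add: a_def ennreal_mult[symmetric])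
  have lt: "a < enn_powr (A z) p" if "z \<in> B" "z \<notin> Z" for z
  proof (rule ccontr)
    assume "\<not> a < enn_powr (A z) p"
    then have "enn_powr (A z) p * ennreal b \<le> a * ennreal b" by (intro mult_right_mono) auto
    then show False using less[OF that] unfolding aI b(1) by simp
  qed
  have "(\<integral>\<^sup>+x. a * indicator B x \<partial>M) < (\<integral>\<^sup>+x. enn_powr (A x) p * indicator B x \<partial>M)"
  proof (rule nn_integral_less)
    show "(\<integral>\<^sup>+x. a * indicator B x \<partial>M) \<noteq> \<infinity>"
      using Ifin aI B by (simp add: nn_integral_cmult_indicator)
    show "AE x in M. a * indicator B x \<le> enn_powr (A x) p * indicator B x"
      by (rule AE_M_I[OF Z]) (use lt in \<open>auto simp: less_imp_le split: split_indicator\<close>)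
    show "\<not> (AE x in M. enn_powr (A x) p * indicator B x \<le> a * indicator B x)"
    proof
      assume "AE x in M. enn_powr (A x) p * indicator B x \<le> a * indicator B x"
      moreover have "AE x in M. x \<notin> Z" by (rule AE_M_I[OF Z])
      ultimately have "AE x in M. x \<notin> B"
      proof eventually_elim
        fix x assume "enn_powr (A x) p * indicator B x \<le> a * indicator B x" "x \<notin> Z"
        then show "x \<notin> B" using lt[of x] by (auto split: split_indicator_asm)
      qed
      with neq show False ..
    qed
  qed auto
  also have "\<dots> = I" by (simp add: I_def)
  finally show False using aI B by (simp add: nn_integral_cmult_indicator)
qed

text \<open>
  Each sampled value is bounded by the mean of \<open>A\<^sup>p\<close> over its ball of radius \<open>r/2\<close>. These balls are
  disjoint, and enlarging them to radius \<open>3r\<close> costs a doubling factor.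
\<close>

lemma sampled_Lp_norm_le:
  assumes p: "0 < p" and dbl: "doubling \<mu>"
  obtains C :: real where "0 \<le> C"
    "\<And>S r z A. 0 < r \<Longrightarrow> \<forall>i\<in>S. \<forall>j\<in>S. i \<noteq> j \<longrightarrow> r \<le> dist i j \<Longrightarrow> A \<in> borel_measurable M \<Longrightarrow>
      \<forall>i\<in>S. enn_powr (A (z i)) p * \<mu> (ball i (r / 2)) \<le> (\<integral>\<^sup>+x. enn_powr (A x) p * indicator (ball i (r / 2)) x \<partial>M) \<Longrightarrow>
      (\<lambda>x. SUP i\<in>S. A (z i) * indicator (ball i (3 * r)) x) \<in> borel_measurable M \<and>
      Lp_norm M p (\<lambda>x. SUP i\<in>S. A (z i) * indicator (ball i (3 * r)) x) \<le> ennreal C * Lp_norm M p A"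
proof -
  obtain c where c: "1 \<le> c" "\<And>x r k. 0 < r \<Longrightarrow> \<mu> (ball x (2 ^ k * r)) \<le> ennreal (c ^ k) * \<mu> (ball x r)"
    by (rule doubling_iterate[OF dbl]) (rule that)
  show ?thesis
  proof (rule that[of "(c ^ 3) powr (1/p)"])
    fix S r z and A :: "'a \<Rightarrow> ennreal"
    assume r: "0 < r" and sep: "\<forall>i\<in>S. \<forall>j\<in>S. i \<noteq> j \<longrightarrow> r \<le> dist i j" and A[measurable]: "A \<in> borel_measurable M"
      and z: "\<forall>i\<in>S. enn_powr (A (z i)) p * \<mu> (ball i (r / 2)) \<le> (\<integral>\<^sup>+x. enn_powr (A x) p * indicator (ball i (r / 2)) x \<partial>M)"
    have S: "countable S" by (rule separated_countable[OF dbl r]) (use sep in blast)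
    define T where "T x = (SUP i\<in>S. A (z i) * indicator (ball i (3 * r)) x)" for x
    have [measurable]: "ball i t \<in> sets M" for i t by simp
    have Tm: "T \<in> borel_measurable M"
      unfolding T_def by (rule borel_measurable_SUP[OF S]) measurable
    have pt: "enn_powr (T x) p \<le> (\<integral>\<^sup>+i. enn_powr (A (z i)) p * indicator (ball i (3 * r)) x \<partial>count_space S)" (is "_ \<le> ?s") for x
    proof -
      have "T x \<le> enn_powr ?s (1/p)"
        unfolding T_def
      proof (rule SUP_least)
        fix i assume i: "i \<in> S"
        have "enn_powr (A (z i) * indicator (ball i (3 * r)) x) p = enn_powr (A (z i)) p * indicator (ball i (3 * r)) x"
          by (auto split: split_indicator)
        also have "\<dots> = (\<integral>\<^sup>+j. (enn_powr (A (z i)) p * indicator (ball i (3 * r)) x) * indicator {i} j \<partial>count_space S)"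
          using i by (simp add: nn_integral_cmult_indicator)
        also have "\<dots> \<le> ?s" by (intro nn_integral_mono) (auto split: split_indicator)
        finally have "enn_powr (enn_powr (A (z i) * indicator (ball i (3 * r)) x) p) (1/p) \<le> enn_powr ?s (1/p)"
          using p by (intro enn_powr_mono) auto
        then show "A (z i) * indicator (ball i (3 * r)) x \<le> enn_powr ?s (1/p)"
          by (simp add: enn_powr_inverse[OF p])
      qed
      then have "enn_powr (T x) p \<le> enn_powr (enn_powr ?s (1/p)) p" by (rule enn_powr_mono[OF p])
      then show ?thesis by (simp add: enn_powr_inverse[OF p])
    qed
    have one: "(\<integral>\<^sup>+i. indicator (ball i (r / 2)) x \<partial>count_space S) \<le> 1" for x
    proof (cases "\<exists>i\<in>S. x \<in> ball i (r / 2)")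
      case True
      then obtain i where i: "i \<in> S" "x \<in> ball i (r / 2)" by blast
      have uniq: "j = i" if "j \<in> S" "x \<in> ball j (r / 2)" for j
        by (rule disjoint_half_balls[of S r j i x]) (use that i sep in auto)
      have "(\<integral>\<^sup>+i. indicator (ball i (r / 2)) x \<partial>count_space S) \<le> (\<integral>\<^sup>+j. indicator {i} j \<partial>count_space S)"
        using uniq by (intro nn_integral_mono) (auto split: split_indicator)
      also have "\<dots> = 1" using i by (simp add: one_ennreal_def)
      finally show ?thesis .
    next
      case False
      then have "(\<integral>\<^sup>+i. indicator (ball i (r / 2)) x \<partial>count_space S) = (\<integral>\<^sup>+i. 0 \<partial>count_space S)"
        by (intro nn_integral_cong) (auto split: split_indicator)
      then show ?thesis by simp
    qed
    have "(\<integral>\<^sup>+x. enn_powr (T x) p \<partial>M) \<le> (\<integral>\<^sup>+x. \<integral>\<^sup>+i. enn_powr (A (z i)) p * indicator (ball i (3 * r)) x \<partial>count_space S \<partial>M)"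
      by (intro nn_integral_mono pt)
    also have "\<dots> = (\<integral>\<^sup>+i. \<integral>\<^sup>+x. enn_powr (A (z i)) p * indicator (ball i (3 * r)) x \<partial>M \<partial>count_space S)"
      by (rule nn_integral_count_space_nn_integral[OF S]) measurable
    also have "\<dots> = (\<integral>\<^sup>+i. enn_powr (A (z i)) p * \<mu> (ball i (3 * r)) \<partial>count_space S)"
      by (intro nn_integral_cong) (simp add: nn_integral_cmult_indicator emeasure_M)
    also have "\<dots> \<le> (\<integral>\<^sup>+i. ennreal (c ^ 3) * (\<integral>\<^sup>+x. enn_powr (A x) p * indicator (ball i (r / 2)) x \<partial>M) \<partial>count_space S)"
    proof (rule nn_integral_mono)
      fix i assume "i \<in> space (count_space S)"
      then have i: "i \<in> S" by simp
      have "\<mu> (ball i (3 * r)) \<le> \<mu> (ball i (2 ^ 3 * (r / 2)))" using r by (intro mu_mono) auto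
      also have "\<dots> \<le> ennreal (c ^ 3) * \<mu> (ball i (r / 2))" using r by (intro c) auto
      finally have "enn_powr (A (z i)) p * \<mu> (ball i (3 * r)) \<le> enn_powr (A (z i)) p * (ennreal (c ^ 3) * \<mu> (ball i (r / 2)))"
        by (rule mult_left_mono) simp
      also have "\<dots> = ennreal (c ^ 3) * (enn_powr (A (z i)) p * \<mu> (ball i (r / 2)))" by (simp add: mult_ac)
      also have "\<dots> \<le> ennreal (c ^ 3) * (\<integral>\<^sup>+x. enn_powr (A x) p * indicator (ball i (r / 2)) x \<partial>M)"
        using z i by (intro mult_left_mono) auto
      finally show "enn_powr (A (z i)) p * \<mu> (ball i (3 * r)) \<le> ennreal (c ^ 3) * (\<integral>\<^sup>+x. enn_powr (A x) p * indicator (ball i (r / 2)) x \<partial>M)" .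
    qed
    also have "\<dots> = ennreal (c ^ 3) * (\<integral>\<^sup>+i. \<integral>\<^sup>+x. enn_powr (A x) p * indicator (ball i (r / 2)) x \<partial>M \<partial>count_space S)"
      by (rule nn_integral_cmult) simp
    also have "(\<integral>\<^sup>+i. \<integral>\<^sup>+x. enn_powr (A x) p * indicator (ball i (r / 2)) x \<partial>M \<partial>count_space S) =
        (\<integral>\<^sup>+x. \<integral>\<^sup>+i. enn_powr (A x) p * indicator (ball i (r / 2)) x \<partial>count_space S \<partial>M)"
      by (rule nn_integral_count_space_nn_integral[OF S, symmetric]) measurable
    also have "\<dots> \<le> (\<integral>\<^sup>+x. enn_powr (A x) p \<partial>M)"
    proof (rule nn_integral_mono)
      fix x
      have "(\<integral>\<^sup>+i. enn_powr (A x) p * indicator (ball i (r / 2)) x \<partial>count_space S) = enn_powr (A x) p * (\<integral>\<^sup>+i. indicator (ball i (r / 2)) x \<partial>count_space S)"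
        by (rule nn_integral_cmult) simp
      also have "\<dots> \<le> enn_powr (A x) p * 1" by (intro mult_left_mono one) simp
      finally show "(\<integral>\<^sup>+i. enn_powr (A x) p * indicator (ball i (r / 2)) x \<partial>count_space S) \<le> enn_powr (A x) p" by simp
    qed
    finally have "(\<integral>\<^sup>+x. enn_powr (T x) p \<partial>M) \<le> ennreal (c ^ 3) * (\<integral>\<^sup>+x. enn_powr (A x) p \<partial>M)"
      by (simp add: mult_left_mono)
    then have "Lp_norm M p T \<le> enn_powr (ennreal (c ^ 3) * (\<integral>\<^sup>+x. enn_powr (A x) p \<partial>M)) (1/p)"
      unfolding Lp_norm_def using p by (intro enn_powr_mono) auto
    also have "\<dots> = ennreal ((c ^ 3) powr (1/p)) * Lp_norm M p A"
      using p c(1) by (simp add: enn_powr_mult enn_powr_ennreal Lp_norm_def)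
    finally show "(\<lambda>x. SUP i\<in>S. A (z i) * indicator (ball i (3 * r)) x) \<in> borel_measurable M \<and>
      Lp_norm M p (\<lambda>x. SUP i\<in>S. A (z i) * indicator (ball i (3 * r)) x) \<le> ennreal ((c ^ 3) powr (1/p)) * Lp_norm M p A"
      using Tm unfolding T_def[abs_def] by blast
  qed simp
qed

end

lemma ennreal_pos_mult_top: "0 < c \<Longrightarrow> ennreal c * \<infinity> = \<infinity>"
  by (simp add: ennreal_mult_top)

lemma two_powi_eq_powr: "(2::real) powi k = 2 powr real_of_int k"
  by (simp add: powr_real_of_int')

lemma eight_half_power: "8 * (1/2) ^ n = (2::real) powr (3 - real n)"
  by (simp add: powr_diff powr_realpow power_one_over)

text \<open>
  Below the scale of the net the interpolant is Lipschitz, and \<open>s < 1\<close> turns the gain \<open>(d/r)\<^bsup>1-s\<^esup>\<close>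
  into geometric decay.
\<close>

lemma fine_scale_weight:
  fixes d s :: real
  assumes s: "0 < s" "s < 1" and k: "int n \<le> k" and d: "0 < d" "d < 2 powr (- real_of_int k)"
  shows "d * 2 ^ n * (8 * (1/2) ^ n) powr s \<le> 8 * d powr s * (2 powr (- min s (1 - s))) ^ nat \<bar>k - int n\<bar>"
proof -
  define r :: real where "r = (1/2) ^ n"
  have r: "0 < r" "r = 2 powr (- real n)" by (auto simp: r_def powr_minus powr_realpow power_one_over inverse_eq_divide)
  have "d * 2 ^ n * (8 * (1/2) ^ n) powr s = d / r * (8 * r) powr s"
    by (simp add: r_def power_one_over)
  also have "d / r = (d / r) powr s * (d / r) powr (1 - s)"
    using d r by (simp add: powr_add[symmetric])
  also have "\<dots> * (8 * r) powr s = 8 powr s * d powr s * (d / r) powr (1 - s)"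
    using d r by (simp add: powr_mult powr_divide)
  also have "\<dots> \<le> 8 * d powr s * (2 powr (- min s (1 - s))) ^ nat \<bar>k - int n\<bar>"
  proof (intro mult_mono)
    have "8 powr s \<le> 8 powr 1" using s by (intro powr_mono) auto
    then show "8 powr s \<le> (8::real)" by simp
    have "d / r \<le> 2 powr (- real_of_int k) / r" using d r by (intro divide_right_mono) auto
    also have "\<dots> = 2 powr (- real_of_int (k - int n))" unfolding r(2) by (simp add: powr_diff[symmetric])
    finally have "(d / r) powr (1 - s) \<le> (2 powr (- real_of_int (k - int n))) powr (1 - s)"
      using d r s by (intro powr_mono2) auto
    also have "\<dots> = 2 powr (- (real_of_int (k - int n) * (1 - s)))" by (simp add: powr_powr algebra_simps)
    also have "\<dots> \<le> 2 powr (- (real_of_int (k - int n) * min s (1 - s)))"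
      using k by (intro powr_mono) (auto intro!: mult_left_mono)
    also have "\<dots> = (2 powr (- min s (1 - s))) powr real (nat \<bar>k - int n\<bar>)"
      using k by (simp add: powr_powr mult.commute)
    also have "\<dots> = (2 powr (- min s (1 - s))) ^ nat \<bar>k - int n\<bar>" by (rule powr_realpow) simp
    finally show "(d / r) powr (1 - s) \<le> (2 powr (- min s (1 - s))) ^ nat \<bar>k - int n\<bar>" .
  qed auto
  finally show ?thesis .
qed

text \<open>
  Above the scale \<open>r\<close> of the net the error has size of order \<open>r\<^sup>s\<close>, and \<open>(r/d)\<^sup>s\<close> decays geometrically.
\<close>

lemma coarse_scale_weight:
  fixes d s :: real
  assumes s: "0 < s" "s < 1" and k: "k < int n" and d: "2 powr (- real_of_int k - 1) \<le> d"
  shows "(8 * (1/2) ^ n) powr s \<le> 16 * d powr s * (2 powr (- min s (1 - s))) ^ nat \<bar>k - int n\<bar>"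
proof -
  have "(8 * (1/2) ^ n) powr s = 2 powr ((3 - real n) * s)"
    unfolding eight_half_power by (simp add: powr_powr)
  also have "\<dots> = 2 powr (4 * s) * (2 powr ((- real_of_int k - 1) * s) * 2 powr (- (real_of_int (int n - k) * s)))"
    by (simp add: powr_add[symmetric] algebra_simps)
  also have "\<dots> \<le> 16 * (d powr s * (2 powr (- min s (1 - s))) ^ nat \<bar>k - int n\<bar>)"
  proof (intro mult_mono)
    have "2 powr (4 * s) \<le> 2 powr 4" using s by (intro powr_mono) auto
    then show "2 powr (4 * s) \<le> (16::real)" by simp
    have "(2 powr (- real_of_int k - 1)) powr s \<le> d powr s" using d s by (intro powr_mono2) auto
    then show "2 powr ((- real_of_int k - 1) * s) \<le> d powr s" by (simp add: powr_powr)
    have "2 powr (- (real_of_int (int n - k) * s)) \<le> 2 powr (- (real_of_int (int n - k) * min s (1 - s)))"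
      using k by (intro powr_mono) (auto intro!: mult_left_mono)
    also have "\<dots> = (2 powr (- min s (1 - s))) powr real (nat \<bar>k - int n\<bar>)"
      using k by (simp add: powr_powr mult.commute)
    also have "\<dots> = (2 powr (- min s (1 - s))) ^ nat \<bar>k - int n\<bar>" by (rule powr_realpow) simp
    finally show "2 powr (- (real_of_int (int n - k) * s)) \<le> (2 powr (- min s (1 - s))) ^ nat \<bar>k - int n\<bar>" .
  qed auto
  finally show ?thesis by (simp add: mult.assoc)
qed

context smoothable_gradient_space
begin

text \<open>
  The discrete Hardy operator that collects the scales from \<open>n - 3\<close> on: it bounds the oscillation of
  \<open>u\<close> at all distances below \<open>8 \<cdot> 2\<^sup>-\<^sup>n\<close> at once.
\<close>

definition Hardy :: "nat \<Rightarrow> (int \<Rightarrow> 'a \<Rightarrow> ennreal) \<Rightarrow> 'a \<Rightarrow> ennreal" where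
  "Hardy n g x = (SUP i::nat. ennreal ((2 powr (- s)) ^ i) * g (int n - 3 + int i) x)"

lemma Hardy_Lp_le:
  obtains C :: real where "0 \<le> C" "\<And>n g. \<forall>k. g k \<in> borel_measurable M \<Longrightarrow>
    Hardy n g \<in> borel_measurable M \<and> Lp_norm M p (Hardy n g) \<le> ennreal C * R (from_scale (int n - 3) g)"
proof -
  define t where "t = 2 powr (- s)"
  have t: "0 < t" "t < 1" using s_pos powr_less_mono[of "- s" 0 2] by (auto simp: t_def)
  obtain C :: real where C: "0 < C" "\<And>(M :: 'a measure) (f :: nat \<Rightarrow> 'a \<Rightarrow> ennreal). \<forall>i. f i \<in> borel_measurable M \<Longrightarrow>
       Lp_norm M p (\<lambda>x. SUP i. f i x) \<le> ennreal C * (SUP i. ennreal ((1/t) ^ i) * Lp_norm M p (f i))"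
    by (rule Lp_norm_SUP_le[OF p_pos t]) (rule that)
  show ?thesis
  proof (rule that[of C])
    fix n and g :: "int \<Rightarrow> 'a \<Rightarrow> ennreal" assume "\<forall>k. g k \<in> borel_measurable M"
    then have gm [measurable]: "g k \<in> borel_measurable M" for k by simp
    have "Lp_norm M p (Hardy n g) \<le> ennreal C * (SUP i. ennreal ((1/t) ^ i) * Lp_norm M p (\<lambda>x. ennreal (t ^ i) * g (int n - 3 + int i) x))"
      unfolding Hardy_def[abs_def] t_def[symmetric] by (intro C(2) allI) measurable
    also have "\<dots> \<le> ennreal C * R (from_scale (int n - 3) g)"
    proof (intro mult_left_mono SUP_least)
      fix i :: nat
      have "ennreal ((1/t) ^ i) * Lp_norm M p (\<lambda>x. ennreal (t ^ i) * g (int n - 3 + int i) x)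
          = (ennreal ((1/t) ^ i) * ennreal (t ^ i)) * Lp_norm M p (g (int n - 3 + int i))"
        by (simp add: Lp_norm_cmult[OF p_pos] mult.assoc)
      also have "ennreal ((1/t) ^ i) * ennreal (t ^ i) = 1"
        using t by (simp add: ennreal_mult[symmetric] power_one_over)
      also have "1 * Lp_norm M p (g (int n - 3 + int i)) = Lp_norm M p (from_scale (int n - 3) g (int n - 3 + int i))"
        by (simp add: from_scale_def[abs_def])
      also have "\<dots> \<le> R (from_scale (int n - 3) g)" by (rule Lp_le_R)
      finally show "ennreal ((1/t) ^ i) * Lp_norm M p (\<lambda>x. ennreal (t ^ i) * g (int n - 3 + int i) x) \<le> R (from_scale (int n - 3) g)" .
    qed simp
    finally show "Hardy n g \<in> borel_measurable M \<and> Lp_norm M p (Hardy n g) \<le> ennreal C * R (from_scale (int n - 3) g)"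
      unfolding Hardy_def[abs_def] by auto
  qed (use C in auto)
qed

lemma oscillation_le_Hardy:
  assumes Z: "\<And>k x y. x \<notin> Z \<Longrightarrow> y \<notin> Z \<Longrightarrow> 2 powi (- k - 1) \<le> dist x y \<Longrightarrow> dist x y < 2 powi (- k) \<Longrightarrow>
      ennreal \<bar>w x - w y\<bar> \<le> ennreal (dist x y powr s) * (g k x + g k y)"
    and xy: "x \<notin> Z" "y \<notin> Z" "dist x y < 8 * (1/2) ^ n"
  shows "ennreal \<bar>w x - w y\<bar> \<le> ennreal ((8 * (1/2) ^ n) powr s) * (Hardy n g x + Hardy n g y)"
proof (cases "x = y")
  case False
  then obtain k where k: "2 powi (- k - 1) \<le> dist x y" "dist x y < 2 powi (- k)"
    using ex_dyadic_scale[of "dist x y"] by auto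
  have "2 powr (real_of_int (- k - 1)) < 2 powr (3 - real n)"
    using k(1) xy(3) unfolding two_powi_eq_powr eight_half_power by linarith
  then have "int n - 3 \<le> k" by simp
  define i where "i = nat (k - (int n - 3))"
  have i: "k = int n - 3 + int i" using \<open>int n - 3 \<le> k\<close> by (simp add: i_def)
  have ds: "dist x y powr s \<le> (8 * (1/2) ^ n) powr s * (2 powr (- s)) ^ i"
  proof -
    have "dist x y powr s \<le> (2 powr (- real_of_int k)) powr s"
      using k(2) s_pos unfolding two_powi_eq_powr by (intro powr_mono2) auto
    also have "\<dots> = 2 powr ((3 - real n) * s) * 2 powr (- s * real i)"
      unfolding i by (simp add: powr_powr powr_add[symmetric] algebra_simps)
    also have "\<dots> = (8 * (1/2) ^ n) powr s * (2 powr (- s)) ^ i"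
      unfolding eight_half_power by (simp add: powr_powr powr_realpow[symmetric])
    finally show ?thesis .
  qed
  have "ennreal \<bar>w x - w y\<bar> \<le> ennreal (dist x y powr s) * (g k x + g k y)" by (rule Z[OF xy(1,2) k])
  also have "\<dots> \<le> ennreal ((8 * (1/2) ^ n) powr s * (2 powr (- s)) ^ i) * (g k x + g k y)"
    using ds by (intro mult_right_mono ennreal_leI) auto
  also have "\<dots> = ennreal ((8 * (1/2) ^ n) powr s) * (ennreal ((2 powr (- s)) ^ i) * g k x + ennreal ((2 powr (- s)) ^ i) * g k y)"
    by (simp add: ennreal_mult distrib_left mult.assoc)
  also have "\<dots> \<le> ennreal ((8 * (1/2) ^ n) powr s) * (Hardy n g x + Hardy n g y)"
    unfolding Hardy_def i by (intro mult_left_mono add_mono SUP_upper) auto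
  finally show ?thesis .
qed simp

text \<open>
  Let \<open>r = 2\<^sup>-\<^sup>n\<close>, \<open>A = Hardy n g\<close>, let \<open>z\<^sub>i\<close> be sampling points for \<open>A\<close> in the balls \<open>B(i, r/2)\<close> of an
  \<open>r\<close>-net, let \<open>f\<close> interpolate the values \<open>u(z\<^sub>i)\<close>, and let \<open>T(x)\<close> be the largest \<open>A(z\<^sub>i)\<close> with \<open>d(x, i) < 3r\<close>.
  With \<open>\<rho> = (8r)\<^sup>s\<close>, the error is at most \<open>\<rho> (A + T)\<close>, and \<open>f\<close> is Lipschitz at scales below \<open>r\<close> with a
  constant of order \<open>\<rho> T / r\<close>. Hence \<open>g\<^sub>k 1\<^bsub>k \<ge> n\<^esub> + 16 K \<theta>\<^bsup>|k - n|\<^esup> (A + T)\<close> is a fractional gradient of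
  the error, and \<open>A\<close> and \<open>T\<close> are bounded in \<open>L\<^sup>p\<close> by the tail of \<open>g\<close>.
\<close>

lemma smooth_approximation:
  obtains C :: ennreal where "C < \<infinity>"
    "\<And>u g n. u \<in> L0 \<mu> \<Longrightarrow> g \<in> fractional_s_gradients \<mu> s u \<Longrightarrow>
      \<exists>f. continuous_on UNIV f \<and> gnorm (\<lambda>x. u x - ereal (f x)) \<le> C * R (from_scale (int n - 3) g)"
proof -
  define \<theta> where "\<theta> = 2 powr (- min s (1 - s))"
  have \<theta>: "0 < \<theta>" "\<theta> < 1"
    using s_pos s_less_1 powr_less_mono[of "- min s (1 - s)" 0 2] by (auto simp: \<theta>_def)
  obtain C1 where C1: "0 \<le> C1" "\<And>n g. \<forall>k. g k \<in> borel_measurable M \<Longrightarrow>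
    Hardy n g \<in> borel_measurable M \<and> Lp_norm M p (Hardy n g) \<le> ennreal C1 * R (from_scale (int n - 3) g)"
    by (rule Hardy_Lp_le) (rule that)
  obtain C2 where C2: "0 \<le> C2"
    "\<And>S r z A. 0 < r \<Longrightarrow> \<forall>i\<in>S. \<forall>j\<in>S. i \<noteq> j \<longrightarrow> r \<le> dist i j \<Longrightarrow> A \<in> borel_measurable M \<Longrightarrow>
      \<forall>i\<in>S. enn_powr (A (z i)) p * \<mu> (ball i (r / 2)) \<le> (\<integral>\<^sup>+x. enn_powr (A x) p * indicator (ball i (r / 2)) x \<partial>M) \<Longrightarrow>
      (\<lambda>x. SUP i\<in>S. A (z i) * indicator (ball i (3 * r)) x) \<in> borel_measurable M \<and>
      Lp_norm M p (\<lambda>x. SUP i\<in>S. A (z i) * indicator (ball i (3 * r)) x) \<le> ennreal C2 * Lp_norm M p A"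
    by (rule sampled_Lp_norm_le[OF p_pos doubling]) (rule that)
  obtain C3 where C3: "0 \<le> C3" "\<And>g h. (\<forall>k. g k \<in> borel_measurable M) \<Longrightarrow> (\<forall>k. h k \<in> borel_measurable M) \<Longrightarrow>
       R (\<lambda>k x. g k x + h k x) \<le> ennreal C3 * (R g + R h)"
    by (rule R_add_le) (rule that)
  obtain C4 :: real where C4: "\<forall>m h. h \<in> borel_measurable M \<longrightarrow>
      R (\<lambda>k x. ennreal (\<theta> ^ nat \<bar>k - m\<bar>) * h x) \<le> ennreal C4 * Lp_norm M p h"
    using R_geometric[OF \<theta>] by (elim exE)
  obtain c where c: "1 \<le> c" "\<And>x r k. 0 < r \<Longrightarrow> \<mu> (ball x (2 ^ k * r)) \<le> ennreal (c ^ k) * \<mu> (ball x r)"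
    by (rule doubling_iterate[OF doubling]) (rule that)
  define K where "K = Suc (nat \<lceil>c ^ (2 + 3)\<rceil>)"
  define C5 where "C5 = (2 * 2 powr (1/p) :: real)"
  define L where "L = ennreal C5 * (ennreal C1 + ennreal C2 * ennreal C1)"
  define B where "B = 16 * real K"
  define C where "C = 8 * L + ennreal C3 * (1 + ennreal B * (ennreal C4 * L))"
  have "C < \<infinity>" by (simp add: C_def L_def ennreal_mult_less_top)
  moreover have "\<exists>f. continuous_on UNIV f \<and> gnorm (\<lambda>x. u x - ereal (f x)) \<le> C * R (from_scale (int n - 3) g)"
    if u: "u \<in> L0 \<mu>" and g: "g \<in> fractional_s_gradients \<mu> s u" for u g n
  proof -
    define Q where "Q = R (from_scale (int n - 3) g)"
    define r :: real where "r = (1/2) ^ n"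
    have r: "0 < r" "r \<le> 1" by (auto simp: r_def power_le_one)
    define \<rho> where "\<rho> = (8 * r) powr s"
    have \<rho>: "0 < \<rho>" "\<rho> \<le> 8"
    proof -
      have "(8 * r) powr s \<le> 8 powr s" using r s_pos by (intro powr_mono2) auto
      also have "8 powr s \<le> 8 powr 1" using s_less_1 by (intro powr_mono) auto
      finally show "\<rho> \<le> 8" by (simp add: \<rho>_def)
    qed (use r in \<open>simp add: \<rho>_def\<close>)
    have gm [measurable]: "g k \<in> borel_measurable M" for k using g by (simp add: fractional_s_gradients_def)
    define A where "A = Hardy n g"
    have Am [measurable]: "A \<in> borel_measurable M" and LpA: "Lp_norm M p A \<le> ennreal C1 * Q"
      using C1(2)[of g n] gm by (auto simp: A_def Q_def)
    obtain E where E: "\<mu> E = 0" "\<forall>k. \<forall>x \<in> - E. \<forall>y \<in> - E.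
         2 powi (- k - 1) \<le> dist x y \<and> dist x y < 2 powi (- k) \<longrightarrow>
         e2ennreal \<bar>u x - u y\<bar> \<le> ennreal (dist x y powr s) * (g k x + g k y)"
      using g unfolding fractional_s_gradients_def by blast
    define Z where "Z = E \<union> {x. \<bar>u x\<bar> = \<infinity>}"
    have Z: "\<mu> Z = 0" unfolding Z_def using E(1) u by (intro null_Un) (auto simp: L0_def)
    define w where "w x = real_of_ereal (u x)" for x
    have uw: "u x = ereal (w x)" if "x \<notin> Z" for x
      using that by (simp add: w_def Z_def ereal_real)
    have wg: "ennreal \<bar>w x - w y\<bar> \<le> ennreal (dist x y powr s) * (g k x + g k y)"
      if "x \<notin> Z" "y \<notin> Z" "2 powi (- k - 1) \<le> dist x y" "dist x y < 2 powi (- k)" for k x y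
    proof -
      have "e2ennreal \<bar>u x - u y\<bar> \<le> ennreal (dist x y powr s) * (g k x + g k y)"
        using E(2) that by (auto simp: Z_def)
      then show ?thesis using uw that by simp
    qed
    have wA: "ennreal \<bar>w x - w y\<bar> \<le> ennreal \<rho> * (A x + A y)" if "x \<notin> Z" "y \<notin> Z" "dist x y < 8 * r" for x y
      using oscillation_le_Hardy[of Z w g x y n, OF wg] that unfolding A_def \<rho>_def r_def by blast
    obtain S :: "'a set" where S: "\<forall>i\<in>S. \<forall>j\<in>S. i \<noteq> j \<longrightarrow> r \<le> dist i j" "\<forall>x. \<exists>i\<in>S. dist x i < r"
      using ex_maximal_separated[OF r(1)] by (elim exE conjE)
    have sep: "r \<le> dist i j" if "i \<in> S" "j \<in> S" "i \<noteq> j" for i j using S(1) that by blast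
    have net: "\<exists>i\<in>S. dist x i < r" for x using S(2) by blast
    have "\<forall>i\<in>S. \<exists>z. z \<in> ball i (r / 2) \<and> z \<notin> Z \<and>
       enn_powr (A z) p * \<mu> (ball i (r / 2)) \<le> (\<integral>\<^sup>+x. enn_powr (A x) p * indicator (ball i (r / 2)) x \<partial>M)"
    proof
      fix i assume "i \<in> S"
      have "0 < r / 2" using r by simp
      from ex_sampling_point[OF p_pos Am Z this, of i]
      show "\<exists>z. z \<in> ball i (r / 2) \<and> z \<notin> Z \<and>
       enn_powr (A z) p * \<mu> (ball i (r / 2)) \<le> (\<integral>\<^sup>+x. enn_powr (A x) p * indicator (ball i (r / 2)) x \<partial>M)"
        unfolding Bex_def .
    qed
    from bchoice[OF this] obtain z where z': "\<forall>i\<in>S. z i \<in> ball i (r / 2) \<and> z i \<notin> Z \<and>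
       enn_powr (A (z i)) p * \<mu> (ball i (r / 2)) \<le> (\<integral>\<^sup>+x. enn_powr (A x) p * indicator (ball i (r / 2)) x \<partial>M)"
      by (elim exE)
    have z: "dist i (z i) < r / 2" "z i \<notin> Z" if "i \<in> S" for i using z' that by auto
    have zA: "\<forall>i\<in>S. enn_powr (A (z i)) p * \<mu> (ball i (r / 2)) \<le> (\<integral>\<^sup>+x. enn_powr (A x) p * indicator (ball i (r / 2)) x \<partial>M)"
      using z' by blast
    define T where "T x = (SUP i\<in>S. A (z i) * indicator (ball i (3 * r)) x)" for x
    have Tm [measurable]: "T \<in> borel_measurable M" and LpT: "Lp_norm M p T \<le> ennreal C2 * Lp_norm M p A"
      using C2(2)[OF r(1) S(1) Am zA] unfolding T_def[abs_def] by auto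
    have T: "A (z i) \<le> T x" if "i \<in> S" "dist x i < 3 * r" for i x
      unfolding T_def using that by (intro SUP_upper2[of i]) (auto simp: dist_commute)
    have fin: "finite {i\<in>S. dist x i < 3 * r}" "card {i\<in>S. dist x i < 3 * r} \<le> K" for x
    proof -
      have sub: "{i\<in>S. dist x i < 3 * r} \<subseteq> {i\<in>S. dist x i < 2 ^ 2 * r}" using r by auto
      have "finite {i\<in>S. dist x i < 2 ^ 2 * r} \<and> card {i\<in>S. dist x i < 2 ^ 2 * r} \<le> nat \<lceil>c ^ (2 + 3)\<rceil>"
        using separated_card_le[of c r S x 2] c r sep by blast
      then show "finite {i\<in>S. dist x i < 3 * r}" "card {i\<in>S. dist x i < 3 * r} \<le> K"
        using sub finite_subset card_mono[of "{i\<in>S. dist x i < 2 ^ 2 * r}" "{i\<in>S. dist x i < 3 * r}"]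
        unfolding K_def by (blast, linarith)
    qed
    obtain f where f: "continuous_on UNIV f"
      and f_near: "\<And>x a H. \<forall>i\<in>S. dist x i < 2 * r \<longrightarrow> \<bar>w (z i) - a\<bar> \<le> H \<Longrightarrow> \<bar>f x - a\<bar> \<le> H"
      and f_Lip: "\<And>x y H. dist x y < r \<Longrightarrow> \<forall>i\<in>S. \<forall>j\<in>S. dist x i < 3 * r \<longrightarrow> dist x j < 3 * r \<longrightarrow> \<bar>w (z i) - w (z j)\<bar> \<le> H \<Longrightarrow>
         \<bar>f x - f y\<bar> \<le> real K * (dist x y / r) * H"
      by (rule partition_of_unity_interpolation[OF r(1) net fin, of "\<lambda>i. w (z i)"]) (rule that)
    have near: "ennreal \<bar>w x - f x\<bar> \<le> ennreal \<rho> * (A x + T x)" if x: "x \<notin> Z" for x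
    proof (cases "A x + T x = \<infinity>")
      case True
      show ?thesis unfolding True using \<rho> by (simp add: ennreal_mult_top)
    next
      case False
      then obtain h where h: "A x + T x = ennreal h" "0 \<le> h" by (cases "A x + T x") auto
      have "\<bar>f x - w x\<bar> \<le> \<rho> * h"
      proof (rule f_near, intro ballI impI)
        fix i assume i: "i \<in> S" "dist x i < 2 * r"
        have "dist (z i) x \<le> dist i (z i) + dist x i" by (metis dist_commute dist_triangle add.commute)
        then have "dist (z i) x < 8 * r" using i z(1)[OF i(1)] r by linarith
        then have "ennreal \<bar>w (z i) - w x\<bar> \<le> ennreal \<rho> * (A (z i) + A x)" using x i z by (intro wA) auto
        also have "\<dots> \<le> ennreal \<rho> * (T x + A x)" using i r by (intro mult_left_mono add_mono T) auto
        also have "\<dots> = ennreal (\<rho> * h)" using h \<rho> by (simp add: ennreal_mult add.commute)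
        finally show "\<bar>w (z i) - w x\<bar> \<le> \<rho> * h" using \<rho> h by (subst (asm) ennreal_le_iff) auto
      qed
      then show ?thesis using h \<rho> by (simp add: ennreal_mult[symmetric] abs_minus_commute ennreal_leI)
    qed
    have Lip: "ennreal \<bar>f x - f y\<bar> \<le> ennreal (real K * (dist x y / r) * (2 * \<rho>)) * T x" if xy: "dist x y < r" "x \<noteq> y" for x y
    proof (cases "T x = \<infinity>")
      case True
      have pos: "0 < real K * (dist x y / r) * (2 * \<rho>)" using r \<rho> xy by (simp add: K_def)
      show ?thesis unfolding True ennreal_pos_mult_top[OF pos] by simp
    next
      case False
      then obtain h where h: "T x = ennreal h" "0 \<le> h" by (cases "T x") auto
      have "\<bar>f x - f y\<bar> \<le> real K * (dist x y / r) * (2 * \<rho> * h)"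
      proof (rule f_Lip[OF xy(1)], intro ballI impI)
        fix i j assume i: "i \<in> S" "dist x i < 3 * r" and j: "j \<in> S" "dist x j < 3 * r"
        have "dist (z i) (z j) \<le> dist (z i) x + dist x (z j)" by (rule dist_triangle)
        moreover have "dist (z i) x \<le> dist i (z i) + dist x i" by (metis dist_commute dist_triangle add.commute)
        moreover have "dist x (z j) \<le> dist x j + dist j (z j)" by (rule dist_triangle)
        ultimately have "dist (z i) (z j) < 8 * r" using i j z(1)[OF i(1)] z(1)[OF j(1)] r by linarith
        then have "ennreal \<bar>w (z i) - w (z j)\<bar> \<le> ennreal \<rho> * (A (z i) + A (z j))" using i j z by (intro wA) auto
        also have "\<dots> \<le> ennreal \<rho> * (T x + T x)" using i j by (intro mult_left_mono add_mono T) auto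
        also have "\<dots> = ennreal (2 * \<rho> * h)" using h \<rho> by (simp add: ennreal_mult[symmetric] mult_ac flip: ennreal_plus)
        finally show "\<bar>w (z i) - w (z j)\<bar> \<le> 2 * \<rho> * h" using \<rho> h by (subst (asm) ennreal_le_iff) auto
      qed
      then have "ennreal \<bar>f x - f y\<bar> \<le> ennreal (real K * (dist x y / r) * (2 * \<rho>) * h)"
        by (intro ennreal_leI) (simp add: mult_ac)
      also have "\<dots> = ennreal (real K * (dist x y / r) * (2 * \<rho>)) * T x"
        unfolding h(1) by (rule ennreal_mult) (use r \<rho> h in auto)
      finally show ?thesis .
    qed
    define v where "v x = u x - ereal (f x)" for x
    have v: "v x = ereal (w x - f x)" if "x \<notin> Z" for x using uw[OF that] by (simp add: v_def)
    define G where "G k x = from_scale (int n) g k x + ennreal B * (ennreal (\<theta> ^ nat \<bar>k - int n\<bar>) * (A x + T x))" for k x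
    have "G \<in> fractional_s_gradients \<mu> s v"
      unfolding fractional_s_gradients_def
    proof (intro CollectI conjI exI[of _ Z] allI ballI impI Z)
      have [measurable]: "from_scale (int n) g k \<in> borel_measurable M" for k using gm by (rule measurable_from_scale)
      show "G k \<in> borel_measurable M" for k unfolding G_def[abs_def] by measurable
      fix k x y assume "x \<in> - Z" "y \<in> - Z" and d: "2 powi (- k - 1) \<le> dist x y \<and> dist x y < 2 powi (- k)"
      then have xy: "x \<notin> Z" "y \<notin> Z" by auto
      have "0 < dist x y" using d by (metis less_le_trans power_int_not_zero zero_less_power_int zero_less_numeral)
      then have d0: "0 < dist x y" "x \<noteq> y" by auto
      have v_eq: "e2ennreal \<bar>v x - v y\<bar> = ennreal \<bar>w x - f x - (w y - f y)\<bar>" using v xy by simp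
      define t where "t = \<theta> ^ nat \<bar>k - int n\<bar>"
      have t: "0 < t" using \<theta> by (simp add: t_def)
      show "e2ennreal \<bar>v x - v y\<bar> \<le> ennreal (dist x y powr s) * (G k x + G k y)"
      proof (cases "int n \<le> k")
        case True
        have "dist x y < 2 powr (- real_of_int k)" using d unfolding two_powi_eq_powr by simp
        moreover have "2 powr (- real_of_int k) \<le> 2 powr (- real n)" using True by (intro powr_mono) auto
        moreover have "2 powr (- real n) = r" by (auto simp: r_def powr_minus powr_realpow power_one_over inverse_eq_divide)
        ultimately have dk: "dist x y < 2 powr (- real_of_int k)" "dist x y < r" by auto
        have "dist x y / r * \<rho> \<le> 8 * dist x y powr s * t"
          using fine_scale_weight[OF s_pos s_less_1 True d0(1) dk(1)]
          unfolding t_def \<theta>_def \<rho>_def r_def by (simp add: power_one_over)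
        then have "2 * real K * (dist x y / r * \<rho>) \<le> 2 * real K * (8 * dist x y powr s * t)" by (intro mult_left_mono) auto
        then have wt: "real K * (dist x y / r) * (2 * \<rho>) \<le> dist x y powr s * (B * t)" by (simp add: B_def mult_ac)
        have "e2ennreal \<bar>v x - v y\<bar> \<le> ennreal (\<bar>w x - w y\<bar> + \<bar>f x - f y\<bar>)"
          unfolding v_eq by (intro ennreal_leI) linarith
        also have "\<dots> = ennreal \<bar>w x - w y\<bar> + ennreal \<bar>f x - f y\<bar>" by simp
        also have "\<dots> \<le> ennreal (dist x y powr s) * (g k x + g k y) + ennreal (dist x y powr s * (B * t)) * T x"
          using xy d by (intro add_mono wg order_trans[OF Lip[OF dk(2) d0(2)]] mult_right_mono ennreal_leI wt) auto
        also have "ennreal (dist x y powr s * (B * t)) * T x = ennreal (dist x y powr s) * (ennreal B * (ennreal t * T x))"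
          using t by (simp add: ennreal_mult B_def mult.assoc)
        also have "ennreal (dist x y powr s) * (g k x + g k y) + \<dots> = ennreal (dist x y powr s) * ((g k x + g k y) + ennreal B * (ennreal t * T x))"
          by (simp only: distrib_left)
        also have "\<dots> \<le> ennreal (dist x y powr s) * (G k x + G k y)"
        proof (rule mult_left_mono)
          have "g k x + g k y + ennreal B * (ennreal t * T x) = (g k x + ennreal B * (ennreal t * T x)) + g k y"
            by (simp only: ac_simps)
          also have "\<dots> \<le> G k x + G k y"
            unfolding G_def t_def[symmetric] from_scale_def using True
            by (intro add_mono mult_left_mono) (auto simp: add_increasing add_increasing2)
          finally show "g k x + g k y + ennreal B * (ennreal t * T x) \<le> G k x + G k y" .
        qed simp
        finally show ?thesis .
      next
        case False
        then have kn: "k < int n" by simp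
        have "2 powr (- real_of_int k - 1) \<le> dist x y" using d unfolding two_powi_eq_powr by simp
        from coarse_scale_weight[OF s_pos s_less_1 kn this]
        have "\<rho> \<le> 16 * dist x y powr s * t" unfolding t_def \<theta>_def \<rho>_def r_def .
        also have "\<dots> \<le> dist x y powr s * (B * t)"
        proof -
          have "16 * (dist x y powr s * t) \<le> B * (dist x y powr s * t)" using t by (intro mult_right_mono) (auto simp: B_def K_def)
          then show ?thesis by (simp add: mult_ac)
        qed
        finally have wt: "\<rho> \<le> dist x y powr s * (B * t)" .
        have "e2ennreal \<bar>v x - v y\<bar> \<le> ennreal (\<bar>w x - f x\<bar> + \<bar>w y - f y\<bar>)"
          unfolding v_eq by (intro ennreal_leI) linarith
        also have "\<dots> = ennreal \<bar>w x - f x\<bar> + ennreal \<bar>w y - f y\<bar>" by simp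
        also have "\<dots> \<le> ennreal \<rho> * (A x + T x) + ennreal \<rho> * (A y + T y)"
          by (intro add_mono near xy)
        also have "\<dots> = ennreal \<rho> * ((A x + T x) + (A y + T y))" by (simp only: distrib_left)
        also have "\<dots> \<le> ennreal (dist x y powr s * (B * t)) * ((A x + T x) + (A y + T y))"
          by (intro mult_right_mono ennreal_leI wt) auto
        also have "\<dots> = ennreal (dist x y powr s) * (ennreal B * (ennreal t * (A x + T x)) + ennreal B * (ennreal t * (A y + T y)))"
        proof -
          have "ennreal (dist x y powr s * (B * t)) = ennreal (dist x y powr s) * (ennreal B * ennreal t)"
            using t by (simp add: ennreal_mult B_def)
          then show ?thesis by (simp only: distrib_left mult.assoc)
        qed
        also have "\<dots> \<le> ennreal (dist x y powr s) * (G k x + G k y)"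
          unfolding G_def t_def[symmetric] by (intro mult_left_mono add_mono) (auto simp: add_increasing)
        finally show ?thesis .
      qed
    qed
    then have INF: "grad_norm v \<le> R G" by (rule INF_lower)
    have LpAT: "Lp_norm M p (\<lambda>x. A x + T x) \<le> L * Q"
    proof -
      have "Lp_norm M p (\<lambda>x. A x + T x) \<le> ennreal C5 * (Lp_norm M p A + Lp_norm M p T)"
        unfolding C5_def by (rule Lp_norm_add_le[OF p_pos Am Tm])
      also have "\<dots> \<le> ennreal C5 * (ennreal C1 * Q + ennreal C2 * (ennreal C1 * Q))"
        by (intro mult_left_mono add_mono LpA order_trans[OF LpT] mult_left_mono LpA) auto
      also have "\<dots> = L * Q" by (simp only: L_def distrib_right distrib_left mult.assoc)
      finally show ?thesis .
    qed
    have RG: "R G \<le> ennreal C3 * (Q + ennreal B * (ennreal C4 * (L * Q)))"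
    proof -
      have m1: "\<forall>k. from_scale (int n) g k \<in> borel_measurable M" using gm by (intro allI measurable_from_scale)
      have "R G \<le> ennreal C3 * (R (from_scale (int n) g) + R (\<lambda>k x. ennreal B * (ennreal (\<theta> ^ nat \<bar>k - int n\<bar>) * (A x + T x))))"
        unfolding G_def by (rule C3(2)[OF m1]) measurable
      also have "\<dots> \<le> ennreal C3 * (Q + ennreal B * (ennreal C4 * (L * Q)))"
      proof (intro mult_left_mono add_mono)
        show "R (from_scale (int n) g) \<le> Q" unfolding Q_def by (rule R_mono) (auto simp: from_scale_def)
        have "R (\<lambda>k x. ennreal B * (ennreal (\<theta> ^ nat \<bar>k - int n\<bar>) * (A x + T x))) = ennreal B * R (\<lambda>k x. ennreal (\<theta> ^ nat \<bar>k - int n\<bar>) * (A x + T x))"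
          by (rule R_cmult) measurable
        also have "\<dots> \<le> ennreal B * (ennreal C4 * Lp_norm M p (\<lambda>x. A x + T x))"
          by (intro mult_left_mono C4[rule_format]) measurable
        also have "\<dots> \<le> ennreal B * (ennreal C4 * (L * Q))" by (intro mult_left_mono LpAT) auto
        finally show "R (\<lambda>k x. ennreal B * (ennreal (\<theta> ^ nat \<bar>k - int n\<bar>) * (A x + T x))) \<le> ennreal B * (ennreal C4 * (L * Q))" .
      qed auto
      finally show ?thesis .
    qed
    have Lpv: "Lp_norm M p (eabs v) \<le> 8 * (L * Q)"
    proof -
      have "AE x in M. eabs v x \<le> ennreal \<rho> * (A x + T x)"
        by (rule AE_M_I[OF Z]) (use near v in \<open>simp add: eabs_def\<close>)
      then have "Lp_norm M p (eabs v) \<le> Lp_norm M p (\<lambda>x. ennreal \<rho> * (A x + T x))" by (rule Lp_norm_mono_AE[OF p_pos])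
      also have "\<dots> = ennreal \<rho> * Lp_norm M p (\<lambda>x. A x + T x)" by (rule Lp_norm_cmult[OF p_pos]) measurable
      also have "\<dots> \<le> 8 * (L * Q)"
      proof (intro mult_mono LpAT)
        have "ennreal \<rho> \<le> ennreal 8" using \<rho> by (intro ennreal_leI)
        then show "ennreal \<rho> \<le> 8" by simp
      qed auto
      finally show ?thesis .
    qed
    have "gnorm v \<le> 8 * (L * Q) + ennreal C3 * (Q + ennreal B * (ennreal C4 * (L * Q)))"
      unfolding gnorm_def by (intro add_mono Lpv order_trans[OF INF RG])
    also have "\<dots> = C * Q" by (simp only: C_def distrib_right distrib_left mult.assoc mult_1)
    finally show ?thesis using f unfolding v_def[abs_def] Q_def by blast
  qed
  ultimately show ?thesis by (rule that)
qed

lemma continuous_dense: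
  assumes u: "u \<in> gspace" and \<epsilon>: "0 < \<epsilon>"
  shows "\<exists>f. continuous_on UNIV f \<and> (\<lambda>x. u x - ereal (f x)) \<in> gspace \<and> gnorm (\<lambda>x. u x - ereal (f x)) < ennreal \<epsilon>"
proof -
  obtain C where C: "C < \<infinity>" "\<And>u g n. u \<in> L0 \<mu> \<Longrightarrow> g \<in> fractional_s_gradients \<mu> s u \<Longrightarrow>
      \<exists>f. continuous_on UNIV f \<and> gnorm (\<lambda>x. u x - ereal (f x)) \<le> C * R (from_scale (int n - 3) g)"
    by (rule smooth_approximation) (rule that)
  have uL0: "u \<in> L0 \<mu>" using u by (simp add: gspace_def Lp_def)
  have "grad_norm u < \<infinity>"
    using u by (auto simp: gspace_def gnorm_def less_top[symmetric])
  then obtain g where g: "g \<in> fractional_s_gradients \<mu> s u" "R g < \<infinity>" unfolding INF_less_iff by blast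
  have "g k \<in> borel_measurable M" for k using g(1) by (simp add: fractional_s_gradients_def)
  then have "(\<lambda>n::nat. C * R (from_scale (int n - 3) g)) \<longlonglongrightarrow> C * 0"
    using C(1) by (intro ennreal_tendsto_cmult R_from_scale g(2)) auto
  then have "\<forall>\<^sub>F n in sequentially. C * R (from_scale (int n - 3) g) < ennreal \<epsilon>"
    using \<epsilon> by (simp add: order_tendsto_iff)
  then obtain n :: nat where n: "C * R (from_scale (int n - 3) g) < ennreal \<epsilon>"
    by (auto simp: eventually_sequentially)
  obtain f where f: "continuous_on UNIV f" "gnorm (\<lambda>x. u x - ereal (f x)) \<le> C * R (from_scale (int n - 3) g)"
    using C(2)[OF uL0 g(1)] by blast
  define v where "v x = u x - ereal (f x)" for x
  have N: "gnorm v < ennreal \<epsilon>" unfolding v_def[abs_def] using f(2) n by (rule le_less_trans)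
  have Nfin: "gnorm v < \<infinity>" using N by (rule less_trans) simp
  then have "Lp_norm M p (eabs v) < \<infinity>" by (simp add: gnorm_def less_top[symmetric])
  moreover have "v \<in> L0 \<mu>" unfolding v_def[abs_def] by (rule L0_diff_continuous[OF uL0 f(1)])
  ultimately have "v \<in> gspace" using Nfin by (simp add: gspace_def Lp_def)
  with N f(1) show ?thesis unfolding v_def[abs_def] by blast
qed

end

section \<open>The function spaces\<close>

text \<open>
  Apply \<open>Lp_norm_SUP_le\<close> with \<open>\<surd>\<theta>\<close> to the layers \<open>|k - m| = i\<close>, each of which has at most two
  elements.
\<close>

lemma lq_norm_geometric:
  assumes q: "0 < q" "q < \<infinity>" and \<theta>: "0 < \<theta>" "\<theta> < 1"
  obtains C :: real where "\<And>m. lq_norm q (\<lambda>k. ennreal (\<theta> ^ nat \<bar>k - m\<bar>)) \<le> ennreal C"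
proof -
  \<comment> \<open>Half of the decay pays for the weights in the supremum.\<close>
  define t where "t = sqrt \<theta>"
  have t: "0 < t" "t < 1" "t * t = \<theta>" using \<theta> by (auto simp: t_def)
  define q' where "q' = enn2real q"
  have q': "0 < q'" using q by (simp add: q'_def enn2real_pos)
  obtain C :: real where C: "0 < C" "\<And>(M :: int measure) (f :: nat \<Rightarrow> int \<Rightarrow> ennreal). \<forall>i. f i \<in> borel_measurable M \<Longrightarrow>
       Lp_norm M q' (\<lambda>x. SUP i. f i x) \<le> ennreal C * (SUP i. ennreal ((1/t) ^ i) * Lp_norm M q' (f i))"
    by (rule Lp_norm_SUP_le[OF q' t(1,2)]) (rule that)
  show ?thesis
  proof (rule that[of "C * 2 powr (1/q')"])
    fix m :: int
    define D where "D i = {k. nat \<bar>k - m\<bar> = i}" for i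
    define f where "f i k = ennreal (\<theta> ^ i) * indicator (D i) k" for i k
    have "ennreal (\<theta> ^ nat \<bar>k - m\<bar>) \<le> (SUP i. f i k)" for k
      by (rule SUP_upper2[of "nat \<bar>k - m\<bar>"]) (auto simp: f_def D_def)
    then have "lq_norm q (\<lambda>k. ennreal (\<theta> ^ nat \<bar>k - m\<bar>)) \<le> lq_norm q (\<lambda>k. SUP i. f i k)"
      by (rule lq_norm_mono[OF q(1)])
    also have "\<dots> = Lp_norm (count_space UNIV) q' (\<lambda>k. SUP i. f i k)" using q(2) by (simp add: lq_norm_finite q'_def)
    also have "\<dots> \<le> ennreal C * (SUP i. ennreal ((1/t) ^ i) * Lp_norm (count_space UNIV) q' (f i))" by (rule C(2)) simp
    also have "\<dots> \<le> ennreal C * ennreal (2 powr (1/q'))"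
    proof (intro mult_left_mono SUP_least)
      fix i :: nat
      have "D i \<subseteq> {m + int i, m - int i}" by (auto simp: D_def)
      then have D: "finite (D i)" "card (D i) \<le> 2"
        using finite_subset card_mono[of "{m + int i, m - int i}" "D i"] by (auto intro: order_trans[OF _ card_insert_le_m1])
      have "Lp_norm (count_space UNIV) q' (f i) = ennreal (\<theta> ^ i) * Lp_norm (count_space UNIV) q' (indicator (D i))"
        unfolding f_def[abs_def] by (rule Lp_norm_cmult[OF q']) simp
      also have "Lp_norm (count_space UNIV) q' (indicator (D i)) = enn_powr (of_nat (card (D i))) (1/q')"
      proof -
        have "enn_powr (indicator (D i) k) q' = indicator (D i) k" for k by (auto split: split_indicator)
        then show ?thesis using D by (simp add: Lp_norm_def)
      qed
      also have "\<dots> \<le> enn_powr (ennreal 2) (1/q')"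
      proof (rule enn_powr_mono)
        have "real (card (D i)) \<le> 2" using D(2) by simp
        then show "of_nat (card (D i)) \<le> ennreal 2"
          unfolding ennreal_of_nat_eq_real_of_nat by (rule ennreal_leI)
      qed (use q' in simp)
      also have "\<dots> = ennreal (2 powr (1/q'))" by (rule enn_powr_ennreal) simp
      finally have "ennreal ((1/t) ^ i) * Lp_norm (count_space UNIV) q' (f i) \<le> ennreal ((1/t) ^ i) * (ennreal (\<theta> ^ i) * ennreal (2 powr (1/q')))"
        by (simp add: mult_left_mono)
      also have "\<dots> = ennreal (t ^ i) * ennreal (2 powr (1/q'))"
      proof -
        have "(1/t) ^ i * \<theta> ^ i = t ^ i" using t(1) unfolding t(3)[symmetric] by (simp add: power_mult_distrib[symmetric])
        then have "ennreal ((1/t) ^ i) * ennreal (\<theta> ^ i) = ennreal (t ^ i)" using t \<theta> by (simp add: ennreal_mult[symmetric])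
        then show ?thesis by (simp add: mult.assoc[symmetric])
      qed
      also have "\<dots> \<le> 1 * ennreal (2 powr (1/q'))"
      proof (rule mult_right_mono)
        have "t ^ i \<le> 1" using t by (intro power_le_one) auto
        then have "ennreal (t ^ i) \<le> ennreal 1" by (rule ennreal_leI)
        then show "ennreal (t ^ i) \<le> 1" by simp
      qed simp
      finally show "ennreal ((1/t) ^ i) * Lp_norm (count_space UNIV) q' (f i) \<le> ennreal (2 powr (1/q'))" by simp
    qed simp
    also have "\<dots> = ennreal (C * 2 powr (1/q'))" using C(1) by (simp add: ennreal_mult)
    finally show "lq_norm q (\<lambda>k. ennreal (\<theta> ^ nat \<bar>k - m\<bar>)) \<le> ennreal (C * 2 powr (1/q'))" .
  qed
qed

lemma lq_norm_tendsto_0_dominated: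
  assumes q: "0 < q" "q < \<infinity>" and fin: "lq_norm q b < \<infinity>" and le: "\<And>n k. a n k \<le> b k"
    and lim: "\<And>k. (\<lambda>n::nat. a n k) \<longlonglongrightarrow> 0"
  shows "(\<lambda>n. lq_norm q (a n)) \<longlonglongrightarrow> 0"
  unfolding lq_norm_finite[OF q(2)]
  by (rule Lp_norm_tendsto_0_dominated[OF enn2real_pos[OF q], of _ _ b])
    (use fin le lim in \<open>auto simp: lq_norm_finite[OF q(2)]\<close>)

lemma from_scale_tendsto_0: "(\<lambda>n::nat. from_scale (int n - 3) g k x) \<longlonglongrightarrow> 0"
  by (rule tendsto_eventually)
    (auto simp: from_scale_def eventually_sequentially intro!: exI[of _ "nat (k + 4)"])

lemma from_scale_le: "from_scale m g k x \<le> g k x"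
  by (simp add: from_scale_def)

context mm_space
begin

lemma smoothable_TL:
  assumes p: "0 < p" and s: "0 < s" "s < 1" and q: "0 < q" "q < \<infinity>" and dbl: "doubling \<mu>"
  shows "smoothable_gradient_space \<mu> p s (TL_norm M p q)"
proof -
  interpret gradient_space \<mu> p s "TL_norm M p q" by (rule gradient_space_TL[OF p s(1) q(1)])
  show ?thesis
  proof unfold_locales
    show "Lp_norm M p (g k) \<le> TL_norm M p q g" for g k
      unfolding TL_norm_def by (intro Lp_norm_mono p le_lq_norm q)
  next
    fix \<theta> :: real assume \<theta>: "0 < \<theta>" "\<theta> < 1"
    obtain C where C: "\<And>m. lq_norm q (\<lambda>k. ennreal (\<theta> ^ nat \<bar>k - m\<bar>)) \<le> ennreal C"
      by (rule lq_norm_geometric[OF q \<theta>]) (rule that)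
    show "\<exists>C::real. \<forall>m h. h \<in> borel_measurable M \<longrightarrow>
      TL_norm M p q (\<lambda>k x. ennreal (\<theta> ^ nat \<bar>k - m\<bar>) * h x) \<le> ennreal C * Lp_norm M p h"
    proof (intro exI[of _ C] allI impI)
      fix m and h :: "'a \<Rightarrow> ennreal" assume [measurable]: "h \<in> borel_measurable M"
      have "lq_norm q (\<lambda>k. ennreal (\<theta> ^ nat \<bar>k - m\<bar>) * h x) \<le> ennreal C * h x" for x
      proof -
        have "lq_norm q (\<lambda>k. ennreal (\<theta> ^ nat \<bar>k - m\<bar>) * h x) = lq_norm q (\<lambda>k. ennreal (\<theta> ^ nat \<bar>k - m\<bar>)) * h x"
          using lq_norm_cmult[OF q(1), of "h x" "\<lambda>k. ennreal (\<theta> ^ nat \<bar>k - m\<bar>)"] by (simp add: mult.commute)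
        also have "\<dots> \<le> ennreal C * h x" using C by (rule mult_right_mono) simp
        finally show ?thesis .
      qed
      then have "TL_norm M p q (\<lambda>k x. ennreal (\<theta> ^ nat \<bar>k - m\<bar>) * h x) \<le> Lp_norm M p (\<lambda>x. ennreal C * h x)"
        unfolding TL_norm_def by (rule Lp_norm_mono[OF p])
      also have "\<dots> = ennreal C * Lp_norm M p h" by (rule Lp_norm_cmult[OF p]) measurable
      finally show "TL_norm M p q (\<lambda>k x. ennreal (\<theta> ^ nat \<bar>k - m\<bar>) * h x) \<le> ennreal C * Lp_norm M p h" .
    qed
  next
    fix g :: "int \<Rightarrow> 'a \<Rightarrow> ennreal" assume gm: "\<And>k. g k \<in> borel_measurable M" and fin: "TL_norm M p q g < \<infinity>"
    have m: "(\<lambda>x. lq_norm q (\<lambda>k. g k x)) \<in> borel_measurable M" using gm by (rule measurable_lq_norm)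
    show "(\<lambda>n::nat. TL_norm M p q (from_scale (int n - 3) g)) \<longlonglongrightarrow> 0"
      unfolding TL_norm_def
    proof (rule Lp_norm_tendsto_0_dominated[OF p _ m fin[unfolded TL_norm_def]])
      show "(\<lambda>x. lq_norm q (\<lambda>k. from_scale (int n - 3) g k x)) \<in> borel_measurable M" for n
        using gm by (intro measurable_lq_norm measurable_from_scale)
      show "AE x in M. lq_norm q (\<lambda>k. from_scale (int n - 3) g k x) \<le> lq_norm q (\<lambda>k. g k x)" for n
        by (intro always_eventually allI lq_norm_mono q from_scale_le)
      have "AE x in M. lq_norm q (\<lambda>k. g k x) \<noteq> \<infinity>" by (rule Lp_norm_finite_AE[OF p m fin[unfolded TL_norm_def]])
      then show "AE x in M. (\<lambda>n. lq_norm q (\<lambda>k. from_scale (int n - 3) g k x)) \<longlonglongrightarrow> 0"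
      proof eventually_elim
        fix x assume "lq_norm q (\<lambda>k. g k x) \<noteq> \<infinity>"
        then have "lq_norm q (\<lambda>k. g k x) < \<infinity>" by (simp add: less_top)
        then show "(\<lambda>n. lq_norm q (\<lambda>k. from_scale (int n - 3) g k x)) \<longlonglongrightarrow> 0"
          by (rule lq_norm_tendsto_0_dominated[OF q]) (rule from_scale_le from_scale_tendsto_0)+
      qed
    qed
  qed (use s dbl in auto)
qed

lemma smoothable_Besov:
  assumes p: "0 < p" and s: "0 < s" "s < 1" and q: "0 < q" "q < \<infinity>" and dbl: "doubling \<mu>"
  shows "smoothable_gradient_space \<mu> p s (Besov_norm M p q)"
proof -
  interpret gradient_space \<mu> p s "Besov_norm M p q" by (rule gradient_space_Besov[OF p s(1) q(1)])
  show ?thesis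
  proof unfold_locales
    show "Lp_norm M p (g k) \<le> Besov_norm M p q g" for g k
      unfolding Besov_norm_def by (rule le_lq_norm[OF q(1)])
  next
    fix \<theta> :: real assume \<theta>: "0 < \<theta>" "\<theta> < 1"
    obtain C where C: "\<And>m. lq_norm q (\<lambda>k. ennreal (\<theta> ^ nat \<bar>k - m\<bar>)) \<le> ennreal C"
      by (rule lq_norm_geometric[OF q \<theta>]) (rule that)
    show "\<exists>C::real. \<forall>m h. h \<in> borel_measurable M \<longrightarrow>
      Besov_norm M p q (\<lambda>k x. ennreal (\<theta> ^ nat \<bar>k - m\<bar>) * h x) \<le> ennreal C * Lp_norm M p h"
    proof (intro exI[of _ C] allI impI)
      fix m and h :: "'a \<Rightarrow> ennreal" assume [measurable]: "h \<in> borel_measurable M"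
      have "Besov_norm M p q (\<lambda>k x. ennreal (\<theta> ^ nat \<bar>k - m\<bar>) * h x) = lq_norm q (\<lambda>k. Lp_norm M p h * ennreal (\<theta> ^ nat \<bar>k - m\<bar>))"
        unfolding Besov_norm_def
        by (subst Lp_norm_cmult[OF p]) (simp_all add: mult.commute)
      also have "\<dots> = Lp_norm M p h * lq_norm q (\<lambda>k. ennreal (\<theta> ^ nat \<bar>k - m\<bar>))" by (rule lq_norm_cmult[OF q(1)])
      also have "\<dots> \<le> Lp_norm M p h * ennreal C" using C by (rule mult_left_mono) simp
      finally show "Besov_norm M p q (\<lambda>k x. ennreal (\<theta> ^ nat \<bar>k - m\<bar>) * h x) \<le> ennreal C * Lp_norm M p h"
        by (simp add: mult.commute)
    qed
  next
    fix g :: "int \<Rightarrow> 'a \<Rightarrow> ennreal" assume gm: "\<And>k. g k \<in> borel_measurable M" and fin: "Besov_norm M p q g < \<infinity>"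
    show "(\<lambda>n::nat. Besov_norm M p q (from_scale (int n - 3) g)) \<longlonglongrightarrow> 0"
      unfolding Besov_norm_def
    proof (rule lq_norm_tendsto_0_dominated[OF q fin[unfolded Besov_norm_def]])
      show "Lp_norm M p (from_scale (int n - 3) g k) \<le> Lp_norm M p (g k)" for n k
        by (intro Lp_norm_mono p from_scale_le)
      show "(\<lambda>n. Lp_norm M p (from_scale (int n - 3) g k)) \<longlonglongrightarrow> 0" for k
      proof (rule tendsto_eventually)
        have "Lp_norm M p (from_scale (int n - 3) g k) = 0" if "nat (k + 4) \<le> n" for n
        proof -
          have "from_scale (int n - 3) g k = (\<lambda>x. 0)" using that by (auto simp: from_scale_def fun_eq_iff)
          then show ?thesis by simp
        qed
        then show "\<forall>\<^sub>F n in sequentially. Lp_norm M p (from_scale (int n - 3) g k) = 0"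
          by (auto simp: eventually_sequentially)
      qed
    qed
  qed (use s dbl in auto)
qed

lemma gnorm_TL:
  assumes "0 < p" "0 < s" "0 < q"
  shows "gradient_space.gnorm \<mu> p s (TL_norm M p q) = hajlasz_triebel_lizorkin_norm \<mu> s p q"
    "gradient_space.gspace \<mu> p s (TL_norm M p q) = hajlasz_triebel_lizorkin_space \<mu> s p q"
proof -
  interpret gradient_space \<mu> p s "TL_norm M p q" by (rule gradient_space_TL[OF assms])
  show 1: "gnorm = hajlasz_triebel_lizorkin_norm \<mu> s p q"
    by (simp add: fun_eq_iff gnorm_def hajlasz_triebel_lizorkin_norm_def TL_norm_def)
  show "gspace = hajlasz_triebel_lizorkin_space \<mu> s p q"
    by (simp add: gspace_def hajlasz_triebel_lizorkin_space_def 1)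
qed

lemma gnorm_Besov:
  assumes "0 < p" "0 < s" "0 < q"
  shows "gradient_space.gnorm \<mu> p s (Besov_norm M p q) = hajlasz_besov_norm \<mu> s p q"
    "gradient_space.gspace \<mu> p s (Besov_norm M p q) = hajlasz_besov_space \<mu> s p q"
proof -
  interpret gradient_space \<mu> p s "Besov_norm M p q" by (rule gradient_space_Besov[OF assms])
  show 1: "gnorm = hajlasz_besov_norm \<mu> s p q"
    by (simp add: fun_eq_iff gnorm_def hajlasz_besov_norm_def Besov_norm_def)
  show "gspace = hajlasz_besov_space \<mu> s p q"
    by (simp add: gspace_def hajlasz_besov_space_def 1)
qed

lemma TL_top_space_eq_hajlasz_space:
  "hajlasz_triebel_lizorkin_space \<mu> s p \<infinity> = hajlasz_space \<mu> s p"
  unfolding hajlasz_triebel_lizorkin_space_def hajlasz_space_def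
  using TL_top_norm_eq_hajlasz_norm[of _ s p] by (auto simp: Lp_def)

lemma capacity_space_TL:
  assumes "0 < p" "0 < s" "s < 1" "0 < q" "q < \<infinity>" "doubling \<mu>"
  shows "capacity_space \<mu> (hajlasz_triebel_lizorkin_space \<mu> s p q) (hajlasz_triebel_lizorkin_norm \<mu> s p q) p"
proof -
  interpret smoothable_gradient_space \<mu> p s "TL_norm M p q" using assms by (rule smoothable_TL)
  show ?thesis using capacity_spaceI[OF continuous_dense] assms by (simp add: gnorm_TL)
qed

lemma capacity_space_Besov:
  assumes "0 < p" "0 < s" "s < 1" "0 < q" "q < \<infinity>" "doubling \<mu>"
  shows "capacity_space \<mu> (hajlasz_besov_space \<mu> s p q) (hajlasz_besov_norm \<mu> s p q) p"
proof -
  interpret smoothable_gradient_space \<mu> p s "Besov_norm M p q" using assms by (rule smoothable_Besov)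
  show ?thesis using capacity_spaceI[OF continuous_dense] assms by (simp add: gnorm_Besov)
qed

lemma capacity_space_TL_top:
  assumes "0 < p" "0 < s" "s \<le> 1"
  shows "capacity_space \<mu> (hajlasz_triebel_lizorkin_space \<mu> s p \<infinity>) (hajlasz_triebel_lizorkin_norm \<mu> s p \<infinity>) p"
proof -
  have top: "(0::ennreal) < \<infinity>" by simp
  interpret gradient_space \<mu> p s "TL_norm M p \<infinity>" by (rule gradient_space_TL[OF assms(1,2) top])
  note eq = gnorm_TL[OF assms(1,2) top]
  have "capacity_space \<mu> gspace gnorm p"
  proof (rule capacity_spaceI)
    fix u \<epsilon> assume u: "u \<in> gspace" and \<epsilon>: "0 < (\<epsilon>::real)"
    have "u \<in> hajlasz_space \<mu> s p" using u unfolding eq TL_top_space_eq_hajlasz_space .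
    from hajlasz_continuous_dense[OF assms this \<epsilon>]
    obtain f where f: "continuous_on UNIV f" "(\<lambda>x. u x - ereal (f x)) \<in> hajlasz_space \<mu> s p"
      "hajlasz_norm \<mu> s p (\<lambda>x. u x - ereal (f x)) < ennreal \<epsilon>" by (elim exE conjE)
    have "(\<lambda>x. u x - ereal (f x)) \<in> L0 \<mu>" using f(2) by (simp add: hajlasz_space_def Lp_def)
    then have "gnorm (\<lambda>x. u x - ereal (f x)) < ennreal \<epsilon>"
      using f(3) unfolding eq by (simp only: TL_top_norm_eq_hajlasz_norm)
    then show "\<exists>f. continuous_on UNIV f \<and> (\<lambda>x. u x - ereal (f x)) \<in> gspace \<and> gnorm (\<lambda>x. u x - ereal (f x)) < ennreal \<epsilon>"
      using f(1,2) unfolding eq TL_top_space_eq_hajlasz_space by blast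
  qed
  then show ?thesis unfolding eq .
qed

lemma capacity_space_cong:
  assumes cs: "capacity_space \<mu> F N p" and eq: "\<And>u. u \<in> F \<Longrightarrow> N u = N' u"
  shows "capacity_space \<mu> F N' p"
proof -
  interpret capacity_space \<mu> F N p by (rule cs)
  show ?thesis
  proof unfold_locales
    show "u \<in> F \<Longrightarrow> N' u < \<infinity>" for u using N_fin[of u] by (simp add: eq)
    show "u \<in> F \<Longrightarrow> Lp_norm M p (eabs u) \<le> N' u" for u using Lp_le_N[of u] by (simp add: eq)
    show "N' (\<lambda>_. 0) = 0" using zero_F by (simp add: eq)
    show "u \<in> F \<Longrightarrow> 0 < c \<Longrightarrow> N' (\<lambda>x. ereal c * u x) \<le> ennreal c * N' u" for u c
      using scale_F[of u c] by (simp add: eq)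
    obtain K :: real where K: "\<forall>v w. v \<in> borel_measurable M \<longrightarrow> (\<forall>i. w i \<in> F) \<longrightarrow>
           sup_dominated \<mu> v w \<longrightarrow> (SUP i. 4 ^ i * N (w i)) < \<infinity> \<longrightarrow>
           v \<in> F \<and> N v \<le> ennreal K * (SUP i. 4 ^ i * N (w i))"
      using dominated_F by (elim exE)
    show "\<exists>K::real. \<forall>v w. v \<in> borel_measurable M \<longrightarrow> (\<forall>i. w i \<in> F) \<longrightarrow>
           sup_dominated \<mu> v w \<longrightarrow> (SUP i. 4 ^ i * N' (w i)) < \<infinity> \<longrightarrow>
           v \<in> F \<and> N' v \<le> ennreal K * (SUP i. 4 ^ i * N' (w i))"
    proof (rule exI[of _ K], intro allI impI)
      fix v and w :: "nat \<Rightarrow> 'a \<Rightarrow> ereal"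
      assume *: "v \<in> borel_measurable M" "\<forall>i. w i \<in> F" "sup_dominated \<mu> v w" "(SUP i. 4 ^ i * N' (w i)) < \<infinity>"
      then have S: "(SUP i. 4 ^ i * N' (w i)) = (SUP i. 4 ^ i * N (w i))" by (simp add: eq)
      have "v \<in> F \<and> N v \<le> ennreal K * (SUP i. 4 ^ i * N (w i))"
        using K *(1-3) *(4)[unfolded S] by blast
      then show "v \<in> F \<and> N' v \<le> ennreal K * (SUP i. 4 ^ i * N' (w i))" unfolding S using eq[of v] by auto
    qed
    show "\<exists>f. continuous_on UNIV f \<and> (\<lambda>x. u x - ereal (f x)) \<in> F \<and> N' (\<lambda>x. u x - ereal (f x)) < ennreal \<epsilon>"
      if u: "u \<in> F" and \<epsilon>: "0 < \<epsilon>" for u \<epsilon>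
      using dense_F[OF u \<epsilon>] eq by auto
  qed (fact p_pos F_meas zero_F scale_F)+
qed

lemma capacity_space_hajlasz:
  assumes "0 < p" "0 < s" "s \<le> 1"
  shows "capacity_space \<mu> (hajlasz_space \<mu> s p) (hajlasz_norm \<mu> s p) p"
proof (rule capacity_space_cong)
  show "capacity_space \<mu> (hajlasz_space \<mu> s p) (hajlasz_triebel_lizorkin_norm \<mu> s p \<infinity>) p"
    using capacity_space_TL_top[OF assms] unfolding TL_top_space_eq_hajlasz_space .
  show "hajlasz_triebel_lizorkin_norm \<mu> s p \<infinity> u = hajlasz_norm \<mu> s p u" if "u \<in> hajlasz_space \<mu> s p" for u
    using that by (intro TL_top_norm_eq_hajlasz_norm) (simp add: hajlasz_space_def Lp_def)
qed

end

theorem theorem4p11: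
  fixes \<mu> :: "'a::metric_space set \<Rightarrow> ennreal"
    and \<B> :: "'a \<Rightarrow> 'a set set"
    and s p :: real and q :: ennreal
    and F :: "('a \<Rightarrow> ereal) set" and N :: "('a \<Rightarrow> ereal) \<Rightarrow> ennreal"
  assumes "metric_measure_space \<mu>" and "doubling \<mu>"
    and "differentiation_basis \<mu> \<B>"
    and "0 < p"
    and "(0 < s \<and> s < 1 \<and> 0 < q \<and> q < \<infinity> \<and>
            (F = hajlasz_besov_space \<mu> s p q \<and> N = hajlasz_besov_norm \<mu> s p q \<or>
             F = hajlasz_triebel_lizorkin_space \<mu> s p q \<and>
             N = hajlasz_triebel_lizorkin_norm \<mu> s p q)) \<or>
         (0 < s \<and> s \<le> 1 \<and>
            (F = hajlasz_triebel_lizorkin_space \<mu> s p \<infinity> \<and>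
             N = hajlasz_triebel_lizorkin_norm \<mu> s p \<infinity> \<or>
             F = hajlasz_space \<mu> s p \<and> N = hajlasz_norm \<mu> s p))"
  defines "claim1 \<equiv>
      (\<forall>u \<in> F. quasicontinuous F N p u \<longrightarrow>
         (\<exists>E. capacity F N p E = 0 \<and>
            (\<forall>\<gamma>::real. 0 < \<gamma> \<and> \<gamma> < 1 \<longrightarrow>
               (\<forall>x \<in> - E. has_basis_limit \<B> x (median \<mu> \<gamma> u) (u x)))))"
    and "claim2 \<equiv>
      (\<forall>\<gamma>::real. 0 < \<gamma> \<and> \<gamma> < 1 \<longrightarrow>
         (\<exists>C::real. 0 \<le> C \<and> (\<forall>t::real. 0 < t \<longrightarrow> (\<forall>u \<in> F.
            capacity F N p {x. basis_limsup \<B> x (median \<mu> \<gamma> (\<lambda>y. \<bar>u y\<bar>)) > ereal t}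
              \<le> ennreal (C * t powr (- p)) * enn_powr (N u) p))))"
    and "claim3 \<equiv>
      (\<forall>\<gamma>::real. 0 < \<gamma> \<and> \<gamma> < 1 \<longrightarrow> (\<forall>t::real. 0 < t \<longrightarrow>
         (\<forall>u :: nat \<Rightarrow> 'a \<Rightarrow> ereal. (\<forall>k. u k \<in> F) \<and> (\<lambda>k. N (u k)) \<longlonglongrightarrow> 0 \<longrightarrow>
            (\<lambda>k. capacity F N p
                   {x. basis_limsup \<B> x (median \<mu> \<gamma> (\<lambda>y. \<bar>u k y\<bar>)) > ereal t}) \<longlonglongrightarrow> 0)))"
  shows "(claim1 \<longleftrightarrow> claim2) \<and> (claim2 \<longleftrightarrow> claim3)"
proof -
  interpret mm_space \<mu> by standard (rule assms)
  have "capacity_space \<mu> F N p"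
    using assms(5) capacity_space_Besov[OF assms(4) _ _ _ _ assms(2)] capacity_space_TL[OF assms(4) _ _ _ _ assms(2)]
      capacity_space_TL_top[OF assms(4)] capacity_space_hajlasz[OF assms(4)]
    by blast
  then show ?thesis
    unfolding claim1_def claim2_def claim3_def
    using assms(3) by (rule capacity_space.Lebesgue_points_iff_weak_type)
qed

end
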